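(* Fix any $p\times q$ integer matrix $A$. Then there is a polynomial time algorithm that, given any positive integer $n$ and any integer vectors $b=(b^0,b^1,\dots,b^n)$ and $c=(c^1,\dots,c^n)$, with $b^0\in\mathbb{Z}^q$, and $b^k\in\mathbb{Z}^p$ and $c^k\in\mathbb{Z}^q$ for $k=1,\dots,n$, solves the $n$-fold integer programming problem $$\min\Big\{\sum_{k=1}^n c^k x^k\ :\ \sum_{k=1}^n x^k=b^0,\ \ Ax^k=b^k\ \text{and}\ x^k\in\mathbb{N}^q\ \text{for } k=1,\dots,n\Big\}.$$
   Context: $\mathbb{N}$ denotes the set of nonnegative integers, and $c^kx^k$ denotes the standard inner product. Solving an integer program means that the algorithm concludes with precisely one of the following correct outputs: it asserts that there is no feasible solution, or it asserts that the objective function is unbounded (below) on the feasible set, or it returns an optimal solution. The matrix $A$ (hence $p,q$) is fixed and not part of the input. The input size is $n$ (its value, not its bit length) plus the bit size of the integer vectors $b$ and $c$ (binary encoding); polynomial time means polynomial in this input size, where the polynomial may depend on $A$. *)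

theory Defs
  imports
    Jordan_Normal_Form.Matrix
    "HOL-Computational_Algebra.Polynomial"
    "HOL-Library.Log_Nat"
begin

section \<open>A random access machine with logarithmic cost\<close>

text \<open>
  Polynomial time is measured on a deterministic random access machine over the integers under
  the logarithmic (bit) cost criterion, programmed with structured control flow. This model is
  polynomially equivalent to multitape Turing machines. The memory consists of integer registers
  and of integer-indexed integer arrays. Programs are finite and address registers and arrays by
  constants, so each uses finitely many registers and arrays; the array cells are the unbounded
  addressable memory.
\<close>

record state =
  regs :: "nat \<Rightarrow> int"
  arrs :: "nat \<Rightarrow> int \<Rightarrow> int"

datatype aexp =
    Const int
  | Reg nat
  | Cell nat aexp
  | Add aexp aexp
  | Sub aexp aexp
  | Mult aexp aexp
  | Div aexp aexp

datatype bexp =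
    Less aexp aexp
  | Neg bexp
  | Conj bexp bexp

datatype com =
    Skip
  | Assign nat aexp
  | Store nat aexp aexp
  | Seq com com
  | If bexp com com
  | While bexp com

text \<open>\<open>Div\<close> is floor division, with value \<open>0\<close> if the divisor is \<open>0\<close>.\<close>

fun aval :: "aexp \<Rightarrow> state \<Rightarrow> int" where
  "aval (Const z) s = z"
| "aval (Reg r) s = regs s r"
| "aval (Cell a e) s = arrs s a (aval e s)"
| "aval (Add e f) s = aval e s + aval f s"
| "aval (Sub e f) s = aval e s - aval f s"
| "aval (Mult e f) s = aval e s * aval f s"
| "aval (Div e f) s = aval e s div aval f s"

fun bval :: "bexp \<Rightarrow> state \<Rightarrow> bool" where
  "bval (Less e f) s = (aval e s < aval f s)"
| "bval (Neg b) s = (\<not> bval b s)"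
| "bval (Conj b d) s = (bval b s \<and> bval d s)"

text \<open>Binary length, including one bit for the sign; in particular positive for every integer.\<close>

definition bit_size :: "int \<Rightarrow> nat" where
  "bit_size z = nat (bitlen \<bar>z\<bar>) + 1"

text \<open>
  Every value occurring during an evaluation, including operands and array indices, is charged
  its binary length. Hence no value of superpolynomial binary length can be created or used in
  polynomial time, even by iterated multiplication.
\<close>

fun acost :: "aexp \<Rightarrow> state \<Rightarrow> nat" where
  "acost (Const z) s = bit_size z"
| "acost (Reg r) s = bit_size (regs s r)"
| "acost (Cell a e) s = acost e s + bit_size (aval (Cell a e) s)"
| "acost (Add e f) s = acost e s + acost f s + bit_size (aval (Add e f) s)"
| "acost (Sub e f) s = acost e s + acost f s + bit_size (aval (Sub e f) s)"
| "acost (Mult e f) s = acost e s + acost f s + bit_size (aval (Mult e f) s)"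
| "acost (Div e f) s = acost e s + acost f s + bit_size (aval (Div e f) s)"

fun bcost :: "bexp \<Rightarrow> state \<Rightarrow> nat" where
  "bcost (Less e f) s = acost e s + acost f s + 1"
| "bcost (Neg b) s = bcost b s + 1"
| "bcost (Conj b d) s = bcost b s + bcost d s + 1"

text \<open>
  \<open>exec P s t s'\<close>: started in state \<open>s\<close>, program \<open>P\<close> halts in state \<open>s'\<close> after time \<open>t\<close>.
\<close>

inductive exec :: "com \<Rightarrow> state \<Rightarrow> nat \<Rightarrow> state \<Rightarrow> bool" where
  Skip: "exec Skip s 1 s"
| Assign: "exec (Assign r e) s (acost e s + 1) (s\<lparr>regs := (regs s)(r := aval e s)\<rparr>)"
| Store: "exec (Store a i e) s (acost i s + acost e s + 1)
    (s\<lparr>arrs := (arrs s)(a := (arrs s a)(aval i s := aval e s))\<rparr>)"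
| Seq: "exec P s t s' \<Longrightarrow> exec Q s' u s'' \<Longrightarrow> exec (Seq P Q) s (t + u) s''"
| IfTrue: "bval b s \<Longrightarrow> exec P s t s' \<Longrightarrow> exec (If b P Q) s (bcost b s + t) s'"
| IfFalse: "\<not> bval b s \<Longrightarrow> exec Q s t s' \<Longrightarrow> exec (If b P Q) s (bcost b s + t) s'"
| WhileFalse: "\<not> bval b s \<Longrightarrow> exec (While b P) s (bcost b s) s"
| WhileTrue: "bval b s \<Longrightarrow> exec P s t s' \<Longrightarrow> exec (While b P) s' u s'' \<Longrightarrow>
    exec (While b P) s (bcost b s + t + u) s''"

inductive_cases exec_SkipE: "exec Skip s t s'"
inductive_cases exec_AssignE: "exec (Assign r e) s t s'"
inductive_cases exec_StoreE: "exec (Store a i e) s t s'"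
inductive_cases exec_SeqE: "exec (Seq P Q) s t s'"
inductive_cases exec_IfE: "exec (If b P Q) s t s'"
inductive_cases exec_WhileE: "exec (While b P) s t s'"

text \<open>
  The machine is deterministic, so the existence of a halting run describes the only run.
\<close>

lemma exec_deterministic:
  "exec P s t s' \<Longrightarrow> exec P s u s'' \<Longrightarrow> t = u \<and> s' = s''"
proof (induction arbitrary: u s'' rule: exec.induct)
  case (Seq P s t s' Q v r)
  then show ?case by (metis exec_SeqE)
next
  case (IfTrue b s P t s' Q)
  then show ?case by (metis exec_IfE)
next
  case (IfFalse b s Q t s' P)
  then show ?case by (metis exec_IfE)
next
  case (WhileFalse b s P)
  then show ?case by (metis exec_WhileE)
next
  case (WhileTrue b s P t s' v r)
  from WhileTrue.prems WhileTrue.hyps(1) obtain t1 s1 t2 where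
    "exec P s t1 s1" "exec (While b P) s1 t2 s''" "u = bcost b s + t1 + t2"
    by (auto elim: exec_WhileE)
  with WhileTrue.IH show ?case by blast
qed (auto elim: exec_SkipE exec_AssignE exec_StoreE)

text \<open>
  The input, a list of integers, is placed in array \<open>0\<close> and its length in register \<open>0\<close>; all other
  memory is \<open>0\<close>. The output is read off in the same format.
\<close>

definition init_state :: "int list \<Rightarrow> state" where
  "init_state xs = \<lparr>regs = (\<lambda>_. 0)(0 := int (length xs)),
     arrs = (\<lambda>_ _. 0)(0 := (\<lambda>i. if 0 \<le> i \<and> i < int (length xs) then xs ! nat i else 0))\<rparr>"

definition holds_output :: "state \<Rightarrow> int list \<Rightarrow> bool" where
  "holds_output s ys \<longleftrightarrow>
     regs s 0 = int (length ys) \<and> (\<forall>i<length ys. arrs s 0 (int i) = ys ! i)"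

definition computes_in :: "com \<Rightarrow> int list \<Rightarrow> nat \<Rightarrow> int list \<Rightarrow> bool" where
  "computes_in P xs t ys \<longleftrightarrow> (\<exists>s. exec P (init_state xs) t s \<and> holds_output s ys)"


section \<open>The n-fold integer program\<close>

text \<open>
  Vectors \<open>b\<^sup>0, \<dots>, b\<^sup>n\<close>, \<open>c\<^sup>1, \<dots>, c\<^sup>n\<close> and \<open>x\<^sup>1, \<dots>, x\<^sup>n\<close> are given by functions on \<open>nat\<close>,
  of which only the values at the indicated indices matter.
\<close>

definition nfold_instance ::
  "nat \<Rightarrow> nat \<Rightarrow> nat \<Rightarrow> (nat \<Rightarrow> int vec) \<Rightarrow> (nat \<Rightarrow> int vec) \<Rightarrow> bool" where
  "nfold_instance p q n b c \<longleftrightarrow>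
     n > 0 \<and> b 0 \<in> carrier_vec q \<and>
     (\<forall>k\<in>{1..n}. b k \<in> carrier_vec p \<and> c k \<in> carrier_vec q)"

definition nfold_feasible ::
  "int mat \<Rightarrow> nat \<Rightarrow> (nat \<Rightarrow> int vec) \<Rightarrow> (nat \<Rightarrow> int vec) set" where
  "nfold_feasible A n b = {x.
     (\<forall>k\<in>{1..n}. x k \<in> carrier_vec (dim_col A) \<and> (\<forall>j<dim_col A. 0 \<le> x k $ j)) \<and>
     finsum_vec TYPE(int) (dim_col A) x {1..n} = b 0 \<and>
     (\<forall>k\<in>{1..n}. A *\<^sub>v x k = b k)}"

definition nfold_objective :: "nat \<Rightarrow> (nat \<Rightarrow> int vec) \<Rightarrow> (nat \<Rightarrow> int vec) \<Rightarrow> int" where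
  "nfold_objective n c x = (\<Sum>k=1..n. c k \<bullet> x k)"

datatype outcome = Infeasible | Unbounded | Optimal "nat \<Rightarrow> int vec"

fun correct_outcome ::
  "int mat \<Rightarrow> nat \<Rightarrow> (nat \<Rightarrow> int vec) \<Rightarrow> (nat \<Rightarrow> int vec) \<Rightarrow> outcome \<Rightarrow> bool" where
  "correct_outcome A n b c Infeasible \<longleftrightarrow> nfold_feasible A n b = {}"
| "correct_outcome A n b c Unbounded \<longleftrightarrow>
     (\<forall>B. \<exists>x\<in>nfold_feasible A n b. nfold_objective n c x < B)"
| "correct_outcome A n b c (Optimal x) \<longleftrightarrow>
     x \<in> nfold_feasible A n b \<and>
     (\<forall>y\<in>nfold_feasible A n b. nfold_objective n c x \<le> nfold_objective n c y)"


section \<open>Encoding of inputs and outputs\<close>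

definition vec_entries :: "(nat \<Rightarrow> int vec) \<Rightarrow> nat list \<Rightarrow> int list" where
  "vec_entries v ks = concat (map (\<lambda>k. list_of_vec (v k)) ks)"

definition bc_entries :: "nat \<Rightarrow> (nat \<Rightarrow> int vec) \<Rightarrow> (nat \<Rightarrow> int vec) \<Rightarrow> int list" where
  "bc_entries n b c = vec_entries b [0..<n + 1] @ vec_entries c [1..<n + 1]"

definition encode_input :: "nat \<Rightarrow> (nat \<Rightarrow> int vec) \<Rightarrow> (nat \<Rightarrow> int vec) \<Rightarrow> int list" where
  "encode_input n b c = int n # bc_entries n b c"

text \<open>The number \<open>n\<close> contributes its value, not its bit length.\<close>

definition input_size :: "nat \<Rightarrow> (nat \<Rightarrow> int vec) \<Rightarrow> (nat \<Rightarrow> int vec) \<Rightarrow> nat" where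
  "input_size n b c = n + sum_list (map bit_size (bc_entries n b c))"

fun encode_outcome :: "nat \<Rightarrow> outcome \<Rightarrow> int list" where
  "encode_outcome n Infeasible = [0]"
| "encode_outcome n Unbounded = [1]"
| "encode_outcome n (Optimal x) = 2 # vec_entries x [1..<n + 1]"

end

theory Submission
  imports Defs "HOL-Library.Multiset"
begin

text \<open>
  The sum constraint bounds the feasible set, so the program is never unbounded. If the system of
  equations has an integer solution at all, then one is found brick by brick, and its negative
  entries are removed together with the optimization: the penalized objective adds to the cost a
  large multiple of the sum of the negative parts.

  Two applications of Dickson's lemma show that every difference of two solutions is a sum of
  conformal vectors, each made of a bounded number of vectors from a finite set of kernel elements
  of \<open>A\<close>. For fixed \<open>A\<close> there are polynomially many such vectors. Writing their multiplicities in
  binary and using that the penalized objective is superadditive along conformal sums, some step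
  \<open>x + 2\<^sup>i g\<close> closes a polynomial fraction of the gap to the optimum, so greedy augmentation by the
  best of all these steps terminates after polynomially many rounds.

  On the machine it suffices to count steps: the program multiplies only by constants and by input
  entries, hence the binary length of the numbers in memory grows linearly with the step count.
\<close>

section \<open>Conformal decomposition of kernel vectors\<close>

text \<open>Neither bound from Dickson's lemma depends on \<open>n\<close>: the first concerns a
  single brick, and the second is applied to multisets of kernel vectors whose brick numbers have
  been forgotten. So a candidate is one of constantly many lists of length \<open>L\<close> together
  with a placement in the bricks, and there are \<open>n ^ L\<close> placements.

  The penalty has two tasks, and each puts a demand on the constant \<open>M\<close> in its weight.
  It must bound the objective from below on the unbounded set of integer solutions; since the sum
  constraint controls all entries up to twice the negative part, this needs
  \<open>2 \<le> M\<close>. It must also outweigh the cost of a step of length one, whose entries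
  are at most \<open>L * r\<close>; this needs \<open>L * r \<le> M\<close>.

  The number of step lengths and the number of rounds are logarithmic in the distance and in the gap
  to an optimum. The size of the starting solution is never estimated for this: the machine computes
  a number that bounds both quantities, and a number reached in polynomially many tame steps has
  polynomial length.\<close>

lemma nat_mono_subseq:
  fixes s :: "nat \<Rightarrow> nat"
  shows "\<exists>r. strict_mono r \<and> incseq (\<lambda>n. s (r n))"
proof -
  obtain f where f: "strict_mono f" "monoseq (\<lambda>n. s (f n))"
    using seq_monosub by blast
  show ?thesis
  proof (cases "incseq (\<lambda>n. s (f n))")
    case True
    with f show ?thesis by blast
  next
    case False
    then have dec: "s (f n) \<le> s (f m)" if "m \<le> n" for m n
      using f(2) that unfolding monoseq_def incseq_def by blast
    \<comment> \<open>A nonincreasing sequence of natural numbers is constant from its minimum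
      on.\<close>
    obtain N where N: "\<And>n. s (f N) \<le> s (f n)"
      using ex_has_least_nat[of "\<lambda>_. True" _ "\<lambda>n. s (f n)"] by auto
    have "s (f (N + n)) = s (f N)" for n
      by (intro antisym N dec) auto
    then have "incseq (\<lambda>n. s (f (N + n)))" by (simp add: mono_def)
    moreover have "strict_mono (\<lambda>n. f (N + n))"
      using f(1) by (simp add: strict_mono_def)
    ultimately show ?thesis by blast
  qed
qed

lemma mono_subseq:
  fixes f :: "nat \<Rightarrow> 'a \<Rightarrow> nat"
  assumes "finite I"
  shows "\<exists>r :: nat \<Rightarrow> nat. strict_mono r \<and> (\<forall>i\<in>I. incseq (\<lambda>n. f (r n) i))"
  using assms
proof (induction I)
  case empty
  show ?case by (auto intro: exI[of _ id] simp: strict_mono_def)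
next
  case (insert i I)
  then obtain r where r: "strict_mono r" "\<forall>i\<in>I. incseq (\<lambda>n. f (r n) i)" by blast
  obtain u where u: "strict_mono u" "incseq (\<lambda>n. f (r (u n)) i)"
    using nat_mono_subseq[of "\<lambda>n. f (r n) i"] by blast
  have "strict_mono (\<lambda>n. r (u n))"
    using r(1) u(1) by (simp add: strict_mono_def)
  moreover have "incseq (\<lambda>n. f (r (u n)) j)" if "j \<in> I" for j
    using r(2) that u(1) by (auto simp: incseq_def strict_mono_less_eq)
  ultimately show ?case using u(2) by (intro exI[of _ "\<lambda>n. r (u n)"]) auto
qed

text \<open>Finiteness of the set of minimal elements, in the form of one bound that works below
  every element. Without such a bound, choose for each \<open>L\<close> an element with nothing of
  size at most \<open>L\<close> below it. On a monotone subsequence the first element lies below all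
  later ones, whose indices eventually reach its size.\<close>

lemma Dickson_bound:
  fixes S :: "('a \<Rightarrow> nat) set"
  assumes "finite I"
  shows "\<exists>L. \<forall>f\<in>S. \<exists>g\<in>S. (\<forall>i\<in>I. g i \<le> f i) \<and> (\<Sum>i\<in>I. g i) \<le> L"
proof (rule ccontr)
  assume "\<not> ?thesis"
  then have "\<forall>L. \<exists>f\<in>S. \<forall>g\<in>S. (\<forall>i\<in>I. g i \<le> f i) \<longrightarrow> L < (\<Sum>i\<in>I. g i)"
    by (meson not_le)
  then obtain f where f: "\<And>L. f L \<in> S"
    "\<And>L g. g \<in> S \<Longrightarrow> (\<forall>i\<in>I. g i \<le> f L i) \<Longrightarrow> L < (\<Sum>i\<in>I. g i)"
    by metis
  obtain r where r: "strict_mono r" "\<forall>i\<in>I. incseq (\<lambda>n. f (r n) i)"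
    using mono_subseq[OF assms] by blast
  define g where "g = f (r 0)"
  have "(\<Sum>i\<in>I. g i) < (\<Sum>i\<in>I. g i)"
  proof (rule le_less_trans)
    show "(\<Sum>i\<in>I. g i) \<le> r (\<Sum>i\<in>I. g i)" using r(1) by (rule strict_mono_imp_increasing)
    show "r (\<Sum>i\<in>I. g i) < (\<Sum>i\<in>I. g i)"
      using r(2) by (intro f(2)) (auto simp: g_def f(1) incseq_def)
  qed
  then show False by simp
qed

section \<open>Bounded conformal parts of the kernel vectors of a single brick\<close>

definition int_ker :: "(nat \<Rightarrow> nat \<Rightarrow> int) \<Rightarrow> nat \<Rightarrow> nat \<Rightarrow> (nat \<Rightarrow> int) set" where
  "int_ker a p q = {v. (\<forall>i<p. (\<Sum>j<q. a i j * v j) = 0) \<and> (\<forall>j\<ge>q. v j = 0)}"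

text \<open>For \<open>h = 0\<close> both implications apply and force \<open>u = 0\<close>. In a
  sum of values conformal to the same \<open>h\<close> nothing cancels.\<close>

definition conformal :: "int \<Rightarrow> int \<Rightarrow> bool" where
  "conformal u h \<longleftrightarrow> (0 \<le> h \<longrightarrow> 0 \<le> u) \<and> (h \<le> 0 \<longrightarrow> u \<le> 0)"

lemma conformal_sum: "(\<And>i. i \<in> I \<Longrightarrow> conformal (f i) h) \<Longrightarrow> conformal (sum f I) h"
  unfolding conformal_def by (auto intro: sum_nonneg sum_nonpos)

lemma conformal_sum_mset: "(\<And>z. z \<in># Z \<Longrightarrow> conformal (f z) h) \<Longrightarrow> conformal (\<Sum>z\<in>#Z. f z) h"
  unfolding conformal_def
  by (induction Z) (auto simp: add_nonneg_nonneg add_nonpos_nonpos)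

text \<open>Dickson's lemma for the vectors of positive and negative parts: on these the
  componentwise order says that \<open>u\<close> is conformal to \<open>v\<close> and not larger.
  The minimal nonzero elements are the Graver basis of the matrix.\<close>

lemma conformal_kernel_part:
  "\<exists>L. \<forall>v\<in>int_ker a p q. v \<noteq> (\<lambda>_. 0) \<longrightarrow> (\<exists>u\<in>int_ker a p q. u \<noteq> (\<lambda>_. 0) \<and>
     (\<forall>j. conformal (u j) (v j) \<and> \<bar>u j\<bar> \<le> \<bar>v j\<bar> \<and> \<bar>u j\<bar> \<le> int L))"
proof -
  define f where "f = (\<lambda>v::nat \<Rightarrow> int. \<lambda>(j, b). if b then nat (v j) else nat (- v j))"
  define I where "I = {..<q} \<times> (UNIV :: bool set)"
  have fin: "finite I" by (simp add: I_def)
  from Dickson_bound[OF fin, of "f ` (int_ker a p q - {\<lambda>_. 0})"]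
  obtain L where L: "\<forall>v\<in>int_ker a p q - {\<lambda>_. 0}. \<exists>u\<in>int_ker a p q - {\<lambda>_. 0}.
     (\<forall>i\<in>I. f u i \<le> f v i) \<and> sum (f u) I \<le> L" by auto
  show ?thesis
  proof (intro exI[of _ L] ballI impI)
    fix v assume v: "v \<in> int_ker a p q" "v \<noteq> (\<lambda>_. 0)"
    with L obtain u where u: "u \<in> int_ker a p q" "u \<noteq> (\<lambda>_. 0)"
      "\<forall>i\<in>I. f u i \<le> f v i" "sum (f u) I \<le> L" by blast
    have "conformal (u j) (v j) \<and> \<bar>u j\<bar> \<le> \<bar>v j\<bar> \<and> \<bar>u j\<bar> \<le> int L" for j
    proof (cases "j < q")
      case True
      then have i: "(j, True) \<in> I" "(j, False) \<in> I" by (auto simp: I_def)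
      have 1: "nat (u j) \<le> nat (v j)" "nat (- u j) \<le> nat (- v j)"
        using u(3) i unfolding f_def by fastforce+
      have 2: "nat (u j) \<le> L" "nat (- u j) \<le> L"
        using member_le_sum[OF i(1), of "f u"] member_le_sum[OF i(2), of "f u"] u(4) fin
        unfolding f_def by auto
      show ?thesis using 1 2 unfolding conformal_def by linarith
    qed (use u(1) v(1) in \<open>auto simp: int_ker_def conformal_def\<close>)
    with u(1,2) show "\<exists>u\<in>int_ker a p q. u \<noteq> (\<lambda>_. 0) \<and>
     (\<forall>j. conformal (u j) (v j) \<and> \<bar>u j\<bar> \<le> \<bar>v j\<bar> \<and> \<bar>u j\<bar> \<le> int L)" by blast
  qed
qed

lemma conformal_trans: "conformal u w \<Longrightarrow> conformal w h \<Longrightarrow> conformal u h"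
  unfolding conformal_def by linarith

text \<open>Parts are split off one by one. The l1-norm decreases each time, and every remainder
  stays conformal to \<open>v\<close>, so the later parts are conformal to \<open>v\<close> as
  well.\<close>

lemma kernel_decomp:
  "\<exists>L. \<forall>v\<in>int_ker a p q. \<exists>U. set_mset U \<subseteq> {u \<in> int_ker a p q. \<forall>j. \<bar>u j\<bar> \<le> int L} \<and>
     (\<forall>j. v j = (\<Sum>u\<in>#U. u j)) \<and> (\<forall>u\<in>#U. \<forall>j. conformal (u j) (v j))"
proof -
  obtain L where L: "\<And>v. v \<in> int_ker a p q \<Longrightarrow> v \<noteq> (\<lambda>_. 0) \<Longrightarrow> (\<exists>u\<in>int_ker a p q. u \<noteq> (\<lambda>_. 0) \<and>
     (\<forall>j. conformal (u j) (v j) \<and> \<bar>u j\<bar> \<le> \<bar>v j\<bar> \<and> \<bar>u j\<bar> \<le> int L))"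
    using conformal_kernel_part[of a p q] by blast
  show ?thesis
  proof (intro exI[of _ L] ballI)
    fix v assume "v \<in> int_ker a p q"
    then show "\<exists>U. set_mset U \<subseteq> {u \<in> int_ker a p q. \<forall>j. \<bar>u j\<bar> \<le> int L} \<and>
     (\<forall>j. v j = (\<Sum>u\<in>#U. u j)) \<and> (\<forall>u\<in>#U. \<forall>j. conformal (u j) (v j))"
    proof (induction "\<Sum>j<q. nat \<bar>v j\<bar>" arbitrary: v rule: less_induct)
      case less
      show ?case
      proof (cases "v = (\<lambda>_. 0)")
        case True
        then show ?thesis by (intro exI[of _ "{#}"]) auto
      next
        case False
        with L less.prems obtain u where u: "u \<in> int_ker a p q" "u \<noteq> (\<lambda>_. 0)"
          "\<And>j. conformal (u j) (v j)" "\<And>j. \<bar>u j\<bar> \<le> \<bar>v j\<bar>" "\<And>j. \<bar>u j\<bar> \<le> int L" by blast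
        define w where "w = (\<lambda>j. v j - u j)"
        have wk: "w \<in> int_ker a p q"
          using u(1) less.prems by (auto simp: int_ker_def w_def right_diff_distrib sum_subtractf)
        have wc: "conformal (w j) (v j)" "nat \<bar>w j\<bar> + nat \<bar>u j\<bar> = nat \<bar>v j\<bar>" for j
          using u(3)[of j] u(4)[of j] unfolding conformal_def w_def by linarith+
        obtain j where "u j \<noteq> 0" using u(2) by auto
        then have "j < q" using u(1) by (auto simp: int_ker_def not_le[symmetric])
        have "(\<Sum>j<q. nat \<bar>w j\<bar>) < (\<Sum>j<q. nat \<bar>v j\<bar>)"
        proof (rule sum_strict_mono_ex1)
          show "\<forall>j\<in>{..<q}. nat \<bar>w j\<bar> \<le> nat \<bar>v j\<bar>" using wc(2) by (metis le_add1)
          show "\<exists>j\<in>{..<q}. nat \<bar>w j\<bar> < nat \<bar>v j\<bar>"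
            using \<open>j < q\<close> \<open>u j \<noteq> 0\<close> wc(2)[of j] by (intro bexI[of _ j]) auto
        qed simp
        then obtain U where U: "set_mset U \<subseteq> {u \<in> int_ker a p q. \<forall>j. \<bar>u j\<bar> \<le> int L}"
          "\<And>j. w j = (\<Sum>u\<in>#U. u j)" "\<And>u j. u \<in># U \<Longrightarrow> conformal (u j) (w j)"
          using less.hyps[OF _ wk] by blast
        show ?thesis
        proof (intro exI[of _ "add_mset u U"] conjI allI ballI)
          show "set_mset (add_mset u U) \<subseteq> {u \<in> int_ker a p q. \<forall>j. \<bar>u j\<bar> \<le> int L}"
            using U(1) u(1,5) by auto
          show "v j = (\<Sum>u\<in>#add_mset u U. u j)" for j
            using U(2)[of j] by (simp add: w_def)
          show "conformal (u' j) (v j)" if "u' \<in># add_mset u U" for u' j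
            using that u(3) conformal_trans[OF U(3) wc(1)] by auto
        qed
      qed
    qed
  qed
qed

section \<open>Groups of bounded size with sum zero\<close>

lemma zero_sum_submultiset:
  assumes "finite (G :: (nat \<Rightarrow> int) set)"
  shows "\<exists>L. \<forall>M. set_mset M \<subseteq> G \<and> M \<noteq> {#} \<and> (\<forall>j<q. (\<Sum>u\<in>#M. u j) = 0) \<longrightarrow>
     (\<exists>N. N \<subseteq># M \<and> N \<noteq> {#} \<and> (\<forall>j<q. (\<Sum>u\<in>#N. u j) = 0) \<and> size N \<le> L)"
proof -
  define S where "S = {M. set_mset M \<subseteq> G \<and> M \<noteq> {#} \<and> (\<forall>j<q. (\<Sum>u\<in>#M. u j) = 0)}"
  \<comment> \<open>Dickson's lemma for multiplicities: the order is inclusion of multisets, and the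
    sum of the coordinates is the size.\<close>
  obtain L where L: "\<And>M. M \<in> S \<Longrightarrow> \<exists>N\<in>S. (\<forall>u\<in>G. count N u \<le> count M u) \<and> (\<Sum>u\<in>G. count N u) \<le> L"
    using Dickson_bound[OF assms, of "count ` S"] by auto
  have "\<exists>N. N \<subseteq># M \<and> N \<noteq> {#} \<and> (\<forall>j<q. (\<Sum>u\<in>#N. u j) = 0) \<and> size N \<le> L" if "M \<in> S" for M
  proof -
    from L[OF that] obtain N where N: "N \<in> S" "\<forall>u\<in>G. count N u \<le> count M u" "(\<Sum>u\<in>G. count N u) \<le> L"
      by blast
    have "size N = (\<Sum>u\<in>G. count N u)"
      unfolding size_multiset_overloaded_eq using N(1) assms
      by (intro sum.mono_neutral_left) (auto simp: S_def count_eq_zero_iff)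
    moreover have "N \<subseteq># M"
      using N(1,2) unfolding S_def subseteq_mset_def
      by (metis (mono_tags, lifting) count_eq_zero_iff mem_Collect_eq subsetD zero_le)
    ultimately show ?thesis using N(1,3) unfolding S_def by auto
  qed
  then show ?thesis unfolding S_def by blast
qed

text \<open>The first components will be brick numbers. The bound is obtained from the second
  components alone, hence it is the same for any number of bricks; a group found among the second
  components is lifted back to tagged elements.\<close>

lemma zero_sum_partition:
  assumes "finite (G :: (nat \<Rightarrow> int) set)"
  shows "\<exists>L. \<forall>Z :: ('k \<times> (nat \<Rightarrow> int)) multiset.
     snd ` set_mset Z \<subseteq> G \<and> (\<forall>j<q. (\<Sum>z\<in>#Z. snd z j) = 0) \<longrightarrow>
     (\<exists>W. \<Sum>\<^sub># W = Z \<and> (\<forall>Y\<in>#W. size Y \<le> L \<and> (\<forall>j<q. (\<Sum>z\<in>#Y. snd z j) = 0)))"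
proof -
  obtain L where L: "\<And>M. set_mset M \<subseteq> G \<Longrightarrow> M \<noteq> {#} \<Longrightarrow> (\<forall>j<q. (\<Sum>u\<in>#M. u j) = 0) \<Longrightarrow>
     (\<exists>N. N \<subseteq># M \<and> N \<noteq> {#} \<and> (\<forall>j<q. (\<Sum>u\<in>#N. u j) = 0) \<and> size N \<le> L)"
    using zero_sum_submultiset[OF assms, of q] by blast
  have "\<exists>W. \<Sum>\<^sub># W = Z \<and> (\<forall>Y\<in>#W. size Y \<le> L \<and> (\<forall>j<q. (\<Sum>z\<in>#Y. snd z j) = 0))"
    if "snd ` set_mset Z \<subseteq> G" "\<forall>j<q. (\<Sum>z\<in>#Z. snd z j) = 0" for Z :: "('k \<times> (nat \<Rightarrow> int)) multiset"
    using that
  proof (induction "size Z" arbitrary: Z rule: less_induct)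
    case less
    show ?case
    proof (cases "Z = {#}")
      case True
      then show ?thesis by (intro exI[of _ "{#}"]) auto
    next
      case False
      have "\<forall>j<q. (\<Sum>u\<in>#image_mset snd Z. u j) = 0"
        using less.prems(2) by (simp add: image_mset.compositionality comp_def)
      with L[of "image_mset snd Z"] less.prems(1) False obtain N where
        N: "N \<subseteq># image_mset snd Z" "N \<noteq> {#}" "\<forall>j<q. (\<Sum>u\<in>#N. u j) = 0" "size N \<le> L"
        by auto
      from N(1) obtain N' where "image_mset snd Z = N + N'" by (auto simp: subset_mset.le_iff_add)
      then obtain Y Y' where Y: "Z = Y + Y'" "N = image_mset snd Y"
        using image_mset_eq_plusD by blast
      have zY: "\<forall>j<q. (\<Sum>z\<in>#Y. snd z j) = 0"
        using N(3) Y(2) by (simp add: image_mset.compositionality comp_def)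
      have "size Y' < size Z" using Y N(2) by (auto simp: nonempty_has_size)
      moreover have "snd ` set_mset Y' \<subseteq> G" using less.prems(1) Y(1) by auto
      moreover have "\<forall>j<q. (\<Sum>z\<in>#Y'. snd z j) = 0"
        using less.prems(2) zY by (simp add: Y(1))
      ultimately obtain W where "\<Sum>\<^sub># W = Y'" "\<forall>Y\<in>#W. size Y \<le> L \<and> (\<forall>j<q. (\<Sum>z\<in>#Y. snd z j) = 0)"
        using less.hyps by blast
      then show ?thesis using zY N(4) Y by (intro exI[of _ "add_mset Y W"]) auto
    qed
  qed
  then show ?thesis by blast
qed

section \<open>Candidates addressed by a template and a number in base \<open>n\<close>\<close>

lemma digits_exist:
  assumes "\<forall>i<L. ks i < (n :: nat)"
  shows "\<exists>m<n ^ L. \<forall>i<L. m div n ^ i mod n = ks i"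
  using assms
proof (induction L arbitrary: ks)
  case 0
  show ?case by auto
next
  case (Suc L)
  from Suc.IH[of "\<lambda>i. ks (Suc i)"] Suc.prems obtain m where
    m: "m < n ^ L" "\<forall>i<L. m div n ^ i mod n = ks (Suc i)" by auto
  have k: "ks 0 < n" using Suc.prems by simp
  show ?case
  proof (intro exI[of _ "n * m + ks 0"] conjI allI impI)
    have "n * m + ks 0 < n * (m + 1)" using k by simp
    also have "\<dots> \<le> n * n ^ L" using m(1) by (intro mult_le_mono) auto
    finally show "n * m + ks 0 < n ^ Suc L" by simp
    fix i assume i: "i < Suc L"
    show "(n * m + ks 0) div n ^ i mod n = ks i"
    proof (cases i)
      case 0
      with k show ?thesis by simp
    next
      case (Suc i')
      have "(n * m + ks 0) div n ^ i = (n * m + ks 0) div n div n ^ i'"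
        unfolding Suc power_Suc by (rule div_mult2_eq)
      also have "(n * m + ks 0) div n = m" using k by simp
      finally show ?thesis using Suc i m(2) by simp
    qed
  qed
qed

text \<open>The length is exactly \<open>L\<close>, with zero vectors as padding, so that one loop
  over the \<open>n ^ L\<close> placements serves all templates.\<close>

definition templates :: "(nat \<Rightarrow> nat \<Rightarrow> int) \<Rightarrow> nat \<Rightarrow> nat \<Rightarrow> nat \<Rightarrow> nat \<Rightarrow> (nat \<Rightarrow> int) list set" where
  "templates a p q L r = {T. length T = L \<and> set T \<subseteq> {u \<in> int_ker a p q. \<forall>j. \<bar>u j\<bar> \<le> int r} \<and>
     (\<forall>j<q. (\<Sum>i<L. (T ! i) j) = 0)}"

text \<open>
  \<open>spread q n T m\<close> puts the \<open>i\<close>-th vector of \<open>T\<close> into the brick whose number is the \<open>i\<close>-th base-\<open>n\<close>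
  digit of \<open>m\<close>. Bricks are counted from 0, and entry \<open>j\<close> of brick \<open>k\<close> has the flat index \<open>k * q + j\<close>.
\<close>

definition spread :: "nat \<Rightarrow> nat \<Rightarrow> (nat \<Rightarrow> int) list \<Rightarrow> nat \<Rightarrow> nat \<Rightarrow> int" where
  "spread q n T m idx = (\<Sum>i<length T. if idx div q = m div n ^ i mod n then (T ! i) (idx mod q) else 0)"

definition nfold_kernel :: "(nat \<Rightarrow> nat \<Rightarrow> int) \<Rightarrow> nat \<Rightarrow> nat \<Rightarrow> nat \<Rightarrow> (nat \<Rightarrow> int) \<Rightarrow> bool" where
  "nfold_kernel a p q n h \<longleftrightarrow> (\<forall>k<n. \<forall>i<p. (\<Sum>j<q. a i j * h (k * q + j)) = 0) \<and>
     (\<forall>j<q. (\<Sum>k<n. h (k * q + j)) = 0)"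

lemma finite_bounded_int_ker: "finite {u \<in> int_ker a p q. \<forall>j. \<bar>u j\<bar> \<le> int r}"
proof (rule finite_subset)
  show "{u \<in> int_ker a p q. \<forall>j. \<bar>u j\<bar> \<le> int r} \<subseteq>
    {f. \<forall>j. (j \<in> {..<q} \<longrightarrow> f j \<in> {- int r..int r}) \<and> (j \<notin> {..<q} \<longrightarrow> f j = 0)}"
    by (auto simp: int_ker_def abs_le_iff minus_le_iff)
  show "finite {f. \<forall>j. (j \<in> {..<q} \<longrightarrow> f j \<in> {- int r..int r}) \<and> (j \<notin> {..<q} \<longrightarrow> f j = 0)}"
    by (rule finite_set_of_finite_funs) auto
qed

lemma finite_templates: "finite (templates a p q L r)"
  by (rule finite_subset[OF _ finite_lists_length_eq[OF finite_bounded_int_ker[of a p q r], of L]])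
    (auto simp: templates_def)

lemma sum_mset_sum_msets:
  "(\<Sum>z\<in>#(\<Sum>k<(n::nat). M k). (f z :: int)) = (\<Sum>k<n. \<Sum>z\<in>#M k. f z)"
  by (induction n) auto

lemma sum_mset_Union:
  "(\<Sum>z\<in>#\<Sum>\<^sub># W. (f z :: int)) = (\<Sum>Y\<in>#W. \<Sum>z\<in>#Y. f z)"
  by (induction W) auto

lemma set_mset_sum_msets: "set_mset (\<Sum>k<(n::nat). M k) = (\<Union>k<n. set_mset (M k))"
  by (induction n) (auto simp: lessThan_Suc)

lemma sum_nth_sum_list: "(\<Sum>i<length xs. f (xs ! i)) = sum_list (map f xs)"
  by (simp add: sum_list_sum_nth atLeast0LessThan)

lemma spread_encodes:
  assumes "n > 0" and "size Y \<le> L" and "\<forall>(k, u)\<in>#Y. k < n \<and> u \<in> int_ker a p q \<and> (\<forall>j. \<bar>u j\<bar> \<le> int r)"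
    and "\<forall>j<q. (\<Sum>z\<in>#Y. snd z j) = 0"
  shows "\<exists>T\<in>templates a p q L r. \<exists>m<n ^ L.
     \<forall>idx. spread q n T m idx = (\<Sum>(k, u)\<in>#Y. if idx div q = k then u (idx mod q) else 0)"
proof -
  obtain ys where ys: "mset ys = Y" using ex_mset by blast
  \<comment> \<open>The padding goes to brick 0, which exists because \<open>n > 0\<close>; being
    zero, it does not change the vector.\<close>
  define zs where "zs = ys @ replicate (L - length ys) (0, \<lambda>_. 0)"
  have len: "length zs = L" using assms(2) ys by (auto simp: zs_def)
  have zs_in: "k < n \<and> u \<in> int_ker a p q \<and> (\<forall>j. \<bar>u j\<bar> \<le> int r)" if "(k, u) \<in> set zs" for k u
  proof -
    have "(\<lambda>_. 0) \<in> int_ker a p q" by (simp add: int_ker_def)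
    then show ?thesis using that assms(1,3) ys[symmetric] unfolding zs_def by fastforce
  qed
  have sum_zs: "(\<Sum>i<L. f (zs ! i)) = (\<Sum>z\<in>#Y. f z)" if "f (0, \<lambda>_. 0) = 0" for f :: "_ \<Rightarrow> int"
  proof -
    have "(\<Sum>i<L. f (zs ! i)) = sum_list (map f zs)" using sum_nth_sum_list[of f zs] len by simp
    also have "\<dots> = sum_list (map f ys)" using that by (simp add: zs_def sum_list_replicate)
    also have "\<dots> = (\<Sum>z\<in>#Y. f z)" by (metis ys mset_map sum_mset_sum_list)
    finally show ?thesis .
  qed
  have "\<forall>i<L. fst (zs ! i) < n"
    using zs_in len by (metis nth_mem prod.collapse)
  then obtain m where m: "m < n ^ L" "\<forall>i<L. m div n ^ i mod n = fst (zs ! i)"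
    using digits_exist[of L "\<lambda>i. fst (zs ! i)" n] by auto
  define T where "T = map snd zs"
  have "T \<in> templates a p q L r"
    unfolding templates_def
  proof (intro CollectI conjI allI impI)
    show "length T = L" by (simp add: T_def len)
    show "set T \<subseteq> {u \<in> int_ker a p q. \<forall>j. \<bar>u j\<bar> \<le> int r}" using zs_in by (auto simp: T_def)
    fix j assume "j < q"
    then show "(\<Sum>i<L. (T ! i) j) = 0"
      using sum_zs[of "\<lambda>z. snd z j"] assms(4) len by (simp add: T_def)
  qed
  moreover have "spread q n T m idx = (\<Sum>(k, u)\<in>#Y. if idx div q = k then u (idx mod q) else 0)" for idx
  proof -
    have "spread q n T m idx = (\<Sum>i<L. (\<lambda>(k, u). if idx div q = k then u (idx mod q) else 0) (zs ! i))"
      unfolding spread_def using m(2) len by (intro sum.cong) (auto simp: T_def case_prod_unfold)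
    also have "\<dots> = (\<Sum>(k, u)\<in>#Y. if idx div q = k then u (idx mod q) else 0)"
      by (intro sum_zs) simp
    finally show ?thesis .
  qed
  ultimately show ?thesis using m(1) by blast
qed

lemma conformal_0: "conformal 0 h" by (simp add: conformal_def)

text \<open>Every brick of \<open>h\<close> is split by the first bound. The parts of all bricks
  together have sum zero because the bricks of \<open>h\<close> do, so the second bound groups them.
  The parts of a group that fall into one brick are all conformal to \<open>h\<close> there, and so
  is their sum.\<close>

lemma nfold_kernel_decomp:
  "\<exists>L r. \<forall>n h. n > 0 \<and> nfold_kernel a p q n h \<longrightarrow> (\<exists>W.
     set_mset W \<subseteq> templates a p q L r \<times> {..<n ^ L} \<and>
     (\<forall>idx<n * q. h idx = (\<Sum>(T, m)\<in>#W. spread q n T m idx) \<and>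
       (\<forall>(T, m)\<in>#W. conformal (spread q n T m idx) (h idx))))"
proof -
  obtain r where r: "\<And>v. v \<in> int_ker a p q \<Longrightarrow> \<exists>U. set_mset U \<subseteq> {u \<in> int_ker a p q. \<forall>j. \<bar>u j\<bar> \<le> int r} \<and>
     (\<forall>j. v j = (\<Sum>u\<in>#U. u j)) \<and> (\<forall>u\<in>#U. \<forall>j. conformal (u j) (v j))"
    using kernel_decomp[of a p q] by blast
  define G where "G = {u \<in> int_ker a p q. \<forall>j. \<bar>u j\<bar> \<le> int r}"
  have finG: "finite G" unfolding G_def by (rule finite_bounded_int_ker)
  obtain L where L: "\<And>Z :: (nat \<times> (nat \<Rightarrow> int)) multiset.
     snd ` set_mset Z \<subseteq> G \<Longrightarrow> (\<forall>j<q. (\<Sum>z\<in>#Z. snd z j) = 0) \<Longrightarrow>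
     (\<exists>W. \<Sum>\<^sub># W = Z \<and> (\<forall>Y\<in>#W. size Y \<le> L \<and> (\<forall>j<q. (\<Sum>z\<in>#Y. snd z j) = 0)))"
    using zero_sum_partition[OF finG, of q] by metis
  have "\<exists>W. set_mset W \<subseteq> templates a p q L r \<times> {..<n ^ L} \<and>
     (\<forall>idx<n * q. h idx = (\<Sum>(T, m)\<in>#W. spread q n T m idx) \<and>
       (\<forall>(T, m)\<in>#W. conformal (spread q n T m idx) (h idx)))"
    if n: "n > 0" and h: "nfold_kernel a p q n h" for n h
  proof -
    define v where "v = (\<lambda>k j. if j < q then h (k * q + j) else 0)"
    have "v k \<in> int_ker a p q" if "k < n" for k
      using h that by (auto simp: v_def int_ker_def nfold_kernel_def)
    then have "\<forall>k\<in>{..<n}. \<exists>U. set_mset U \<subseteq> G \<and> (\<forall>j. v k j = (\<Sum>u\<in>#U. u j)) \<and>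
       (\<forall>u\<in>#U. \<forall>j. conformal (u j) (v k j))"
      using r unfolding G_def by blast
    from bchoice[OF this] obtain U where "\<forall>k\<in>{..<n}. set_mset (U k) \<subseteq> G \<and>
       (\<forall>j. v k j = (\<Sum>u\<in>#U k. u j)) \<and> (\<forall>u\<in>#U k. \<forall>j. conformal (u j) (v k j))" by blast
    then have U: "\<And>k. k < n \<Longrightarrow> set_mset (U k) \<subseteq> G"
       "\<And>k j. k < n \<Longrightarrow> v k j = (\<Sum>u\<in>#U k. u j)"
       "\<And>k u j. k < n \<Longrightarrow> u \<in># U k \<Longrightarrow> conformal (u j) (v k j)"
      by blast+
    define Z where "Z = (\<Sum>k<n. image_mset (Pair k) (U k))"
    have Z_in: "k < n \<and> u \<in># U k" if "(k, u) \<in># Z" for k u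
      using that unfolding Z_def set_mset_sum_msets by auto
    have "snd ` set_mset Z \<subseteq> G"
      using Z_in U(1) by fastforce
    moreover have "\<forall>j<q. (\<Sum>z\<in>#Z. snd z j) = 0"
    proof (intro allI impI)
      fix j assume j: "j < q"
      have "(\<Sum>z\<in>#Z. snd z j) = (\<Sum>k<n. v k j)"
        unfolding Z_def sum_mset_sum_msets
        by (intro sum.cong) (auto simp: U(2) image_mset.compositionality comp_def)
      then show "(\<Sum>z\<in>#Z. snd z j) = 0" using h j by (simp add: nfold_kernel_def v_def)
    qed
    ultimately have "\<exists>W. \<Sum>\<^sub># W = Z \<and> (\<forall>Y\<in>#W. size Y \<le> L \<and> (\<forall>j<q. (\<Sum>z\<in>#Y. snd z j) = 0))"
      by (rule L)
    then obtain V where V: "\<Sum>\<^sub># V = Z"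
      "\<And>Y. Y \<in># V \<Longrightarrow> size Y \<le> L \<and> (\<forall>j<q. (\<Sum>z\<in>#Y. snd z j) = 0)"
      by auto
    define val where "val = (\<lambda>idx (k, u :: nat \<Rightarrow> int). if idx div q = k then u (idx mod q) else 0)"
    have sub: "z \<in># Z" if "Y \<in># V" "z \<in># Y" for Y z
      using that V(1) by (metis in_Union_mset_iff)
    have "\<forall>Y\<in>#V. \<exists>t. fst t \<in> templates a p q L r \<and> snd t < n ^ L \<and>
       (\<forall>idx. spread q n (fst t) (snd t) idx = (\<Sum>z\<in>#Y. val idx z))"
    proof
      fix Y assume Y: "Y \<in># V"
      have "\<forall>(k, u)\<in>#Y. k < n \<and> u \<in> int_ker a p q \<and> (\<forall>j. \<bar>u j\<bar> \<le> int r)"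
        using Z_in[OF sub[OF Y]] U(1) unfolding G_def by blast
      with spread_encodes[OF n, of Y L a p q r] V(2)[OF Y]
      show "\<exists>t. fst t \<in> templates a p q L r \<and> snd t < n ^ L \<and>
       (\<forall>idx. spread q n (fst t) (snd t) idx = (\<Sum>z\<in>#Y. val idx z))"
        unfolding val_def by fastforce
    qed
    from bchoice[OF this] obtain e where e: "\<And>Y. Y \<in># V \<Longrightarrow> fst (e Y) \<in> templates a p q L r"
       "\<And>Y. Y \<in># V \<Longrightarrow> snd (e Y) < n ^ L"
       "\<And>Y idx. Y \<in># V \<Longrightarrow> spread q n (fst (e Y)) (snd (e Y)) idx = (\<Sum>z\<in>#Y. val idx z)"
      by auto
    show ?thesis
    proof (intro exI[of _ "image_mset e V"] conjI allI impI)
      show "set_mset (image_mset e V) \<subseteq> templates a p q L r \<times> {..<n ^ L}"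
        unfolding set_image_mset by (rule image_subsetI) (simp add: mem_Times_iff e(1,2))
      fix idx assume idx: "idx < n * q"
      have k: "idx div q < n" using idx by (simp add: less_mult_imp_div_less)
      have q: "idx mod q < q" using idx by (cases q) auto
      have h_v: "h idx = v (idx div q) (idx mod q)" using q by (simp add: v_def)
      have "(\<Sum>(T, m)\<in>#image_mset e V. spread q n T m idx) = (\<Sum>Y\<in>#V. \<Sum>z\<in>#Y. val idx z)"
        unfolding image_mset.compositionality comp_def case_prod_unfold
        by (intro arg_cong[where f = sum_mset] image_mset_cong) (simp add: e(3))
      also have "\<dots> = (\<Sum>z\<in>#Z. val idx z)" by (simp add: sum_mset_Union flip: V(1))
      also have "\<dots> = (\<Sum>k<n. \<Sum>u\<in>#U k. val idx (k, u))"
        unfolding Z_def sum_mset_sum_msets by (simp add: image_mset.compositionality comp_def)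
      also have "\<dots> = (\<Sum>k<n. if k = idx div q then \<Sum>u\<in>#U k. u (idx mod q) else 0)"
        by (intro sum.cong) (auto simp: val_def)
      also have "\<dots> = v (idx div q) (idx mod q)" using k U(2) by (simp add: sum.delta)
      finally show "h idx = (\<Sum>(T, m)\<in>#image_mset e V. spread q n T m idx)" using h_v by simp
      have "conformal (val idx z) (h idx)" if "z \<in># Z" for z
        using Z_in[of "fst z" "snd z"] that U(3) conformal_0 unfolding h_v
        by (auto simp: val_def case_prod_unfold)
      then have "conformal (spread q n (fst (e Y)) (snd (e Y)) idx) (h idx)" if "Y \<in># V" for Y
        unfolding e(3)[OF that] using sub[OF that] by (intro conformal_sum_mset) auto
      then show "\<forall>(T, m)\<in>#image_mset e V. conformal (spread q n T m idx) (h idx)"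
        by (simp add: case_prod_unfold)
    qed
  qed
  then show ?thesis by blast
qed

section \<open>Superadditivity of the penalized objective\<close>

lemma sum_mset_count:
  assumes "finite A" and "set_mset W \<subseteq> A"
  shows "(\<Sum>t\<in>#W. f t) = (\<Sum>t\<in>A. int (count W t) * f t)"
  using assms(2)
proof (induction W)
  case (add x W)
  have "(\<Sum>t\<in>A. int (count (add_mset x W) t) * f t) =
    (\<Sum>t\<in>A. int (count W t) * f t + (if t = x then f t else 0))"
    by (intro sum.cong) (auto simp: algebra_simps)
  also have "\<dots> = (\<Sum>t\<in>A. int (count W t) * f t) + f x"
    using add.prems assms(1) by (simp add: sum.distrib)
  finally show ?case using add by simp
qed simp

lemma nat_binary: "\<exists>S. finite S \<and> (c :: nat) = (\<Sum>i\<in>S. 2 ^ i) \<and> (\<forall>i\<in>S. 2 ^ i \<le> c)"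
proof (induction c rule: less_induct)
  case (less c)
  show ?case
  proof (cases "c = 0")
    case True
    then show ?thesis by (intro exI[of _ "{}"]) auto
  next
    case False
    then have "c div 2 < c" by simp
    from less.IH[OF this] obtain S where S: "finite S" "c div 2 = (\<Sum>i\<in>S. 2 ^ i)"
      "\<forall>i\<in>S. 2 ^ i \<le> c div 2" by blast
    define S' where "S' = Suc ` S \<union> (if odd c then {0} else {})"
    have "(\<Sum>i\<in>S'. 2 ^ i) = (\<Sum>i\<in>Suc ` S. 2 ^ i :: nat) + c mod 2"
      unfolding S'_def using S(1) by (subst sum.union_disjoint) (auto simp: odd_iff_mod_2_eq_one)
    also have "(\<Sum>i\<in>Suc ` S. 2 ^ i :: nat) = 2 * (c div 2)"
      unfolding S(2) by (simp add: sum.reindex sum_distrib_left)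
    finally have "c = (\<Sum>i\<in>S'. 2 ^ i)" by simp
    moreover have "2 ^ i \<le> c" if "i \<in> S'" for i
      using that S(3) False by (auto simp: S'_def split: if_splits)
    ultimately show ?thesis using S(1) by (intro exI[of _ S']) (auto simp: S'_def)
  qed
qed

text \<open>With powers of two in place of multiplicities the summands are indexed by distinct
  pairs. Their number is at most the number of vectors times the number of exponents, however large
  \<open>h\<close> is.\<close>

lemma decomp_powers:
  fixes h :: "nat \<Rightarrow> int"
  assumes "\<forall>idx<N. h idx = (\<Sum>t\<in>#W. g t idx) \<and> (\<forall>t\<in>#W. conformal (g t idx) (h idx))"
    and "\<forall>idx<N. \<bar>h idx\<bar> \<le> B"
  shows "\<exists>C. finite C \<and> C \<subseteq> set_mset W \<times> {i. 2 ^ i \<le> B} \<and>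
    (\<forall>idx<N. h idx = (\<Sum>(t, i)\<in>C. 2 ^ i * g t idx) \<and>
      (\<forall>(t, i)\<in>C. conformal (2 ^ i * g t idx) (h idx)))"
proof -
  \<comment> \<open>The multiplicity of a vector that vanishes on the whole range is arbitrary, so
    these vectors are dropped. For any other vector a nonzero entry bounds the multiplicity by
    \<open>B\<close>, since conformal summands do not cancel.\<close>
  define W' where "W' = filter_mset (\<lambda>t. \<exists>idx<N. g t idx \<noteq> 0) W"
  have sub: "set_mset W' \<subseteq> set_mset W" by (auto simp: W'_def)
  have sum_W': "h idx = (\<Sum>t\<in>set_mset W'. int (count W' t) * g t idx)" if "idx < N" for idx
  proof -
    have "h idx = (\<Sum>t\<in>set_mset W. int (count W t) * g t idx)"
      using assms(1) that by (simp add: sum_mset_count)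
    also have "\<dots> = (\<Sum>t\<in>set_mset W'. int (count W' t) * g t idx)"
      using that by (intro sum.mono_neutral_cong_right) (auto simp: W'_def)
    finally show ?thesis .
  qed
  have cB: "int (count W' t) \<le> B" if t: "t \<in># W'" for t
  proof -
    obtain idx where idx: "idx < N" "g t idx \<noteq> 0" using t by (auto simp: W'_def)
    have c: "conformal (g u idx) (h idx)" if "u \<in># W'" for u
      using that assms(1) idx(1) sub by blast
    have "int (count W' t) \<le> int (count W' t) * \<bar>g t idx\<bar>"
      using idx(2) mult_left_mono[of 1 "\<bar>g t idx\<bar>" "int (count W' t)"] by simp
    also have "\<dots> \<le> (\<Sum>u\<in>set_mset W'. int (count W' u) * \<bar>g u idx\<bar>)"
      using t by (intro member_le_sum) auto
    also have "\<dots> = \<bar>h idx\<bar>"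
    proof (cases "0 \<le> h idx")
      case True
      then have "\<bar>g u idx\<bar> = g u idx" if "u \<in># W'" for u
        using c[OF that] by (simp add: conformal_def)
      then have "(\<Sum>u\<in>set_mset W'. int (count W' u) * \<bar>g u idx\<bar>) =
          (\<Sum>u\<in>set_mset W'. int (count W' u) * g u idx)" by (intro sum.cong) auto
      with True show ?thesis by (simp add: sum_W'[OF idx(1), symmetric])
    next
      case False
      then have "\<bar>g u idx\<bar> = - g u idx" if "u \<in># W'" for u
        using c[OF that] by (simp add: conformal_def)
      then have "(\<Sum>u\<in>set_mset W'. int (count W' u) * \<bar>g u idx\<bar>) =
          - (\<Sum>u\<in>set_mset W'. int (count W' u) * g u idx)"
        unfolding sum_negf[symmetric] by (intro sum.cong) auto
      with False show ?thesis by (simp add: sum_W'[OF idx(1), symmetric])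
    qed
    finally show ?thesis using assms(2) idx(1) by force
  qed
  obtain S where S: "\<And>c. finite (S c)" "\<And>c :: nat. c = (\<Sum>i\<in>S c. 2 ^ i)" "\<And>c. \<forall>i\<in>S c. 2 ^ i \<le> c"
    using nat_binary by metis
  define C where "C = Sigma (set_mset W') (\<lambda>t. S (count W' t))"
  show ?thesis
  proof (intro exI[of _ C] conjI allI impI)
    show "finite C" unfolding C_def using S(1) by auto
    have "2 ^ i \<le> B" if "t \<in># W'" "i \<in> S (count W' t)" for t i
    proof -
      have "(2 :: nat) ^ i \<le> count W' t" using S(3) that(2) by blast
      then have "(2 :: int) ^ i \<le> int (count W' t)" by (metis of_nat_le_iff of_nat_numeral of_nat_power)
      from this cB[OF that(1)] show ?thesis by (rule order_trans)
    qed
    then show "C \<subseteq> set_mset W \<times> {i. 2 ^ i \<le> B}" unfolding C_def using sub by auto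
    fix idx assume idx: "idx < N"
    have "(\<Sum>(t, i)\<in>C. 2 ^ i * g t idx) =
      (\<Sum>t\<in>set_mset W'. \<Sum>i\<in>S (count W' t). 2 ^ i * g t idx)"
      unfolding C_def using S(1) by (subst sum.Sigma) auto
    also have "\<dots> = (\<Sum>t\<in>set_mset W'. int (count W' t) * g t idx)"
    proof (intro sum.cong refl)
      fix t
      have "int (count W' t) = int (\<Sum>i\<in>S (count W' t). 2 ^ i)" using S(2) by metis
      then show "(\<Sum>i\<in>S (count W' t). 2 ^ i * g t idx) = int (count W' t) * g t idx"
        by (simp add: sum_distrib_right)
    qed
    finally show "h idx = (\<Sum>(t, i)\<in>C. 2 ^ i * g t idx)" using sum_W'[OF idx] by simp
    have "conformal (2 ^ i * z) w" if "conformal z w" for z w :: int and i :: nat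
      using that by (auto simp: conformal_def mult_nonneg_nonneg mult_nonneg_nonpos)
    then show "\<forall>(t, i)\<in>C. conformal (2 ^ i * g t idx) (h idx)"
      using assms(1) idx sub unfolding C_def by blast
  qed
qed

section \<open>The penalized objective along conformal sums\<close>

definition negpart :: "nat \<Rightarrow> (nat \<Rightarrow> int) \<Rightarrow> int" where
  "negpart N x = (\<Sum>i<N. max 0 (- x i))"

definition pobj :: "int \<Rightarrow> (nat \<Rightarrow> int) \<Rightarrow> nat \<Rightarrow> (nat \<Rightarrow> int) \<Rightarrow> int" where
  "pobj M c N x = (\<Sum>i<N. c i * x i) + M * negpart N x"

lemma negpart_nonneg: "0 \<le> negpart N x"
  by (auto simp: negpart_def intro: sum_nonneg)

text \<open>Convexity of \<open>max 0 (- x)\<close>: for two steps in the same direction, the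
  increment of the joint step is at least the sum of the separate increments.\<close>

lemma max_superadd2:
  assumes "0 \<le> a \<and> 0 \<le> b \<or> a \<le> 0 \<and> b \<le> 0"
  shows "max 0 (- (x + a)) + max 0 (- (x + b)) \<le> max 0 (- (x + (a + b))) + max 0 (- x :: int)"
  using assms unfolding max_def by auto

lemma max_superadd:
  assumes "finite C" and "\<And>t. t \<in> C \<Longrightarrow> conformal (f t) h"
  shows "(\<Sum>t\<in>C. max 0 (- (x + f t)) - max 0 (- x)) \<le> max 0 (- (x + sum f C)) - max 0 (- x :: int)"
  using assms
proof (induction C)
  case (insert t C)
  have "conformal (sum f C) h" using insert.prems by (intro conformal_sum) auto
  moreover have "conformal (f t) h" using insert.prems by auto
  ultimately have "max 0 (- (x + f t)) + max 0 (- (x + sum f C)) \<le>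
      max 0 (- (x + (f t + sum f C))) + max 0 (- x)"
    unfolding conformal_def by (intro max_superadd2) linarith
  moreover have "(\<Sum>t\<in>C. max 0 (- (x + f t)) - max 0 (- x)) \<le> max 0 (- (x + sum f C)) - max 0 (- x)"
    using insert.IH insert.prems by blast
  ultimately show ?case unfolding sum.insert[OF insert.hyps] by linarith
qed simp

lemma negpart_superadd:
  assumes "finite C" and "\<And>i. i < N \<Longrightarrow> h i = (\<Sum>t\<in>C. v t i)"
    and "\<And>i t. i < N \<Longrightarrow> t \<in> C \<Longrightarrow> conformal (v t i) (h i)"
  shows "(\<Sum>t\<in>C. negpart N (\<lambda>i. x i + v t i) - negpart N x) \<le> negpart N (\<lambda>i. x i + h i) - negpart N x"
proof -
  have "(\<Sum>t\<in>C. negpart N (\<lambda>i. x i + v t i) - negpart N x) =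
    (\<Sum>i<N. \<Sum>t\<in>C. max 0 (- (x i + v t i)) - max 0 (- x i))"
    unfolding negpart_def sum_subtractf[symmetric] by (rule sum.swap)
  also have "\<dots> \<le> (\<Sum>i<N. max 0 (- (x i + (\<Sum>t\<in>C. v t i))) - max 0 (- x i))"
  proof (intro sum_mono)
    fix i assume "i \<in> {..<N}"
    then show "(\<Sum>t\<in>C. max 0 (- (x i + v t i)) - max 0 (- x i)) \<le>
        max 0 (- (x i + (\<Sum>t\<in>C. v t i))) - max 0 (- x i)"
      using assms(1,3) by (intro max_superadd[where h = "h i"]) auto
  qed
  also have "\<dots> = negpart N (\<lambda>i. x i + h i) - negpart N x"
    unfolding negpart_def sum_subtractf[symmetric] using assms(2) by (intro sum.cong) auto
  finally show ?thesis .
qed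

text \<open>The linear part is additive along the decomposition, so the claim reduces to the
  negative part, multiplied by a nonnegative weight.\<close>

lemma pobj_superadd:
  assumes "finite C" and "\<And>i. i < N \<Longrightarrow> h i = (\<Sum>t\<in>C. v t i)"
    and "\<And>i t. i < N \<Longrightarrow> t \<in> C \<Longrightarrow> conformal (v t i) (h i)" and "0 \<le> M"
  shows "(\<Sum>t\<in>C. pobj M c N (\<lambda>i. x i + v t i) - pobj M c N x) \<le> pobj M c N (\<lambda>i. x i + h i) - pobj M c N x"
proof -
  have lin: "(\<Sum>t\<in>C. \<Sum>i<N. c i * v t i) = (\<Sum>i<N. c i * h i)"
    by (subst sum.swap) (auto simp: assms(2) sum_distrib_left)
  have diff: "pobj M c N (\<lambda>i. x i + w i) - pobj M c N x =
     (\<Sum>i<N. c i * w i) + M * (negpart N (\<lambda>i. x i + w i) - negpart N x)" for w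
    by (simp add: pobj_def distrib_left sum.distrib right_diff_distrib)
  have "(\<Sum>t\<in>C. pobj M c N (\<lambda>i. x i + v t i) - pobj M c N x) =
    (\<Sum>i<N. c i * h i) + M * (\<Sum>t\<in>C. negpart N (\<lambda>i. x i + v t i) - negpart N x)"
    unfolding diff sum.distrib lin by (simp add: sum_distrib_left)
  also have "\<dots> \<le> (\<Sum>i<N. c i * h i) + M * (negpart N (\<lambda>i. x i + h i) - negpart N x)"
    using assms by (intro add_left_mono mult_left_mono negpart_superadd) auto
  finally show ?thesis unfolding diff .
qed

section \<open>Solutions, candidate steps and the estimate of the gap\<close>

definition sol :: "(nat \<Rightarrow> nat \<Rightarrow> int) \<Rightarrow> nat \<Rightarrow> nat \<Rightarrow> nat \<Rightarrow> (nat \<Rightarrow> nat \<Rightarrow> int) \<Rightarrow> (nat \<Rightarrow> int) \<Rightarrow>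
    (nat \<Rightarrow> int) \<Rightarrow> bool" where
  "sol a p q n bb b0 x \<longleftrightarrow> (\<forall>k<n. \<forall>i<p. (\<Sum>j<q. a i j * x (k * q + j)) = bb k i) \<and>
     (\<forall>j<q. (\<Sum>k<n. x (k * q + j)) = b0 j)"

lemma sol_diff_kernel: "sol a p q n bb b0 x \<Longrightarrow> sol a p q n bb b0 y \<Longrightarrow> nfold_kernel a p q n (\<lambda>i. y i - x i)"
  by (simp add: sol_def nfold_kernel_def right_diff_distrib sum_subtractf)

lemma sol_add_kernel: "sol a p q n bb b0 x \<Longrightarrow> nfold_kernel a p q n h \<Longrightarrow> sol a p q n bb b0 (\<lambda>i. x i + z * h i)"
  by (simp add: sol_def nfold_kernel_def distrib_left sum.distrib mult.left_commute[of _ z] flip: sum_distrib_left)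

lemma spread_brick:
  assumes "j < q"
  shows "spread q n T m (k * q + j) = (\<Sum>i<length T. if k = m div n ^ i mod n then (T ! i) j else 0)"
proof -
  have "(k * q + j) div q = k" "(k * q + j) mod q = j" using assms by auto
  then show ?thesis by (simp only: spread_def)
qed

lemma templates_nth:
  assumes "T \<in> templates a p q L r" and "i < L"
  shows "T ! i \<in> int_ker a p q" and "\<bar>(T ! i) j\<bar> \<le> int r"
proof -
  have "T ! i \<in> set T" using assms by (auto simp: templates_def)
  then show "T ! i \<in> int_ker a p q" and "\<bar>(T ! i) j\<bar> \<le> int r"
    using assms(1) unfolding templates_def by blast+
qed

lemma spread_kernel:
  assumes "T \<in> templates a p q L r" and "n > 0"
  shows "nfold_kernel a p q n (spread q n T m)"
  unfolding nfold_kernel_def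
proof (intro conjI allI impI)
  have T: "length T = L" "\<And>i. i < L \<Longrightarrow> T ! i \<in> int_ker a p q" "\<And>j. j < q \<Longrightarrow> (\<Sum>i<L. (T ! i) j) = 0"
    using assms(1) templates_nth[OF assms(1)] by (auto simp: templates_def)
  fix k i assume "k < n" "i < p"
  have "(\<Sum>j<q. a i j * spread q n T m (k * q + j)) =
    (\<Sum>j<q. \<Sum>l<L. if k = m div n ^ l mod n then a i j * (T ! l) j else 0)"
    by (intro sum.cong) (auto simp: spread_brick T(1) sum_distrib_left intro!: sum.cong)
  also have "\<dots> = (\<Sum>l<L. \<Sum>j<q. if k = m div n ^ l mod n then a i j * (T ! l) j else 0)"
    by (rule sum.swap)
  also have "\<dots> = 0"
  proof (rule sum.neutral, rule ballI)
    fix l assume "l \<in> {..<L}"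
    then have "(\<Sum>j<q. a i j * (T ! l) j) = 0" using T(2)[of l] \<open>i < p\<close> by (simp add: int_ker_def)
    then show "(\<Sum>j<q. if k = m div n ^ l mod n then a i j * (T ! l) j else 0) = 0"
      by (cases "k = m div n ^ l mod n") simp_all
  qed
  finally show "(\<Sum>j<q. a i j * spread q n T m (k * q + j)) = 0" .
next
  have T: "length T = L" "\<And>i. i < L \<Longrightarrow> T ! i \<in> int_ker a p q" "\<And>j. j < q \<Longrightarrow> (\<Sum>i<L. (T ! i) j) = 0"
    using assms(1) templates_nth[OF assms(1)] by (auto simp: templates_def)
  fix j assume j: "j < q"
  have "(\<Sum>k<n. spread q n T m (k * q + j)) =
    (\<Sum>l<L. \<Sum>k<n. if k = m div n ^ l mod n then (T ! l) j else 0)"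
    unfolding spread_brick[OF j] T(1) by (rule sum.swap)
  also have "\<dots> = (\<Sum>l<L. (T ! l) j)"
    using assms(2) by (intro sum.cong) (auto simp: sum.delta)
  finally show "(\<Sum>k<n. spread q n T m (k * q + j)) = 0" using T(3) j by simp
qed

lemma spread_bound:
  assumes "T \<in> templates a p q L r"
  shows "\<bar>spread q n T m idx\<bar> \<le> int (L * r)"
proof -
  have T: "length T = L" "\<And>i j. i < L \<Longrightarrow> \<bar>(T ! i) j\<bar> \<le> int r"
    using assms templates_nth[OF assms] by (auto simp: templates_def)
  have "\<bar>spread q n T m idx\<bar> \<le> (\<Sum>i<L. \<bar>if idx div q = m div n ^ i mod n then (T ! i) (idx mod q) else 0\<bar>)"
    unfolding spread_def T(1) by (rule sum_abs)
  also have "\<dots> \<le> (\<Sum>i<L. int r)" using T(2) by (intro sum_mono) auto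
  finally show ?thesis by simp
qed

definition scaled_spread :: "nat \<Rightarrow> nat \<Rightarrow> ((nat \<Rightarrow> int) list \<times> nat) \<times> nat \<Rightarrow> nat \<Rightarrow> int" where
  "scaled_spread q n t idx = 2 ^ snd t * spread q n (fst (fst t)) (snd (fst t)) idx"

text \<open>The point is the order of the quantifiers: \<open>L\<close> and \<open>r\<close> belong
  to the matrix and are fixed before \<open>n\<close>, \<open>h\<close> and
  \<open>B\<close>.\<close>

definition decomposable :: "(nat \<Rightarrow> nat \<Rightarrow> int) \<Rightarrow> nat \<Rightarrow> nat \<Rightarrow> nat \<Rightarrow> nat \<Rightarrow> bool" where
  "decomposable a p q L r \<longleftrightarrow> (\<forall>n h B. n > 0 \<longrightarrow> nfold_kernel a p q n h \<longrightarrow> (\<forall>idx<n * q. \<bar>h idx\<bar> \<le> B) \<longrightarrow> (\<exists>C.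
     finite C \<and> C \<subseteq> (templates a p q L r \<times> {..<n ^ L}) \<times> {i. 2 ^ i \<le> B} \<and>
     (\<forall>idx<n * q. h idx = (\<Sum>t\<in>C. scaled_spread q n t idx) \<and> (\<forall>t\<in>C. conformal (scaled_spread q n t idx) (h idx)))))"

lemma decomposable_exists: "\<exists>L r. decomposable a p q L r"
proof -
  obtain L r where W: "\<And>n h. n > 0 \<and> nfold_kernel a p q n h \<longrightarrow> (\<exists>W.
     set_mset W \<subseteq> templates a p q L r \<times> {..<n ^ L} \<and>
     (\<forall>idx<n * q. h idx = (\<Sum>(T, m)\<in>#W. spread q n T m idx) \<and>
       (\<forall>(T, m)\<in>#W. conformal (spread q n T m idx) (h idx))))"
    using nfold_kernel_decomp[of a p q] by metis
  have "decomposable a p q L r"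
    unfolding decomposable_def
  proof (intro allI impI)
    fix n h B assume n: "0 < n" and h: "nfold_kernel a p q n h" and B: "\<forall>idx<n * q. \<bar>h idx\<bar> \<le> B"
    define g where "g = (\<lambda>t. spread q n (fst t) (snd t))"
    from W[rule_format, OF conjI[OF n h]] obtain W where
      W: "set_mset W \<subseteq> templates a p q L r \<times> {..<n ^ L}"
      "\<forall>idx<n * q. h idx = (\<Sum>t\<in>#W. g t idx) \<and> (\<forall>t\<in>#W. conformal (g t idx) (h idx))"
      unfolding case_prod_unfold g_def by blast
    obtain C where C: "finite C" "C \<subseteq> set_mset W \<times> {i. 2 ^ i \<le> B}"
      "\<forall>idx<n * q. h idx = (\<Sum>(t, i)\<in>C. 2 ^ i * g t idx) \<and>
        (\<forall>(t, i)\<in>C. conformal (2 ^ i * g t idx) (h idx))"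
      using decomp_powers[OF W(2) B] by blast
    have "C \<subseteq> (templates a p q L r \<times> {..<n ^ L}) \<times> {i. 2 ^ i \<le> B}" using C(2) W(1) by blast
    with C(1,3)
    show "\<exists>C. finite C \<and> C \<subseteq> (templates a p q L r \<times> {..<n ^ L}) \<times> {i. 2 ^ i \<le> B} \<and>
     (\<forall>idx<n * q. h idx = (\<Sum>t\<in>C. scaled_spread q n t idx) \<and> (\<forall>t\<in>C. conformal (scaled_spread q n t idx) (h idx)))"
      unfolding scaled_spread_def g_def case_prod_unfold by (intro exI[of _ C] conjI)
  qed
  then show ?thesis by blast
qed

text \<open>The weight exceeds any change of the linear cost by a step whose entries are at most
  \<open>M\<close> in absolute value.\<close>

definition obj :: "int \<Rightarrow> (nat \<Rightarrow> int) \<Rightarrow> nat \<Rightarrow> (nat \<Rightarrow> int) \<Rightarrow> int" where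
  "obj M c N = pobj (1 + M * (\<Sum>i<N. \<bar>c i\<bar>)) c N"

text \<open>\<open>\<beta>\<close> stands for the best value found by a search. By superadditivity
  the decrease from \<open>x\<close> to \<open>y\<close> is at most the sum of the decreases under
  the single steps of the decomposition of \<open>y - x\<close>. Each of these is at most
  \<open>F x - \<beta>\<close>, and the exponents are below \<open>V\<close>, which bounds the
  number of steps.\<close>

lemma obj_gap:
  assumes dec: "decomposable a p q L r" and "n > 0" and "0 \<le> M"
    and x: "sol a p q n bb b0 x" and y: "sol a p q n bb b0 y"
    and B: "\<forall>idx<n * q. \<bar>y idx - x idx\<bar> \<le> B" "B < 2 ^ V"
    and \<beta>: "\<beta> \<le> obj M c (n * q) x"
      "\<And>T m i. T \<in> templates a p q L r \<Longrightarrow> m < n ^ L \<Longrightarrow> 2 ^ i \<le> B \<Longrightarrow>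
        \<beta> \<le> obj M c (n * q) (\<lambda>idx. x idx + 2 ^ i * spread q n T m idx)"
  shows "obj M c (n * q) x - obj M c (n * q) y \<le>
    int (card (templates a p q L r) * n ^ L * V) * (obj M c (n * q) x - \<beta>)"
proof -
  define h where "h = (\<lambda>i. y i - x i)"
  define F where "F = obj M c (n * q)"
  have nfold_kernel: "nfold_kernel a p q n h" unfolding h_def by (rule sol_diff_kernel[OF x y])
  have bd: "\<forall>idx<n * q. \<bar>h idx\<bar> \<le> B" using B(1) by (simp add: h_def)
  from dec[unfolded decomposable_def, THEN spec, THEN spec, THEN spec, THEN mp, THEN mp, THEN mp,
      OF \<open>n > 0\<close> nfold_kernel bd] obtain C where
    C0: "finite C \<and> C \<subseteq> (templates a p q L r \<times> {..<n ^ L}) \<times> {i. 2 ^ i \<le> B} \<and>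
      (\<forall>idx<n * q. h idx = (\<Sum>t\<in>C. scaled_spread q n t idx) \<and> (\<forall>t\<in>C. conformal (scaled_spread q n t idx) (h idx)))" ..
  note C = C0[THEN conjunct1] C0[THEN conjunct2, THEN conjunct1]
    C0[THEN conjunct2, THEN conjunct2, rule_format, THEN conjunct1]
    C0[THEN conjunct2, THEN conjunct2, rule_format, THEN conjunct2, rule_format]
  have "{i. 2 ^ i \<le> B} \<subseteq> {..<V}"
  proof
    fix i assume "i \<in> {i. 2 ^ i \<le> B}"
    then have "(2 :: int) ^ i < 2 ^ V" using B(2) unfolding mem_Collect_eq by linarith
    then show "i \<in> {..<V}" by simp
  qed
  with C(2) have "C \<subseteq> (templates a p q L r \<times> {..<n ^ L}) \<times> {..<V}" by blast
  from card_mono[OF _ this] have card: "card C \<le> card (templates a p q L r) * n ^ L * V"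
    by (simp add: finite_templates card_cartesian_product)
  have "0 \<le> 1 + M * (\<Sum>i<n * q. \<bar>c i\<bar>)" using \<open>0 \<le> M\<close> by (simp add: sum_nonneg)
  then have "(\<Sum>t\<in>C. F (\<lambda>i. x i + scaled_spread q n t i) - F x) \<le> F (\<lambda>i. x i + h i) - F x"
    unfolding F_def obj_def using C(1,3,4) by (intro pobj_superadd)
  moreover have "F (\<lambda>i. x i + h i) = F y" by (simp add: h_def)
  moreover have "(\<Sum>t\<in>C. F (\<lambda>i. x i + scaled_spread q n t i) - F x) \<ge> (\<Sum>t\<in>C. \<beta> - F x)"
    using C(2) \<beta>(2) unfolding F_def scaled_spread_def by (intro sum_mono) auto
  ultimately have "F x - F y \<le> int (card C) * (F x - \<beta>)"
    by (simp add: algebra_simps)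
  also have "\<dots> \<le> int (card (templates a p q L r) * n ^ L * V) * (F x - \<beta>)"
    using card \<beta>(1) unfolding F_def of_nat_le_iff[symmetric, where 'a = int] by (intro mult_right_mono) auto
  finally show ?thesis unfolding F_def .
qed

section \<open>Size of solutions and exactness of the penalty\<close>

lemma sum_bricks: "(\<Sum>i<n * q. f i) = (\<Sum>k<n. \<Sum>j<q. f (k * q + j :: nat))"
proof -
  have "(\<Sum>i<n * q. f i) = (\<Sum>k<n. sum f {k * q..<k * q + q})" by (rule sum.nat_group[symmetric])
  also have "\<dots> = (\<Sum>k<n. \<Sum>j<q. f (k * q + j))"
  proof (rule sum.cong[OF refl])
    fix k
    show "sum f {k * q..<k * q + q} = (\<Sum>j<q. f (k * q + j))"
      using sum.atLeastLessThan_shift_0[of f "k * q" "k * q + q"] by (simp add: atLeast0LessThan)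
  qed
  finally show ?thesis .
qed

text \<open>The bricks sum to \<open>b0\<close>, so the sum of all entries is fixed; the sum of the
  absolute values exceeds it by twice the negative part.\<close>

lemma sol_sum_abs:
  assumes "sol a p q n bb b0 y"
  shows "(\<Sum>i<n * q. \<bar>y i\<bar>) \<le> (\<Sum>j<q. \<bar>b0 j\<bar>) + 2 * negpart (n * q) y"
proof -
  have "(\<Sum>i<n * q. y i) = (\<Sum>j<q. b0 j)"
    using assms unfolding sum_bricks sol_def by (subst sum.swap) (auto intro: sum.cong)
  moreover have "(\<Sum>i<n * q. \<bar>y i\<bar>) = (\<Sum>i<n * q. y i) + 2 * negpart (n * q) y"
    unfolding negpart_def sum_distrib_left sum.distrib[symmetric] by (intro sum.cong) auto
  moreover have "(\<Sum>j<q. b0 j) \<le> (\<Sum>j<q. \<bar>b0 j\<bar>)" by (intro sum_mono) auto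
  ultimately show ?thesis by linarith
qed

lemma sol_entry_bound:
  assumes "sol a p q n bb b0 y" and "i < n * q"
  shows "\<bar>y i\<bar> \<le> (\<Sum>j<q. \<bar>b0 j\<bar>) + 2 * negpart (n * q) y"
proof -
  have "\<bar>y i\<bar> \<le> (\<Sum>i<n * q. \<bar>y i\<bar>)" using assms(2) by (intro member_le_sum) auto
  then show ?thesis using sol_sum_abs[OF assms(1)] by linarith
qed

text \<open>With the abbreviations of the proof, the linear cost is at least
  \<open>- K * (b + 2 * N)\<close>. The penalty \<open>(1 + M * K) * N\<close> absorbs
  \<open>2 * K * N\<close> because \<open>2 \<le> M\<close>, and \<open>N\<close> is left
  over.\<close>

lemma obj_lower_bound:
  assumes y: "sol a p q n bb b0 y" and "2 \<le> M"
  shows "negpart (n * q) y - (\<Sum>i<n * q. \<bar>c i\<bar>) * (\<Sum>j<q. \<bar>b0 j\<bar>) \<le> obj M c (n * q) y"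
proof -
  define K where "K = (\<Sum>i<n * q. \<bar>c i\<bar>)"
  define b where "b = (\<Sum>j<q. \<bar>b0 j\<bar>)"
  define N where "N = negpart (n * q) y"
  have "- (\<Sum>i<n * q. c i * y i) \<le> (\<Sum>i<n * q. \<bar>c i\<bar> * (b + 2 * N))"
    unfolding sum_negf[symmetric]
  proof (intro sum_mono)
    fix i assume "i \<in> {..<n * q}"
    then have "\<bar>c i\<bar> * \<bar>y i\<bar> \<le> \<bar>c i\<bar> * (b + 2 * N)"
      using sol_entry_bound[OF y] by (intro mult_left_mono) (auto simp: b_def N_def)
    moreover have "- (c i * y i) \<le> \<bar>c i\<bar> * \<bar>y i\<bar>" unfolding abs_mult[symmetric] by linarith
    ultimately show "- (c i * y i) \<le> \<bar>c i\<bar> * (b + 2 * N)" by linarith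
  qed
  also have "\<dots> = K * b + 2 * (K * N)" unfolding sum_distrib_right[symmetric] K_def[symmetric] by (simp add: algebra_simps)
  finally have "- (K * b) - 2 * (K * N) \<le> (\<Sum>i<n * q. c i * y i)" by linarith
  moreover have "2 * (K * N) \<le> M * (K * N)"
    using assms(2) negpart_nonneg by (intro mult_right_mono) (auto simp: K_def N_def sum_nonneg)
  ultimately show ?thesis
    unfolding obj_def pobj_def K_def[symmetric] b_def[symmetric] N_def[symmetric]
    by (simp add: algebra_simps)
qed

text \<open>The right-hand side is what the program later computes as its bound on the step length.
  A value of at most \<open>F0\<close> bounds the negative part, and the negative part bounds the
  entries.\<close>

lemma sol_distance:
  assumes "sol a p q n bb b0 x" "sol a p q n bb b0 y" "2 \<le> M"
    and "obj M c (n * q) x \<le> F0" "obj M c (n * q) y \<le> F0" and "i < n * q"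
  shows "\<bar>y i - x i\<bar> \<le> 2 * (\<Sum>j<q. \<bar>b0 j\<bar>) +
    4 * (F0 + (\<Sum>i<n * q. \<bar>c i\<bar>) * (\<Sum>j<q. \<bar>b0 j\<bar>))"
proof -
  define P where "P = (\<Sum>i<n * q. \<bar>c i\<bar>) * (\<Sum>j<q. \<bar>b0 j\<bar>)"
  define b where "b = (\<Sum>j<q. \<bar>b0 j\<bar>)"
  have "negpart (n * q) x \<le> F0 + P" "negpart (n * q) y \<le> F0 + P"
    using obj_lower_bound[OF assms(1,3), of c] obj_lower_bound[OF assms(2,3), of c] assms(4,5)
    unfolding P_def by linarith+
  with sol_entry_bound[OF assms(1,6)] sol_entry_bound[OF assms(2,6)] abs_triangle_ineq4[of "y i" "x i"]
  show ?thesis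
    unfolding P_def[symmetric] unfolding b_def[symmetric] by (smt (verit))
qed

text \<open>The objective is integral and bounded below on the solutions; shifted by
  \<open>K\<close> it takes natural values, of which there is a least one.\<close>

lemma obj_minimizer:
  assumes "sol a p q n bb b0 x" and "2 \<le> M"
  shows "\<exists>y. sol a p q n bb b0 y \<and> (\<forall>z. sol a p q n bb b0 z \<longrightarrow> obj M c (n * q) y \<le> obj M c (n * q) z)"
proof -
  define K where "K = (\<Sum>i<n * q. \<bar>c i\<bar>) * (\<Sum>j<q. \<bar>b0 j\<bar>)"
  have nn: "0 \<le> obj M c (n * q) z + K" if "sol a p q n bb b0 z" for z
    using obj_lower_bound[OF that assms(2), of c] negpart_nonneg[of "n * q" z] by (simp add: K_def)
  obtain y where "sol a p q n bb b0 y"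
    "\<forall>z. sol a p q n bb b0 z \<longrightarrow> nat (obj M c (n * q) y + K) \<le> nat (obj M c (n * q) z + K)"
    using ex_has_least_nat[of "sol a p q n bb b0" x "\<lambda>z. nat (obj M c (n * q) z + K)"] assms(1) by auto
  then show ?thesis using nn by (intro exI[of _ y]) force
qed

text \<open>The penalty is exact: a unit decrease of the negative part outweighs the cost of any step.\<close>

lemma minimizer_nonneg:
  assumes dec: "decomposable a p q L r" and "n > 0" and M: "int (L * r) \<le> M"
    and x: "sol a p q n bb b0 x"
    and min: "\<And>z. sol a p q n bb b0 z \<Longrightarrow> obj M c (n * q) x \<le> obj M c (n * q) z"
    and y: "sol a p q n bb b0 y" "\<And>i. i < n * q \<Longrightarrow> 0 \<le> y i"
    and i: "i < n * q"
  shows "0 \<le> x i"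
proof (rule ccontr)
  assume neg: "\<not> 0 \<le> x i"
  define N where "N = n * q"
  define h where "h = (\<lambda>i. y i - x i)"
  have bd: "\<forall>idx<n * q. \<bar>h idx\<bar> \<le> (\<Sum>i<n * q. \<bar>h i\<bar>)" by (auto intro!: member_le_sum)
  have nfold_kernel: "nfold_kernel a p q n h" unfolding h_def by (rule sol_diff_kernel[OF x y(1)])
  from dec[unfolded decomposable_def, THEN spec, THEN spec, THEN spec, THEN mp, THEN mp, THEN mp,
      OF \<open>n > 0\<close> nfold_kernel bd] obtain C where
    C0: "finite C \<and> C \<subseteq> (templates a p q L r \<times> {..<n ^ L}) \<times> {i. 2 ^ i \<le> (\<Sum>i<n * q. \<bar>h i\<bar>)} \<and>
      (\<forall>idx<n * q. h idx = (\<Sum>t\<in>C. scaled_spread q n t idx) \<and> (\<forall>t\<in>C. conformal (scaled_spread q n t idx) (h idx)))" ..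
  note C = C0[THEN conjunct1] C0[THEN conjunct2, THEN conjunct1]
    C0[THEN conjunct2, THEN conjunct2, rule_format, THEN conjunct1]
    C0[THEN conjunct2, THEN conjunct2, rule_format, THEN conjunct2, rule_format]
  \<comment> \<open>The negative part vanishes at \<open>y\<close> and is positive at
    \<open>x\<close>, so some summand of the decomposition of \<open>y - x\<close> decreases
    it.\<close>
  have "(\<Sum>t\<in>C. negpart N (\<lambda>i. x i + scaled_spread q n t i) - negpart N x) \<le> negpart N (\<lambda>i. x i + h i) - negpart N x"
    using C(1,3,4) unfolding N_def by (intro negpart_superadd)
  also have "negpart N (\<lambda>i. x i + h i) = 0"
    using y(2) by (simp add: h_def negpart_def N_def)
  also have "0 - negpart N x < 0"
    using neg i sum_pos2[of "{..<N}" i "\<lambda>i. max 0 (- x i)"] by (auto simp: negpart_def N_def)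
  finally have "\<exists>t\<in>C. negpart N (\<lambda>i. x i + scaled_spread q n t i) - negpart N x < 0"
    by (meson not_le sum_nonneg)
  then obtain T m e where t: "((T, m), e) \<in> C" "negpart N (\<lambda>i. x i + 2 ^ e * spread q n T m i) < negpart N x"
    by (auto simp: scaled_spread_def)
  define g where "g = spread q n T m"
  have T: "T \<in> templates a p q L r" using t(1) C(2) by auto
  \<comment> \<open>The step \<open>2 ^ e * g\<close> is regarded as \<open>2 ^ e\<close> equal
    steps. So \<open>g\<close> alone already decreases the negative part, and the cost of
    \<open>g\<close> has a bound that does not involve \<open>e\<close>.\<close>
  have "(\<Sum>s<(2::nat) ^ e. negpart N (\<lambda>i. x i + g i) - negpart N x) \<le>
      negpart N (\<lambda>i. x i + 2 ^ e * g i) - negpart N x"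
    by (intro negpart_superadd) (auto simp: conformal_def zero_le_mult_iff mult_le_0_iff)
  also have "\<dots> < 0" using t(2) by (simp add: g_def)
  finally have "negpart N (\<lambda>i. x i + g i) < negpart N x" by (auto simp: mult_less_0_iff)
  then have less: "negpart N (\<lambda>i. x i + g i) - negpart N x \<le> -1" by simp
  define K where "K = (\<Sum>i<N. \<bar>c i\<bar>)"
  have K: "0 \<le> K" by (simp add: K_def sum_nonneg)
  have "sol a p q n bb b0 (\<lambda>i. x i + 1 * g i)"
    unfolding g_def by (rule sol_add_kernel[OF x spread_kernel[OF T \<open>n > 0\<close>]])
  with min have "obj M c N x \<le> obj M c N (\<lambda>i. x i + g i)" unfolding N_def by simp
  then have "0 \<le> (\<Sum>i<N. c i * g i) + (1 + M * K) * (negpart N (\<lambda>i. x i + g i) - negpart N x)"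
    unfolding obj_def pobj_def K_def[symmetric] by (simp add: distrib_left sum.distrib right_diff_distrib)
  also have "(\<Sum>i<N. c i * g i) \<le> (\<Sum>i<N. \<bar>c i\<bar> * M)"
  proof (intro sum_mono)
    fix i
    have "c i * g i \<le> \<bar>c i\<bar> * \<bar>g i\<bar>" unfolding abs_mult[symmetric] by linarith
    also have "\<dots> \<le> \<bar>c i\<bar> * M"
      using spread_bound[OF T, of n m i] M unfolding g_def by (intro mult_left_mono) linarith+
    finally show "c i * g i \<le> \<bar>c i\<bar> * M" .
  qed
  also have "(\<Sum>i<N. \<bar>c i\<bar> * M) = M * K" by (simp add: K_def sum_distrib_left mult.commute)
  also have "M * K + (1 + M * K) * (negpart N (\<lambda>i. x i + g i) - negpart N x) \<le> M * K + (1 + M * K) * (- 1)"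
  proof (intro add_left_mono mult_left_mono less)
    have "0 \<le> M" using M by (rule order_trans[rotated]) simp
    then show "0 \<le> 1 + M * K" using K by simp
  qed
  finally show False by simp
qed

section \<open>Unit cost runs and their logarithmic cost\<close>

inductive run :: "com \<Rightarrow> state \<Rightarrow> nat \<Rightarrow> state \<Rightarrow> bool" where
  run_Skip: "run Skip s 1 s"
| run_Assign: "run (Assign r e) s 1 (s\<lparr>regs := (regs s)(r := aval e s)\<rparr>)"
| run_Store: "run (Store a i e) s 1 (s\<lparr>arrs := (arrs s)(a := (arrs s a)(aval i s := aval e s))\<rparr>)"
| run_Seq: "run P s m s' \<Longrightarrow> run Q s' n s'' \<Longrightarrow> run (Seq P Q) s (m + n) s''"
| run_IfTrue: "bval b s \<Longrightarrow> run P s n s' \<Longrightarrow> run (If b P Q) s (Suc n) s'"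
| run_IfFalse: "\<not> bval b s \<Longrightarrow> run Q s n s' \<Longrightarrow> run (If b P Q) s (Suc n) s'"
| run_WhileFalse: "\<not> bval b s \<Longrightarrow> run (While b P) s 1 s"
| run_WhileTrue: "bval b s \<Longrightarrow> run P s m s' \<Longrightarrow> run (While b P) s' n s'' \<Longrightarrow>
    run (While b P) s (Suc (m + n)) s''"

text \<open>Chosen so that evaluating \<open>e\<close> adds at most \<open>weight e * w\<close> bits
  to the length of the numbers in memory, where \<open>w\<close> bounds the length of the input. A
  constant counts with its own length, because it may be a factor.\<close>

fun weight :: "aexp \<Rightarrow> nat" where
  "weight (Const z) = bit_size z"
| "weight (Reg r) = 1"
| "weight (Cell a e) = Suc (weight e)"
| "weight (Add e f) = Suc (weight e + weight f)"
| "weight (Sub e f) = Suc (weight e + weight f)"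
| "weight (Mult e f) = Suc (weight e + weight f)"
| "weight (Div e f) = Suc (weight e + weight f)"

fun bweight :: "bexp \<Rightarrow> nat" where
  "bweight (Less e f) = Suc (weight e + weight f)"
| "bweight (Neg b) = Suc (bweight b)"
| "bweight (Conj b d) = Suc (bweight b + bweight d)"

fun cweight :: "com \<Rightarrow> nat" where
  "cweight Skip = 1"
| "cweight (Assign r e) = weight e"
| "cweight (Store a i e) = weight i + weight e"
| "cweight (Seq P Q) = cweight P + cweight Q"
| "cweight (If b P Q) = bweight b + cweight P + cweight Q"
| "cweight (While b P) = bweight b + cweight P"

text \<open>
  Tame programs multiply only by constants or, if \<open>i\<close> is set, by cells of the array \<open>0\<close>, which
  they then leave unchanged. Each step adds a bounded number of input lengths to the length of the
  largest number in memory, so a polynomial number of steps takes polynomial time.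
\<close>

fun tame :: "bool \<Rightarrow> aexp \<Rightarrow> bool" where
  "tame i (Const z) \<longleftrightarrow> True"
| "tame i (Reg r) \<longleftrightarrow> True"
| "tame i (Cell a e) \<longleftrightarrow> tame i e"
| "tame i (Add e f) \<longleftrightarrow> tame i e \<and> tame i f"
| "tame i (Sub e f) \<longleftrightarrow> tame i e \<and> tame i f"
| "tame i (Mult e f) \<longleftrightarrow> tame i e \<and> tame i f \<and> ((\<exists>z. e = Const z) \<or> i \<and> (\<exists>g. e = Cell 0 g))"
| "tame i (Div e f) \<longleftrightarrow> tame i e \<and> tame i f"

fun btame :: "bool \<Rightarrow> bexp \<Rightarrow> bool" where
  "btame i (Less e f) \<longleftrightarrow> tame i e \<and> tame i f"
| "btame i (Neg b) \<longleftrightarrow> btame i b"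
| "btame i (Conj b d) \<longleftrightarrow> btame i b \<and> btame i d"

fun ctame :: "bool \<Rightarrow> com \<Rightarrow> bool" where
  "ctame i Skip \<longleftrightarrow> True"
| "ctame i (Assign r e) \<longleftrightarrow> tame i e"
| "ctame i (Store a e f) \<longleftrightarrow> tame i e \<and> tame i f \<and> (i \<longrightarrow> a \<noteq> 0)"
| "ctame i (Seq P Q) \<longleftrightarrow> ctame i P \<and> ctame i Q"
| "ctame i (If b P Q) \<longleftrightarrow> btame i b \<and> ctame i P \<and> ctame i Q"
| "ctame i (While b P) \<longleftrightarrow> btame i b \<and> ctame i P"

definition bounded :: "nat \<Rightarrow> state \<Rightarrow> bool" where
  "bounded v s \<longleftrightarrow> (\<forall>r. \<bar>regs s r\<bar> \<le> 2 ^ v) \<and> (\<forall>a i. \<bar>arrs s a i\<bar> \<le> 2 ^ v)"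

definition input_bounded :: "nat \<Rightarrow> state \<Rightarrow> bool" where
  "input_bounded w s \<longleftrightarrow> (\<forall>i. \<bar>arrs s 0 i\<bar> \<le> 2 ^ w)"

section \<open>Bit lengths of values and the logarithmic cost\<close>

lemma abs_le_bit_size: "\<bar>z\<bar> \<le> 2 ^ bit_size z"
proof (cases "z = 0")
  case False
  then have "\<bar>z\<bar> < 2 ^ nat (bitlen \<bar>z\<bar>)" using bitlen_bounds[of "\<bar>z\<bar>"] by simp
  also have "\<dots> \<le> 2 ^ bit_size z" by (intro power_increasing) (auto simp: bit_size_def)
  finally show ?thesis by simp
qed simp

lemma bit_size_le:
  assumes "\<bar>z\<bar> \<le> 2 ^ m"
  shows "bit_size z \<le> m + 2"
proof -
  have "\<bar>z\<bar> < 2 ^ (m + 1)" using assms by (simp add: less_le_trans le_less_trans)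
  then have "bitlen \<bar>z\<bar> \<le> int (m + 1)" by (subst bitlen_le_iff_power) (simp_all only: nat_int of_nat_0_le_iff simp_thms)
  then show ?thesis by (simp add: bit_size_def)
qed

lemma div_abs_le: "\<bar>x div y\<bar> \<le> \<bar>x :: int\<bar>"
proof -
  have *: "\<bar>x div y\<bar> \<le> \<bar>x\<bar>" if "y > 0" for x y :: int
  proof (cases "x \<ge> 0")
    case True
    then show ?thesis using that using zdiv_mono2[of x 1 y] by (simp add: pos_imp_zdiv_nonneg_iff)
  next
    case False
    have "x * y \<le> x" using that False mult_left_mono_neg[of 1 y x] by simp
    then have "x \<le> x div y" using that zdiv_mono1[of "x * y" x y] by simp
    moreover have "x div y < 0" using that False by (simp add: neg_imp_zdiv_neg_iff div_neg_pos_less0)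
    ultimately show ?thesis using False by simp
  qed
  consider "y > 0" | "y = 0" | "y < 0" by linarith
  then show ?thesis
  proof cases
    case 3
    then show ?thesis using *[of "- y" "- x"] by simp
  qed (use * in auto)
qed

lemma aval_bound:
  assumes "tame i e" and "bounded v s" and "i \<Longrightarrow> input_bounded w s" and "0 < w"
  shows "\<bar>aval e s\<bar> \<le> 2 ^ (v + weight e * w)"
proof -
  have add_bound: "\<bar>x + y\<bar> \<le> 2 ^ (v + Suc (weight e + weight f) * w)"
    if "\<bar>x\<bar> \<le> 2 ^ (v + weight e * w)" "\<bar>y\<bar> \<le> 2 ^ (v + weight f * w)" for x y :: int and e f
  proof -
    define u where "u = v + (weight e + weight f) * w"
    have "(2 :: int) ^ (v + weight e * w) \<le> 2 ^ u" "(2 :: int) ^ (v + weight f * w) \<le> 2 ^ u"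
      unfolding u_def by (intro power_increasing; simp add: add_mult_distrib)+
    with that have "\<bar>x\<bar> \<le> 2 ^ u" "\<bar>y\<bar> \<le> 2 ^ u" by linarith+
    then have "\<bar>x + y\<bar> \<le> 2 ^ (u + 1)" by simp
    also have "\<dots> \<le> 2 ^ (v + Suc (weight e + weight f) * w)"
      using assms(4) unfolding u_def by (intro power_increasing) simp_all
    finally show ?thesis .
  qed
  show ?thesis using assms(1)
  proof (induction e)
    case (Const z)
    have "bit_size z \<le> bit_size z * w" using assms(4) by (cases w) simp_all
    then have "(2 :: int) ^ bit_size z \<le> 2 ^ (v + bit_size z * w)" by (intro power_increasing trans_le_add2) simp_all
    from order_trans[OF abs_le_bit_size this] show ?case by simp
  next
    case (Reg r)
    have "(2 :: int) ^ v \<le> 2 ^ (v + w)" by (intro power_increasing) auto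
    with assms(2) show ?case unfolding bounded_def by (auto intro: order_trans)
  next
    case (Cell a e)
    have "(2 :: int) ^ v \<le> 2 ^ (v + weight (Cell a e) * w)" by (intro power_increasing) auto
    moreover have "\<bar>aval (Cell a e) s\<bar> \<le> 2 ^ v" using assms(2) by (simp add: bounded_def)
    ultimately show ?case by (rule order_trans[rotated])
  next
    case (Add e f)
    then show ?case using add_bound[of "aval e s" e "aval f s" f] by simp
  next
    case (Sub e f)
    then show ?case using add_bound[of "aval e s" e "- aval f s" f] by simp
  next
    case (Mult e f)
    \<comment> \<open>The bound for the left factor does not contain \<open>v\<close>. So the length
      of the memory enters a product only once and grows additively.\<close>
    have e: "\<bar>aval e s\<bar> \<le> 2 ^ (weight e * w)"
    proof (cases "\<exists>z. e = Const z")
      case True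
      then obtain z where z: "e = Const z" by blast
      have "bit_size z \<le> bit_size z * w" using assms(4) by (cases w) simp_all
      then have "(2 :: int) ^ bit_size z \<le> 2 ^ (bit_size z * w)" by (intro power_increasing) simp_all
      from order_trans[OF abs_le_bit_size this] z show ?thesis by simp
    next
      case False
      with Mult.prems obtain g where g: "e = Cell 0 g" and i by auto
      then have "\<bar>aval e s\<bar> \<le> 2 ^ w" using assms(3) by (auto simp: input_bounded_def)
      also have "\<dots> \<le> 2 ^ (weight e * w)" by (intro power_increasing) (auto simp: g)
      finally show ?thesis .
  qed
    have "\<bar>aval f s\<bar> \<le> 2 ^ (v + weight f * w)" using Mult by simp
    with e have "\<bar>aval (Mult e f) s\<bar> \<le> 2 ^ (weight e * w) * 2 ^ (v + weight f * w)"
      by (auto simp: abs_mult intro: mult_mono)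
    also have "\<dots> = 2 ^ (v + (weight e + weight f) * w)" by (simp add: power_add[symmetric] algebra_simps)
    also have "\<dots> \<le> 2 ^ (v + weight (Mult e f) * w)"
      by (intro power_increasing) (auto simp: add_mult_distrib)
    finally show ?case .
  next
    case (Div e f)
    have "\<bar>aval (Div e f) s\<bar> \<le> \<bar>aval e s\<bar>" by (simp add: div_abs_le)
    also have "\<dots> \<le> 2 ^ (v + weight e * w)" using Div by simp
    also have "\<dots> \<le> 2 ^ (v + weight (Div e f) * w)"
      by (intro power_increasing) (auto simp: add_mult_distrib)
    finally show ?case .
  qed
qed

lemma acost_bound:
  assumes "tame i e" and "bounded v s" and "i \<Longrightarrow> input_bounded w s" and "0 < w"
  shows "acost e s \<le> weight e * (v + weight e * w + 2)"
  using assms(1)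
proof (induction e)
  have bs: "bit_size (aval e s) \<le> v + weight e * w + 2" if "tame i e" for e
    using aval_bound[OF that assms(2-4)] by (rule bit_size_le)
  have bin: "a + b + c \<le> Suc (x + y) * (v + Suc (x + y) * w + 2)"
    if "a \<le> x * (v + x * w + 2)" "b \<le> y * (v + y * w + 2)" "c \<le> v + Suc (x + y) * w + 2" for a b c x y
  proof -
    have "a \<le> x * (v + Suc (x + y) * w + 2)"
      by (rule order_trans[OF that(1)]) (intro mult_le_mono2 add_le_mono mult_le_mono1 order_refl; simp)
    moreover have "b \<le> y * (v + Suc (x + y) * w + 2)"
      by (rule order_trans[OF that(2)]) (intro mult_le_mono2 add_le_mono mult_le_mono1 order_refl; simp)
    ultimately have "a + b + c \<le> x * (v + Suc (x + y) * w + 2) + y * (v + Suc (x + y) * w + 2) +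
        (v + Suc (x + y) * w + 2)" using that(3) by linarith
    also have "\<dots> = Suc (x + y) * (v + Suc (x + y) * w + 2)" by (simp add: algebra_simps)
    finally show ?thesis .
  qed
  {
    case (Const z)
    show ?case by simp
  next
    case (Reg r)
    show ?case using bs[of "Reg r"] by simp
  next
    case (Cell a e)
    then show ?case using bs[of "Cell a e"] bin[of _ "weight e" 0 0] by simp
  next
    case (Add e f)
    then show ?case using bs[of "Add e f"] bin[of "acost e s" "weight e" "acost f s" "weight f"] by simp
  next
    case (Sub e f)
    then show ?case using bs[of "Sub e f"] bin[of "acost e s" "weight e" "acost f s" "weight f"] by simp
  next
    case (Mult e f)
    then show ?case using bs[of "Mult e f"] bin[of "acost e s" "weight e" "acost f s" "weight f"] by simp
  next
    case (Div e f)
    then show ?case using bs[of "Div e f"] bin[of "acost e s" "weight e" "acost f s" "weight f"] by simp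
  }
qed

lemma cost_mono: "x \<le> y \<Longrightarrow> x * (v + x * w + 2) \<le> y * (v + y * w + 2)" for x y v w :: nat
  by (intro mult_le_mono add_le_mono order_refl) auto

lemma cost_add: "x * (v + x * w + 2) + y * (v + y * w + 2) \<le> (x + y) * (v + (x + y) * w + 2)"
  for x y v w :: nat
  by (simp add: algebra_simps)

lemma bcost_bound:
  assumes "btame i b" and "bounded v s" and "i \<Longrightarrow> input_bounded w s" and "0 < w"
  shows "bcost b s \<le> bweight b * (v + bweight b * w + 2)"
  using assms(1)
proof (induction b)
  have suc: "a + 1 \<le> Suc x * (v + Suc x * w + 2)" if "a \<le> x * (v + x * w + 2)" for a x
    using that by (simp add: algebra_simps)
  {
    case (Less e f)
    then show ?case
      using acost_bound[of i e, OF _ assms(2-4)] acost_bound[of i f, OF _ assms(2-4)]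
        cost_add[of "weight e" v w "weight f"] suc[of "acost e s + acost f s" "weight e + weight f"]
      by simp
  next
    case (Neg b)
    then show ?case using suc[of "bcost b s" "bweight b"] by simp
  next
    case (Conj b d)
    then show ?case
      using cost_add[of "bweight b" v w "bweight d"] suc[of "bcost b s + bcost d s" "bweight b + bweight d"]
      by simp
  }
qed

lemma bounded_mono: "bounded u s \<Longrightarrow> u \<le> v \<Longrightarrow> bounded v s"
  unfolding bounded_def by (meson order_trans power_increasing one_le_numeral)

text \<open>\<open>U\<close> bounds the bit length at the end of the whole run and stays fixed while
  \<open>v\<close> grows in the induction. Thus every step can be charged the same amount
  \<open>C * (U + 2) + 1\<close>.\<close>

lemma run_exec_aux:
  assumes "run P s n s'" and "ctame i P" and "cweight P \<le> C" and "bounded v s"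
    and "i \<Longrightarrow> input_bounded w s" and "0 < w" and "v + n * C * w \<le> U"
  shows "bounded (v + n * C * w) s' \<and> (i \<longrightarrow> input_bounded w s') \<and>
    (\<exists>t \<le> n * (C * (U + 2) + 1). exec P s t s')"
proof -
  have mono: "k \<le> C * (U + 2)" if "k \<le> x * (v + x * w + 2)" "x \<le> C" "v + C * w \<le> U" for k x v
  proof -
    note that(1)
    also have "x * (v + x * w + 2) \<le> C * (v + C * w + 2)" by (rule cost_mono[OF that(2)])
    also have "\<dots> \<le> C * (U + 2)" using that(3) by (intro mult_le_mono2) simp
    finally show ?thesis .
  qed
  have test: "bcost b s \<le> C * (U + 2)"
    if "btame i b" "bweight b \<le> C" "bounded v s" "i \<Longrightarrow> input_bounded w s" "v + C * w \<le> U" for b s v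
    using bcost_bound[OF that(1,3,4) \<open>0 < w\<close>] that(2,5) by (rule mono)
  have val: "\<bar>aval e s\<bar> \<le> 2 ^ (v + C * w)"
    if "tame i e" "weight e \<le> C" "bounded v s" "i \<Longrightarrow> input_bounded w s" for e s v
  proof -
    have "(2 :: int) ^ (v + weight e * w) \<le> 2 ^ (v + C * w)" using that(2) by (intro power_increasing) auto
    with aval_bound[OF that(1,3,4) \<open>0 < w\<close>] show ?thesis by linarith
  qed
  show ?thesis
    using assms(1-5,7)
  proof (induction arbitrary: v rule: run.induct)
    case (run_Skip s)
    then show ?case using exec.Skip[of s] bounded_mono[of v s] by (intro conjI exI[of _ 1]) auto
  next
    case (run_Assign r e s)
    have "bounded (v + C * w) s" using run_Assign(3) by (rule bounded_mono) simp
    moreover have "\<bar>aval e s\<bar> \<le> 2 ^ (v + C * w)" using run_Assign by (intro val) auto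
    moreover have "acost e s \<le> C * (U + 2)"
      using run_Assign \<open>0 < w\<close> by (intro mono[OF acost_bound[of i]]) auto
    ultimately show ?case using run_Assign(4) exec.Assign[of r e s]
      by (intro conjI exI[of _ "acost e s + 1"]) (auto simp: input_bounded_def bounded_def)
  next
    case (run_Store a j e s)
    have t: "tame i e" "tame i j" "i \<longrightarrow> a \<noteq> 0" and C: "weight j + weight e \<le> C" using run_Store by auto
    have "bounded (v + C * w) s" using run_Store(3) by (rule bounded_mono) simp
    moreover have "\<bar>aval e s\<bar> \<le> 2 ^ (v + C * w)" using run_Store t C by (intro val) auto
    moreover have "acost j s + acost e s \<le> C * (U + 2)"
      using acost_bound[OF t(1) run_Store(3,4) \<open>0 < w\<close>] acost_bound[OF t(2) run_Store(3,4) \<open>0 < w\<close>]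
        cost_add[of "weight j" v w "weight e"] run_Store(5) by (intro mono[OF _ C]) auto
    ultimately show ?case using run_Store(4) t(3) exec.Store[of a j e s]
      by (intro conjI exI[of _ "acost j s + acost e s + 1"]) (auto simp: input_bounded_def bounded_def)
  next
    case (run_Seq P s m s' Q n s'')
    have P: "bounded (v + m * C * w) s'" "i \<Longrightarrow> input_bounded w s'"
      "\<exists>t \<le> m * (C * (U + 2) + 1). exec P s t s'"
      using run_Seq.IH(1)[of v] run_Seq.prems by (auto simp: add_mult_distrib)
    have Q: "bounded (v + m * C * w + n * C * w) s''" "i \<Longrightarrow> input_bounded w s''"
      "\<exists>t \<le> n * (C * (U + 2) + 1). exec Q s' t s''"
      using run_Seq.IH(2)[of "v + m * C * w"] run_Seq.prems P(1,2) by (auto simp: add_mult_distrib)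
    from P(3) Q(3) have "\<exists>t \<le> (m + n) * (C * (U + 2) + 1). exec (Seq P Q) s t s''"
      unfolding add_mult_distrib[of m n "C * (U + 2) + 1"] by (meson add_le_mono exec.Seq)
    with Q(1,2) show ?case by (auto simp: add_mult_distrib add.assoc)
  next
    case (run_IfTrue b s P n s' Q)
    have "bcost b s \<le> C * (U + 2)" using run_IfTrue.prems by (intro test) (auto simp: add_mult_distrib)
    moreover from run_IfTrue.IH[of v] run_IfTrue.prems obtain t where
      "bounded (v + n * C * w) s'" "i \<longrightarrow> input_bounded w s'" "t \<le> n * (C * (U + 2) + 1)" "exec P s t s'"
      by (auto simp: add_mult_distrib)
    ultimately show ?case using exec.IfTrue[OF run_IfTrue.hyps(1), of P t s' Q]
      by (intro conjI exI[of _ "bcost b s + t"]) (auto elim: bounded_mono)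
  next
    case (run_IfFalse b s Q n s' P)
    have "bcost b s \<le> C * (U + 2)" using run_IfFalse.prems by (intro test) (auto simp: add_mult_distrib)
    moreover from run_IfFalse.IH[of v] run_IfFalse.prems obtain t where
      "bounded (v + n * C * w) s'" "i \<longrightarrow> input_bounded w s'" "t \<le> n * (C * (U + 2) + 1)" "exec Q s t s'"
      by (auto simp: add_mult_distrib)
    ultimately show ?case using exec.IfFalse[OF run_IfFalse.hyps(1), of Q t s' P]
      by (intro conjI exI[of _ "bcost b s + t"]) (auto elim: bounded_mono)
  next
    case (run_WhileFalse b s P)
    have "bcost b s \<le> C * (U + 2)" using run_WhileFalse.prems by (intro test) auto
    then show ?case using exec.WhileFalse[OF run_WhileFalse.hyps, of P] run_WhileFalse.prems
      by (intro conjI exI[of _ "bcost b s"]) (auto elim: bounded_mono)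
  next
    case (run_WhileTrue b s P m s' n s'')
    have b: "bcost b s \<le> C * (U + 2)" using run_WhileTrue.prems by (intro test) (auto simp: add_mult_distrib)
    from run_WhileTrue.IH(1)[of v] run_WhileTrue.prems obtain t where
      P: "bounded (v + m * C * w) s'" "i \<Longrightarrow> input_bounded w s'" "t \<le> m * (C * (U + 2) + 1)" "exec P s t s'"
      by (auto simp: add_mult_distrib)
    from run_WhileTrue.IH(2)[of "v + m * C * w"] run_WhileTrue.prems P(1,2) obtain u where
      Q: "bounded (v + m * C * w + n * C * w) s''" "i \<longrightarrow> input_bounded w s''"
        "u \<le> n * (C * (U + 2) + 1)" "exec (While b P) s' u s''"
      by (auto simp: add_mult_distrib)
    have "bcost b s + t + u \<le> (C * (U + 2) + 1) + m * (C * (U + 2) + 1) + n * (C * (U + 2) + 1)"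
      using b P(3) Q(3) by (intro add_le_mono) auto
    then have "bcost b s + t + u \<le> Suc (m + n) * (C * (U + 2) + 1)" by (simp add: add_mult_distrib)
    moreover have "bounded (v + Suc (m + n) * C * w) s''"
      by (rule bounded_mono[OF Q(1)]) (simp add: add_mult_distrib)
    ultimately show ?case using exec.WhileTrue[OF run_WhileTrue.hyps(1) P(4) Q(4)] Q(2) by blast
  qed
qed

lemmas run_exec = run_exec_aux[OF _ _ _ _ _ _ order_refl]

section \<open>Weakest preconditions with step bounds\<close>

fun mod_regs :: "com \<Rightarrow> nat set" where
  "mod_regs Skip = {}"
| "mod_regs (Assign r e) = {r}"
| "mod_regs (Store a i e) = {}"
| "mod_regs (Seq P Q) = mod_regs P \<union> mod_regs Q"
| "mod_regs (If b P Q) = mod_regs P \<union> mod_regs Q"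
| "mod_regs (While b P) = mod_regs P"

fun mod_arrs :: "com \<Rightarrow> nat set" where
  "mod_arrs Skip = {}"
| "mod_arrs (Assign r e) = {}"
| "mod_arrs (Store a i e) = {a}"
| "mod_arrs (Seq P Q) = mod_arrs P \<union> mod_arrs Q"
| "mod_arrs (If b P Q) = mod_arrs P \<union> mod_arrs Q"
| "mod_arrs (While b P) = mod_arrs P"

lemma run_frame:
  "run P s n s' \<Longrightarrow> (\<forall>r. r \<notin> mod_regs P \<longrightarrow> regs s' r = regs s r) \<and> (\<forall>a. a \<notin> mod_arrs P \<longrightarrow> arrs s' a = arrs s a)"
  by (induction rule: run.induct) auto

text \<open>Termination is part of the claim. Since \<open>n\<close> is only an upper bound on the
  steps, time bounds may be rounded up at every composition.\<close>

definition wp :: "com \<Rightarrow> nat \<Rightarrow> (state \<Rightarrow> bool) \<Rightarrow> state \<Rightarrow> bool" where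
  "wp P n Q s \<longleftrightarrow> (\<exists>m\<le>n. \<exists>s'. run P s m s' \<and> Q s')"

lemma wp_mono: "wp P n Q s \<Longrightarrow> n \<le> n' \<Longrightarrow> (\<And>s'. Q s' \<Longrightarrow> Q' s') \<Longrightarrow> wp P n' Q' s"
  unfolding wp_def by (meson order_trans)

text \<open>The running time limits the numbers that can be reached. Later this replaces a direct
  estimate of the registers that hold the bound on the step length and the value of the starting
  solution.\<close>

lemma wp_bounded:
  assumes "wp P n Q s" and "ctame i P" and "cweight P \<le> C" and "bounded v s"
    and "i \<Longrightarrow> input_bounded w s" and "0 < w"
  shows "wp P n (\<lambda>s'. Q s' \<and> bounded (v + n * C * w) s' \<and> (i \<longrightarrow> input_bounded w s')) s"
proof -
  obtain m s' where *: "m \<le> n" "run P s m s'" "Q s'" using assms(1) unfolding wp_def by blast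
  have "bounded (v + m * C * w) s'" "i \<longrightarrow> input_bounded w s'"
    using run_exec[OF *(2) assms(2-6)] by auto
  moreover have "m * C * w \<le> n * C * w" using *(1) by simp
  then have "(2 :: int) ^ (v + m * C * w) \<le> 2 ^ (v + n * C * w)" by (intro power_increasing) auto
  ultimately show ?thesis using * unfolding wp_def bounded_def by (meson order_trans)
qed

lemma wp_frame:
  assumes "wp P n Q s" and "n \<le> n'"
    and "\<And>s'. Q s' \<Longrightarrow> (\<And>r. r \<notin> mod_regs P \<Longrightarrow> regs s' r = regs s r) \<Longrightarrow>
      (\<And>a. a \<notin> mod_arrs P \<Longrightarrow> arrs s' a = arrs s a) \<Longrightarrow> Q' s'"
  shows "wp P n' Q' s"
proof -
  obtain m s' where *: "m \<le> n" "run P s m s'" "Q s'" using assms(1) unfolding wp_def by blast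
  then have "Q' s'" using run_frame[OF *(2)] assms(3) by blast
  with * assms(2) show ?thesis unfolding wp_def by (meson order_trans)
qed

lemma wp_Skip: "Q s \<Longrightarrow> 1 \<le> n \<Longrightarrow> wp Skip n Q s"
  unfolding wp_def using run_Skip by blast

abbreviation set_reg :: "nat \<Rightarrow> int \<Rightarrow> state \<Rightarrow> state" where
  "set_reg r z s \<equiv> s\<lparr>regs := (regs s)(r := z)\<rparr>"

lemma wp_Assign: "Q (set_reg r (aval e s) s) \<Longrightarrow> 1 \<le> n \<Longrightarrow> wp (Assign r e) n Q s"
  unfolding wp_def using run_Assign by blast

lemma wp_Store:
  "Q (s\<lparr>arrs := (arrs s)(a := (arrs s a)(aval i s := aval e s))\<rparr>) \<Longrightarrow> 1 \<le> n \<Longrightarrow> wp (Store a i e) n Q s"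
  unfolding wp_def using run_Store by blast

lemma wp_Seq: "wp P m (wp R n Q) s \<Longrightarrow> m + n \<le> k \<Longrightarrow> wp (Seq P R) k Q s"
  unfolding wp_def by (meson add_le_mono order_trans run_Seq)

lemma wp_If:
  assumes "bval b s \<Longrightarrow> wp P n Q s" and "\<not> bval b s \<Longrightarrow> wp R n Q s" and "Suc n \<le> k"
  shows "wp (If b P R) k Q s"
proof (cases "bval b s")
  case True
  with assms show ?thesis unfolding wp_def by (meson Suc_le_mono order_trans run_IfTrue)
next
  case False
  with assms show ?thesis unfolding wp_def by (meson Suc_le_mono order_trans run_IfFalse)
qed

text \<open>The invariant carries the number of completed rounds. Together with the guard it has to
  imply that this number is below \<open>k\<close>, which yields termination and the time bound at
  once.\<close>

lemma wp_While:
  assumes "I 0 s"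
    and "\<And>i s. I i s \<Longrightarrow> bval b s \<Longrightarrow> i < k \<and> wp P n (I (Suc i)) s"
    and "\<And>i s. I i s \<Longrightarrow> \<not> bval b s \<Longrightarrow> Q s"
    and "Suc (k * Suc n) \<le> m"
  shows "wp (While b P) m Q s"
proof -
  have "wp (While b P) (Suc ((k - i) * Suc n)) Q s" if "I i s" "i \<le> k" for i s
    using that
  proof (induction "k - i" arbitrary: i s)
    case 0
    then have "\<not> bval b s" using assms(2) by fastforce
    then show ?case using assms(3)[OF 0(2)] run_WhileFalse unfolding wp_def by fastforce
  next
    case (Suc d)
    show ?case
    proof (cases "bval b s")
      case False
      then show ?thesis using assms(3)[OF Suc(3)] run_WhileFalse unfolding wp_def by fastforce
    next
      case True
      with assms(2)[OF Suc(3)] obtain l s' where l: "i < k" "l \<le> n" "run P s l s'" "I (Suc i) s'"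
        unfolding wp_def by blast
      have "wp (While b P) (Suc ((k - Suc i) * Suc n)) Q s'"
        using Suc(2) l by (intro Suc(1)) auto
      then obtain l' s'' where l': "l' \<le> Suc ((k - Suc i) * Suc n)" "run (While b P) s' l' s''" "Q s''"
        unfolding wp_def by blast
      have "k - i = Suc (k - Suc i)" using l(1) by simp
      then have "Suc (l + l') \<le> Suc ((k - i) * Suc n)" using l(2) l'(1) by simp
      with run_WhileTrue[OF True l(3) l'(2)] l'(3) show ?thesis unfolding wp_def by blast
    qed
  qed
  from this[OF assms(1)] have "wp (While b P) (Suc (k * Suc n)) Q s" by simp
  then show ?thesis using assms(4) by (rule wp_mono)
qed

definition For :: "nat \<Rightarrow> aexp \<Rightarrow> com \<Rightarrow> com" where
  "For r e P = Seq (Assign r (Const 0)) (While (Less (Reg r) e) (Seq P (Assign r (Add (Reg r) (Const 1)))))"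

text \<open>The bound \<open>e\<close> is evaluated in every round, so the invariant must fix its
  value; the counter is tracked by the rule itself, as the body does not modify it.\<close>

lemma wp_For:
  assumes "r \<notin> mod_regs P"
    and "I 0 (set_reg r 0 s)"
    and "\<And>i s. I i s \<Longrightarrow> aval e s = int k"
    and "\<And>i s. i < k \<Longrightarrow> regs s r = int i \<Longrightarrow> I i s \<Longrightarrow>
      wp P n (\<lambda>s'. I (Suc i) (set_reg r (int (Suc i)) s')) s"
    and "\<And>s. regs s r = int k \<Longrightarrow> I k s \<Longrightarrow> Q s"
    and "k * (n + 2) + 2 \<le> m"
  shows "wp (For r e P) m Q s"
  unfolding For_def
proof (rule wp_Seq)
  show "wp (Assign r (Const 0)) 1 (wp (While (Less (Reg r) e) (Seq P (Assign r (Add (Reg r) (Const 1)))))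
      (Suc (k * Suc (n + 1))) Q) s"
  proof (rule wp_Assign)
    show "wp (While (Less (Reg r) e) (Seq P (Assign r (Add (Reg r) (Const 1)))))
      (Suc (k * Suc (n + 1))) Q (set_reg r (aval (Const 0) s) s)"
    proof (rule wp_While[where I = "\<lambda>i s. regs s r = int i \<and> i \<le> k \<and> I i s" and k = k and n = "n + 1"])
      show "regs (set_reg r (aval (Const 0) s) s) r = int 0 \<and> 0 \<le> k \<and>
          I 0 (set_reg r (aval (Const 0) s) s)"
        using assms(2) by simp
      fix i s
      assume I: "regs s r = int i \<and> i \<le> k \<and> I i s"
      {
        assume "bval (Less (Reg r) e) s"
        then have i: "i < k" using I assms(3)[of i s] by simp
        have "wp P n (\<lambda>s'. I (Suc i) (set_reg r (int (Suc i)) s') \<and> regs s' r = int i) s"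
          using assms(1) I by (intro wp_frame[OF assms(4)[OF i]]) auto
        then have "wp (Seq P (Assign r (Add (Reg r) (Const 1)))) (n + 1)
            (\<lambda>s. regs s r = int (Suc i) \<and> Suc i \<le> k \<and> I (Suc i) s) s"
          using i by (intro wp_Seq[where m = n and n = 1])
            (auto elim!: wp_mono intro!: wp_Assign simp: algebra_simps)
        with i show "i < k \<and> wp (Seq P (Assign r (Add (Reg r) (Const 1)))) (n + 1)
            (\<lambda>s. regs s r = int (Suc i) \<and> Suc i \<le> k \<and> I (Suc i) s) s" ..
      next
        assume "\<not> bval (Less (Reg r) e) s"
        then have "i = k" using I assms(3)[of i s] by simp
        with I assms(5) show "Q s" by simp
      }
    qed simp
  qed simp
  show "1 + Suc (k * Suc (n + 1)) \<le> m" using assms(6) by simp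
qed

section \<open>Sequences and sums unrolled over ranges that depend only on the matrix\<close>

fun seqs :: "com list \<Rightarrow> com" where
  "seqs [] = Skip"
| "seqs (P # Ps) = Seq P (seqs Ps)"

lemma wp_seqs:
  assumes "I 0 s" and "\<And>i s. i < length Ps \<Longrightarrow> I i s \<Longrightarrow> wp (Ps ! i) n (I (Suc i)) s"
    and "\<And>s. I (length Ps) s \<Longrightarrow> Q s" and "length Ps * n + 1 \<le> m"
  shows "wp (seqs Ps) m Q s"
proof -
  have "wp (seqs Ps) (length Ps * n + 1) Q s"
    using assms(1-3)
  proof (induction Ps arbitrary: I s)
    case Nil
    then show ?case by (auto intro: wp_Skip)
  next
    case (Cons P Ps)
    have "wp P n (I 1) s" using Cons.prems(1) Cons.prems(2)[of 0] by simp
    moreover have "wp (seqs Ps) (length Ps * n + 1) Q s'" if "I 1 s'" for s'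
      using Cons.prems(2)[of "Suc _"] Cons.prems(3) that by (intro Cons.IH[of "\<lambda>i. I (Suc i)"]) auto
    ultimately show ?case unfolding seqs.simps by (intro wp_Seq[where m = n and n = "length Ps * n + 1"]) (auto elim: wp_mono)
  qed
  then show ?thesis using assms(4) by (rule wp_mono)
qed

lemma mod_seqs [simp]:
  "mod_regs (seqs Ps) = (\<Union>P\<in>set Ps. mod_regs P)" "mod_arrs (seqs Ps) = (\<Union>P\<in>set Ps. mod_arrs P)"
  by (induction Ps) auto

lemma ctame_seqs [simp]: "ctame i (seqs Ps) \<longleftrightarrow> (\<forall>P\<in>set Ps. ctame i P)"
  by (induction Ps) auto

lemma mod_For [simp]: "mod_regs (For r e P) = insert r (mod_regs P)" "mod_arrs (For r e P) = mod_arrs P"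
  by (auto simp: For_def)

lemma ctame_For [simp]: "ctame i (For r e P) \<longleftrightarrow> tame i e \<and> ctame i P"
  by (auto simp: For_def)

fun sum_exp :: "aexp list \<Rightarrow> aexp" where
  "sum_exp [] = Const 0"
| "sum_exp (e # es) = Add e (sum_exp es)"

lemma aval_sum_exp: "aval (sum_exp (map f [0..<q])) s = (\<Sum>j<q. aval (f j) s)"
proof -
  have "aval (sum_exp es) s = sum_list (map (\<lambda>e. aval e s) es)" for es
    by (induction es) auto
  then show ?thesis by (simp add: comp_def sum_list_distinct_conv_sum_set atLeast0LessThan)
qed

lemma tame_sum_exp [simp]: "tame i (sum_exp es) \<longleftrightarrow> (\<forall>e\<in>set es. tame i e)"
  by (induction es) auto

section \<open>The augmentation program\<close>

lemma sol_cong: "(\<And>i. i < n * q \<Longrightarrow> x i = y i) \<Longrightarrow> sol a p q n bb b0 x = sol a p q n bb b0 y"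
proof -
  assume eq: "\<And>i. i < n * q \<Longrightarrow> x i = y i"
  have *: "x (k * q + j) = y (k * q + j)" if "k < n" "j < q" for k j
  proof (rule eq)
    have "k * q + j < Suc k * q" using that by simp
    also have "\<dots> \<le> n * q" using that by (intro mult_le_mono1) simp
    finally show "k * q + j < n * q" .
  qed
  then have "(\<Sum>j<q. a i j * x (k * q + j)) = (\<Sum>j<q. a i j * y (k * q + j))" if "k < n" for i k
    using that by (intro sum.cong) auto
  moreover have "(\<Sum>k<n. x (k * q + j)) = (\<Sum>k<n. y (k * q + j))" if "j < q" for j
    using * that by (intro sum.cong) auto
  ultimately show ?thesis unfolding sol_def by simp
qed

lemma obj_cong: "(\<And>i. i < N \<Longrightarrow> x i = y i) \<Longrightarrow> obj M c N x = obj M c N y"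
proof -
  assume *: "\<And>i. i < N \<Longrightarrow> x i = y i"
  have "(\<Sum>i<N. c i * x i) = (\<Sum>i<N. c i * y i)" "(\<Sum>i<N. max 0 (- x i)) = (\<Sum>i<N. max 0 (- y i))"
    using * by (auto intro: sum.cong)
  then show ?thesis unfolding obj_def pobj_def negpart_def by simp
qed

section \<open>Addresses of the input data and of the bricks\<close>

definition nE :: aexp where
  "nE = Cell 0 (Const 0)"

definition varsE :: "nat \<Rightarrow> aexp" where
  "varsE q = Mult (Const (int q)) nE"

definition cE :: "nat \<Rightarrow> nat \<Rightarrow> aexp \<Rightarrow> aexp" where
  "cE p q e = Cell 0 (Add (Const (1 + int q)) (Add (Mult (Const (int p)) nE) e))"

definition b0E :: "nat \<Rightarrow> aexp" where
  "b0E j = Cell 0 (Const (1 + int j))"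

definition bE :: "nat \<Rightarrow> nat \<Rightarrow> aexp \<Rightarrow> nat \<Rightarrow> aexp" where
  "bE p q k i = Cell 0 (Add (Const (1 + int q + int i)) (Mult (Const (int p)) k))"

definition ix :: "nat \<Rightarrow> aexp \<Rightarrow> nat \<Rightarrow> aexp" where
  "ix q k j = Add (Mult (Const (int q)) k) (Const (int j))"

definition content :: "nat \<Rightarrow> state \<Rightarrow> nat \<Rightarrow> int" where
  "content u s i = arrs s u (int i)"

definition input :: "nat \<Rightarrow> nat \<Rightarrow> nat \<Rightarrow> (nat \<Rightarrow> int) \<Rightarrow> (nat \<Rightarrow> nat \<Rightarrow> int) \<Rightarrow> (nat \<Rightarrow> int) \<Rightarrow> (int \<Rightarrow> int) \<Rightarrow> bool" where
  "input p q n b0 bb c h \<longleftrightarrow> h 0 = int n \<and> (\<forall>j<q. h (1 + int j) = b0 j) \<and>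
     (\<forall>k<n. \<forall>i<p. h (1 + int q + int p * int k + int i) = bb k i) \<and>
     (\<forall>i<n * q. h (1 + int q + int p * int n + int i) = c i)"

text \<open>
  The program keeps the input in array 0, the current solution in array 4, the candidate under
  evaluation in array 2 and the best candidate in array 3. Registers 2 and 3 hold the negative part
  and the value just computed, 4 and 5 the values of the arrays 4 and 3, 6 the step length \<open>2\<^sup>i\<close>,
  7 the number \<open>m\<close> of the candidate, 8 whether the last round improved, 9 the bound on the step
  length, 10 a failure flag, 12 the norm of \<open>b\<^sup>0\<close>, 11 and 13 loop counters.
\<close>

definition copy :: "nat \<Rightarrow> nat \<Rightarrow> nat \<Rightarrow> com" where
  "copy q u v = For 13 (varsE q) (Store v (Reg 13) (Cell u (Reg 13)))"

text \<open>Multiplying the penalty weight by the negative part would be a product of two computed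
  numbers. Distributing the weight over the \<open>\<bar>c i\<bar>\<close> leaves products in which
  all factors but one are constants or input cells.\<close>

definition eval_obj :: "nat \<Rightarrow> nat \<Rightarrow> int \<Rightarrow> nat \<Rightarrow> com" where
  "eval_obj p q M u = Seq (Assign 2 (Const 0))
    (Seq (For 13 (varsE q) (If (Less (Cell u (Reg 13)) (Const 0)) (Assign 2 (Sub (Reg 2) (Cell u (Reg 13)))) Skip))
    (Seq (Assign 3 (Reg 2))
      (For 13 (varsE q) (Seq (Assign 3 (Add (Reg 3) (Mult (cE p q (Reg 13)) (Cell u (Reg 13)))))
        (If (Less (cE p q (Reg 13)) (Const 0))
          (Assign 3 (Sub (Reg 3) (Mult (Const M) (Mult (cE p q (Reg 13)) (Reg 2)))))
          (Assign 3 (Add (Reg 3) (Mult (Const M) (Mult (cE p q (Reg 13)) (Reg 2))))))))))"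

fun powE :: "nat \<Rightarrow> aexp" where
  "powE 0 = Const 1"
| "powE (Suc l) = Mult nE (powE l)"

text \<open>The machine has no remainder operation, so a digit is a quotient minus \<open>n\<close>
  times the next quotient. \<open>n\<close> stands on the left, where tame programs admit an input
  cell.\<close>

definition digitE :: "nat \<Rightarrow> aexp" where
  "digitE l = Sub (Div (Reg 7) (powE l)) (Mult nE (Div (Reg 7) (powE (Suc l))))"

definition add_template :: "nat \<Rightarrow> (nat \<Rightarrow> int) list \<Rightarrow> com" where
  "add_template q T = seqs (map (\<lambda>l. seqs (map (\<lambda>j.
     Store 2 (ix q (digitE l) j) (Add (Cell 2 (ix q (digitE l) j)) (Mult (Const ((T ! l) j)) (Reg 6)))) [0..<q])) [0..<length T])"

definition try_template :: "nat \<Rightarrow> nat \<Rightarrow> int \<Rightarrow> (nat \<Rightarrow> int) list \<Rightarrow> com" where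
  "try_template p q M T = Seq (copy q 4 2) (Seq (add_template q T) (Seq (eval_obj p q M 2)
     (If (Less (Reg 3) (Reg 5)) (Seq (Assign 5 (Reg 3)) (copy q 2 3)) Skip)))"

section \<open>Correctness of the elementary routines\<close>

locale nfold_data =
  fixes p q n :: nat and b0 :: "nat \<Rightarrow> int" and bb :: "nat \<Rightarrow> nat \<Rightarrow> int" and c :: "nat \<Rightarrow> int"
begin

abbreviation inp :: "state \<Rightarrow> bool" where
  "inp s \<equiv> input p q n b0 bb c (arrs s 0)"

abbreviation b0_norm :: int where
  "b0_norm \<equiv> \<Sum>j<q. \<bar>b0 j\<bar>"

abbreviation c_norm :: int where
  "c_norm \<equiv> \<Sum>i<n * q. \<bar>c i\<bar>"

lemma aval_nE [simp]: "inp s \<Longrightarrow> aval nE s = int n"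
  by (simp add: nE_def input_def)

lemma aval_varsE [simp]: "inp s \<Longrightarrow> aval (varsE q) s = int (n * q)"
  by (simp add: varsE_def)

lemma aval_cE [simp]: "inp s \<Longrightarrow> aval e s = int i \<Longrightarrow> i < n * q \<Longrightarrow> aval (cE p q e) s = c i"
  by (simp add: cE_def input_def add.assoc)

lemma aval_b0E [simp]: "inp s \<Longrightarrow> j < q \<Longrightarrow> aval (b0E j) s = b0 j"
  by (simp add: b0E_def input_def)

lemma aval_bE [simp]: "inp s \<Longrightarrow> aval e s = int k \<Longrightarrow> k < n \<Longrightarrow> i < p \<Longrightarrow> aval (bE p q e i) s = bb k i"
  by (simp add: bE_def input_def algebra_simps)

lemma aval_ix [simp]: "aval e s = int k \<Longrightarrow> aval (ix q e j) s = int (k * q + j)"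
  by (simp add: ix_def)

lemma aval_powE [simp]: "inp s \<Longrightarrow> aval (powE l) s = int (n ^ l)"
  by (induction l) simp_all

lemma aval_digitE: 
  assumes "inp s" and "regs s 7 = int m"
  shows "aval (digitE l) s = int (m div n ^ l mod n)"
proof -
  have "m div n ^ Suc l = m div n ^ l div n"
    unfolding power_Suc2 by (rule div_mult2_eq)
  moreover have "int (a mod n) = int a - int n * int (a div n)" for a
    by (simp add: zmod_int zdiv_int minus_mult_div_eq_mod)
  moreover have "aval (digitE l) s = int (m div n ^ l) - int n * int (m div n ^ Suc l)"
    using assms by (simp add: digitE_def zdiv_int del: power_Suc of_nat_power powE.simps)
  ultimately show ?thesis by simp
qed

lemma wp_copy:
  assumes "inp s" and "v \<noteq> 0" and "u \<noteq> v"
  shows "wp (copy q u v) (n * q * 3 + 2) (\<lambda>s'. \<forall>i<n * q. content v s' i = content u s i) s"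
  unfolding copy_def
proof (rule wp_For[where n = 1 and k = "n * q" and
      I = "\<lambda>i s'. inp s' \<and> arrs s' u = arrs s u \<and> (\<forall>i'<i. content v s' i' = content u s i')"])
  fix i s'
  assume "i < n * q" "regs s' 13 = int i"
    "inp s' \<and> arrs s' u = arrs s u \<and> (\<forall>i'<i. content v s' i' = content u s i')"
  then show "wp (Store v (Reg 13) (Cell u (Reg 13))) 1 (\<lambda>s'. inp (set_reg 13 (int (Suc i)) s') \<and>
      arrs (set_reg 13 (int (Suc i)) s') u = arrs s u \<and>
      (\<forall>i'<Suc i. content v (set_reg 13 (int (Suc i)) s') i' = content u s i')) s'"
    using assms(2,3) by (intro wp_Store) (auto simp: content_def less_Suc_eq)
qed (use assms in \<open>auto simp: content_def\<close>)

lemma wp_eval_obj: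
  assumes "inp s"
  shows "wp (eval_obj p q M u) (n * q * 10 + 20) (\<lambda>s'. regs s' 3 = obj M c (n * q) (content u s)) s"
proof -
  define x where "x = content u s"
  have 1: "wp (For 13 (varsE q) (If (Less (Cell u (Reg 13)) (Const 0)) (Assign 2 (Sub (Reg 2) (Cell u (Reg 13)))) Skip))
    (n * q * 4 + 2) (\<lambda>s'. arrs s' = arrs s \<and> regs s' 2 = negpart (n * q) x) s0"
    if s0: "arrs s0 = arrs s" "regs s0 2 = 0" for s0 :: state
  proof (rule wp_For[where n = 2 and k = "n * q" and I = "\<lambda>i s'. arrs s' = arrs s \<and> regs s' 2 = negpart i x"])
    fix i and s' :: state assume i: "i < n * q" "regs s' 13 = int i" "arrs s' = arrs s \<and> regs s' 2 = negpart i x"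
    have "aval (Cell u (Reg 13)) s' = x i" using i by (simp add: x_def content_def)
    with i show "wp (If (Less (Cell u (Reg 13)) (Const 0)) (Assign 2 (Sub (Reg 2) (Cell u (Reg 13)))) Skip) 2
       (\<lambda>s'. arrs (set_reg 13 (int (Suc i)) s') = arrs s \<and>
         regs (set_reg 13 (int (Suc i)) s') 2 = negpart (Suc i) x) s'"
      by (intro wp_If[where n = 1] wp_Assign wp_Skip) (auto simp: negpart_def)
  qed (use s0 assms in \<open>auto simp: negpart_def\<close>)
  \<comment> \<open>The content of register 3 before round \<open>i\<close>: the summand 1 of the
    penalty weight contributes the negative part once, and every entry passed adds its cost and its
    share of the penalty.\<close>
  define f where "f = (\<lambda>i. negpart (n * q) x + (\<Sum>l<i. c l * x l + M * (\<bar>c l\<bar> * negpart (n * q) x)))"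
  define body where "body = Seq (Assign 3 (Add (Reg 3) (Mult (cE p q (Reg 13)) (Cell u (Reg 13)))))
        (If (Less (cE p q (Reg 13)) (Const 0))
          (Assign 3 (Sub (Reg 3) (Mult (Const M) (Mult (cE p q (Reg 13)) (Reg 2)))))
          (Assign 3 (Add (Reg 3) (Mult (Const M) (Mult (cE p q (Reg 13)) (Reg 2))))))"
  have 2: "wp (For 13 (varsE q) body) (n * q * 5 + 2) (\<lambda>s'. regs s' 3 = f (n * q)) s0"
    if s0: "arrs s0 = arrs s" "regs s0 2 = negpart (n * q) x" "regs s0 3 = negpart (n * q) x" for s0 :: state
  proof (rule wp_For[where n = 3 and k = "n * q" and
        I = "\<lambda>i s'. arrs s' = arrs s \<and> regs s' 2 = negpart (n * q) x \<and> regs s' 3 = f i"])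
    fix i and s' :: state assume i: "i < n * q" "regs s' 13 = int i"
      "arrs s' = arrs s \<and> regs s' 2 = negpart (n * q) x \<and> regs s' 3 = f i"
    have x: "arrs s u (int i) = x i" by (simp add: x_def content_def)
    have cv: "aval (cE p q (Reg 13)) t = c i" if "arrs t = arrs s" "regs t 13 = int i" for t
      using that i(1) assms by simp
    show "wp body 3 (\<lambda>s'. arrs (set_reg 13 (int (Suc i)) s') = arrs s \<and>
         regs (set_reg 13 (int (Suc i)) s') 2 = negpart (n * q) x \<and>
         regs (set_reg 13 (int (Suc i)) s') 3 = f (Suc i)) s'"
      unfolding body_def using i x
      by (intro wp_Seq[where m = 1 and n = 2] wp_If[where n = 1] wp_Assign)
        (auto simp: cv f_def)
  qed (use s0 assms in \<open>auto simp: f_def body_def\<close>)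
  have f: "f (n * q) = obj M c (n * q) x"
    by (simp add: f_def obj_def pobj_def sum.distrib algebra_simps sum_distrib_left sum_distrib_right)
  show ?thesis
    unfolding eval_obj_def body_def[symmetric]
  proof (rule wp_Seq, rule wp_Assign, rule wp_Seq, rule wp_mono, rule 1)
    fix s' :: state assume s': "arrs s' = arrs s \<and> regs s' 2 = negpart (n * q) x"
    show "wp (Seq (Assign 3 (Reg 2)) (For 13 (varsE q) body)) (n * q * 5 + 3)
        (\<lambda>s'. regs s' 3 = obj M c (n * q) (content u s)) s'"
      using s' by (intro wp_Seq[where m = 1 and n = "n * q * 5 + 2"] wp_Assign wp_mono[OF 2])
        (auto simp: f x_def)
  qed (auto intro: order_refl)
qed

lemma wp_add_template:
  assumes "inp s" and m: "regs s 7 = int m" and T: "length T = L"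
  shows "wp (add_template q T) (L * (q + 1) + 1)
    (\<lambda>s'. \<forall>i<n * q. content 2 s' i = content 2 s i + regs s 6 * spread q n T m i) s"
proof -
  define d where "d = (\<lambda>l. m div n ^ l mod n)"
  define g where "g = (\<lambda>l i. if i div q = d l then (T ! l) (i mod q) else 0)"
  define stored where "stored = (\<lambda>l j. Store 2 (ix q (digitE l) j)
      (Add (Cell 2 (ix q (digitE l) j)) (Mult (Const ((T ! l) j)) (Reg 6))))"
  \<comment> \<open>\<open>h\<close> is the part of the spread vector that has been added so far, in
    units of the step length.\<close>
  define I where "I = (\<lambda>(h :: nat \<Rightarrow> int) s'. inp s' \<and> regs s' 7 = int m \<and> regs s' 6 = regs s 6 \<and>
    (\<forall>i<n * q. content 2 s' i = content 2 s i + regs s 6 * h i))"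
  have step: "wp (stored l j) 1 (I (\<lambda>i. h i + (if i div q = d l \<and> i mod q < Suc j then (T ! l) (i mod q) else 0))) s'"
    if "j < q" "I (\<lambda>i. h i + (if i div q = d l \<and> i mod q < j then (T ! l) (i mod q) else 0)) s'" for l j h s'
  proof -
    have dl: "aval (digitE l) s' = int (d l)"
      using that(2) aval_digitE[of s' m l] by (simp add: I_def d_def)
    have eq: "i = d l * q + j \<longleftrightarrow> i div q = d l \<and> i mod q = j" for i
      using \<open>j < q\<close> by (auto, metis div_mult_mod_eq)
    have eq': "int i = int (d l * q + j) \<longleftrightarrow> i div q = d l \<and> i mod q = j" for i
      unfolding of_nat_eq_iff by (rule eq)
    define t where "t = s'\<lparr>arrs := (arrs s')(2 := (arrs s' 2)(int (d l * q + j) :=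
      arrs s' 2 (int (d l * q + j)) + (T ! l) j * regs s' 6))\<rparr>"
    have t: "content 2 t i = content 2 s' i + (if i div q = d l \<and> i mod q = j then (T ! l) (i mod q) * regs s' 6 else 0)" for i
      using eq'[of i] by (auto simp: t_def content_def)
    have "I (\<lambda>i. h i + (if i div q = d l \<and> i mod q < Suc j then (T ! l) (i mod q) else 0)) t"
      unfolding I_def
    proof (intro conjI allI impI)
      fix i assume "i < n * q"
      then have s': "content 2 s' i = content 2 s i + regs s 6 * (h i + (if i div q = d l \<and> i mod q < j then (T ! l) (i mod q) else 0))"
        and r: "regs s' 6 = regs s 6"
        using that(2) by (auto simp: I_def)
      show "content 2 t i = content 2 s i + regs s 6 * (h i + (if i div q = d l \<and> i mod q < Suc j then (T ! l) (i mod q) else 0))"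
        unfolding t s' r by (auto simp: less_Suc_eq algebra_simps)
    qed (use that(2) in \<open>simp_all add: I_def t_def\<close>)
    then show ?thesis
      unfolding stored_def by (intro wp_Store) (simp_all add: aval_ix[OF dl] t_def del: of_nat_add of_nat_mult)
  qed
  have inner: "wp (seqs (map (stored l) [0..<q])) (q + 1) (I (\<lambda>i. \<Sum>l'<Suc l. g l' i)) s'"
    if "I (\<lambda>i. \<Sum>l'<l. g l' i) s'" for l s'
  proof (rule wp_seqs[where n = 1 and I = "\<lambda>j. I (\<lambda>i. (\<Sum>l'<l. g l' i) +
      (if i div q = d l \<and> i mod q < j then (T ! l) (i mod q) else 0))"])
    show "I (\<lambda>i. (\<Sum>l'<l. g l' i) + (if i div q = d l \<and> i mod q < 0 then (T ! l) (i mod q) else 0)) s'"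
      using that by simp
  next
    fix t assume "I (\<lambda>i. (\<Sum>l'<l. g l' i) + (if i div q = d l \<and> i mod q < length (map (stored l) [0..<q])
        then (T ! l) (i mod q) else 0)) t"
    moreover have "i mod q < q" if "i < n * q" for i using that by (cases q) auto
    ultimately show "I (\<lambda>i. \<Sum>l'<Suc l. g l' i) t" by (simp add: I_def g_def)
  qed (use step in auto)
  have "wp (add_template q T) (L * (q + 1) + 1) (I (\<lambda>i. \<Sum>l<L. g l i)) s"
    unfolding add_template_def stored_def[symmetric] T
  proof (rule wp_seqs[where n = "q + 1" and I = "\<lambda>l. I (\<lambda>i. \<Sum>l'<l. g l' i)"])
    show "I (\<lambda>i. \<Sum>l'<0. g l' i) s" using assms(1) m by (simp add: I_def)
  qed (use inner in \<open>auto simp: stored_def\<close>)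
  then show ?thesis
    by (rule wp_mono) (auto simp: I_def spread_def g_def d_def T)
qed

end

section \<open>One round of augmentation\<close>

definition search_step :: "nat \<Rightarrow> nat \<Rightarrow> int \<Rightarrow> nat \<Rightarrow> (nat \<Rightarrow> int) list list \<Rightarrow> com" where
  "search_step p q M L Ts = For 7 (powE L) (seqs (map (try_template p q M) Ts))"

definition search :: "nat \<Rightarrow> nat \<Rightarrow> int \<Rightarrow> nat \<Rightarrow> (nat \<Rightarrow> int) list list \<Rightarrow> com" where
  "search p q M L Ts = Seq (Assign 6 (Const 1))
     (While (Neg (Less (Reg 9) (Reg 6))) (Seq (search_step p q M L Ts) (Assign 6 (Add (Reg 6) (Reg 6)))))"

definition improve :: "nat \<Rightarrow> nat \<Rightarrow> int \<Rightarrow> nat \<Rightarrow> (nat \<Rightarrow> int) list list \<Rightarrow> com" where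
  "improve p q M L Ts = Seq (Assign 5 (Reg 4)) (Seq (search p q M L Ts)
     (If (Less (Reg 5) (Reg 4)) (Seq (Assign 4 (Reg 5)) (copy q 3 4)) (Assign 8 (Const 0))))"

lemma mod_copy [simp]: "mod_regs (copy q u v) = {13}" "mod_arrs (copy q u v) = {v}"
  by (auto simp: copy_def)

lemma mod_eval_obj [simp]: "mod_regs (eval_obj p q M u) = {2, 3, 13}" "mod_arrs (eval_obj p q M u) = {}"
  by (auto simp: eval_obj_def)

lemma mod_add_template: "mod_regs (add_template q T) = {}" "mod_arrs (add_template q T) \<subseteq> {2}"
  by (auto simp: add_template_def)

lemma mod_try_template: "mod_regs (try_template p q M T) = {2, 3, 5, 13}" "mod_arrs (try_template p q M T) = {2, 3}"
  using mod_add_template[of q T] by (auto simp: try_template_def)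

lemma mod_search_step: "mod_regs (search_step p q M L Ts) \<subseteq> {2, 3, 5, 7, 13}"
    "mod_arrs (search_step p q M L Ts) \<subseteq> {2, 3}"
  by (auto simp: search_step_def mod_try_template)

lemma mod_search: "mod_regs (search p q M L Ts) \<subseteq> {2, 3, 5, 6, 7, 13}"
    "mod_arrs (search p q M L Ts) \<subseteq> {2, 3}"
  using mod_search_step[of p q M L Ts] by (auto simp: search_def)

locale nfold_search = nfold_data p q n b0 bb c
  for p q n :: nat and b0 :: "nat \<Rightarrow> int" and bb :: "nat \<Rightarrow> nat \<Rightarrow> int" and c :: "nat \<Rightarrow> int" +
  fixes a :: "nat \<Rightarrow> nat \<Rightarrow> int" and L r :: nat and Ts :: "(nat \<Rightarrow> int) list list" and M :: int
  assumes Ts: "set Ts = templates a p q L r" "distinct Ts" and dec: "decomposable a p q L r"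
    and M: "2 \<le> M" "int (L * r) \<le> M" and n_pos: "0 < n"
begin

abbreviation sln :: "(nat \<Rightarrow> int) \<Rightarrow> bool" where
  "sln \<equiv> sol a p q n bb b0"

abbreviation F :: "(nat \<Rightarrow> int) \<Rightarrow> int" where
  "F \<equiv> obj M c (n * q)"

definition cand :: "(nat \<Rightarrow> int) \<Rightarrow> nat \<Rightarrow> (nat \<Rightarrow> int) list \<Rightarrow> nat \<Rightarrow> nat \<Rightarrow> int" where
  "cand x i T m = (\<lambda>idx. x idx + 2 ^ i * spread q n T m idx)"

text \<open>Register 5 starts at \<open>F x\<close>. As long as nothing better has been found, array
  3 may hold anything, so it is described only in the case of a strict improvement.\<close>

definition tried :: "(nat \<Rightarrow> int) \<Rightarrow> (nat \<times> (nat \<Rightarrow> int) list \<times> nat) set \<Rightarrow> state \<Rightarrow> bool" where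
  "tried x S s \<longleftrightarrow> inp s \<and> (\<forall>i<n * q. content 4 s i = x i) \<and> regs s 4 = F x \<and> regs s 5 \<le> F x \<and>
     (\<forall>(i, T, m)\<in>S. regs s 5 \<le> F (cand x i T m)) \<and>
     (regs s 5 < F x \<longrightarrow> sln (content 3 s) \<and> F (content 3 s) = regs s 5)"

lemma sln_cand: "sln x \<Longrightarrow> T \<in> set Ts \<Longrightarrow> sln (cand x i T m)"
  unfolding cand_def Ts(1) using n_pos by (intro sol_add_kernel spread_kernel)

abbreviation indices :: "nat set \<Rightarrow> (nat \<times> (nat \<Rightarrow> int) list \<times> nat) set" where
  "indices I \<equiv> I \<times> set Ts \<times> {..<n ^ L}"

definition try_time :: nat where
  "try_time = n * q * 16 + L * (q + 1) + 30"

lemma wp_try_template: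
  assumes s: "tried x S s" and x: "sln x" and T: "T \<in> set Ts" and "regs s 7 = int m" and "regs s 6 = 2 ^ i"
  shows "wp (try_template p q M T) try_time (tried x (insert (i, T, m) S)) s"
proof -
  define y where "y = cand x i T m"
  have inp: "inp s" using s by (simp add: tried_def)
  have len: "length T = L" using T by (auto simp: Ts(1) templates_def)
  define K where "K = (\<lambda>s'. inp s' \<and> (\<forall>i<n * q. content 4 s' i = x i) \<and> regs s' 4 = F x \<and>
    regs s' 5 = regs s 5 \<and> arrs s' 3 = arrs s 3)"
  have 1: "wp (copy q 4 2) (n * q * 3 + 2) (\<lambda>s'. K s' \<and> (\<forall>i<n * q. content 2 s' i = x i) \<and>
      regs s' 6 = 2 ^ i \<and> regs s' 7 = int m) s"
    using s assms(4,5) by (intro wp_frame[OF wp_copy[OF inp]]) (auto simp: tried_def K_def content_def)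
  have 2: "wp (add_template q T) (L * (q + 1) + 1) (\<lambda>s'. K s' \<and> (\<forall>i<n * q. content 2 s' i = y i)) s1"
    if "K s1 \<and> (\<forall>i<n * q. content 2 s1 i = x i) \<and> regs s1 6 = 2 ^ i \<and> regs s1 7 = int m" for s1
  proof (rule wp_frame[OF wp_add_template[OF _ _ len] order_refl])
    show "inp s1" "regs s1 7 = int m" using that by (auto simp: K_def)
    fix s'
    assume eq: "\<forall>i<n * q. content 2 s' i = content 2 s1 i + regs s1 6 * spread q n T m i"
      and "\<And>r. r \<notin> mod_regs (add_template q T) \<Longrightarrow> regs s' r = regs s1 r"
      and "\<And>u. u \<notin> mod_arrs (add_template q T) \<Longrightarrow> arrs s' u = arrs s1 u"
    moreover from this have "regs s' = regs s1"
      using mod_add_template[of q T] by auto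
    moreover have "arrs s' u = arrs s1 u" if "u \<noteq> 2" for u
      using calculation(3) mod_add_template(2)[of q T] that by blast
    ultimately show "K s' \<and> (\<forall>i<n * q. content 2 s' i = y i)"
      using that eq by (auto simp: K_def content_def y_def cand_def)
  qed
  have 3: "wp (eval_obj p q M 2) (n * q * 10 + 20) (\<lambda>s'. K s' \<and> (\<forall>i<n * q. content 2 s' i = y i) \<and> regs s' 3 = F y) s1"
    if "K s1 \<and> (\<forall>i<n * q. content 2 s1 i = y i)" for s1
  proof -
    have "obj M c (n * q) (content 2 s1) = F y" using that by (intro obj_cong) auto
    with that show ?thesis
      by (intro wp_frame[OF wp_eval_obj]) (auto simp: K_def content_def)
  qed
  have 4: "wp (If (Less (Reg 3) (Reg 5)) (Seq (Assign 5 (Reg 3)) (copy q 2 3)) Skip) (n * q * 3 + 4)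
      (tried x (insert (i, T, m) S)) s1"
    if s1: "K s1 \<and> (\<forall>i<n * q. content 2 s1 i = y i) \<and> regs s1 3 = F y" for s1
  proof (rule wp_If)
    assume less: "bval (Less (Reg 3) (Reg 5)) s1"
    let ?t = "(set_reg 5 (F y) s1)"
    have "wp (copy q 2 3) (n * q * 3 + 2) (tried x (insert (i, T, m) S)) ?t"
    proof (rule wp_frame[OF wp_copy])
      fix s'
      assume eq: "\<forall>i<n * q. content 3 s' i = content 2 ?t i"
        and r: "\<And>r. r \<notin> mod_regs (copy q 2 3) \<Longrightarrow> regs s' r = regs ?t r"
        and a: "\<And>u. u \<notin> mod_arrs (copy q 2 3) \<Longrightarrow> arrs s' u = arrs ?t u"
      have e3: "content 3 s' i = y i" if "i < n * q" for i
        using eq s1 that by (simp add: content_def)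
      have "sln (content 3 s')"
        using sln_cand[OF x T, of i m] sol_cong[of n q "content 3 s'" y, OF e3] unfolding y_def by blast
      moreover have "F (content 3 s') = F y" by (rule obj_cong) (rule e3)
      moreover have "F y < regs s 5" using less s1 by (simp add: K_def)
      ultimately show "tried x (insert (i, T, m) S) s'"
        using s s1 r a unfolding tried_def K_def y_def[symmetric] by (auto simp: content_def y_def[symmetric])
    qed (use s1 in \<open>auto simp: K_def\<close>)
    then show "wp (Seq (Assign 5 (Reg 3)) (copy q 2 3)) (n * q * 3 + 3) (tried x (insert (i, T, m) S)) s1"
      using s1 by (intro wp_Seq[where m = 1 and n = "n * q * 3 + 2"] wp_Assign) auto
  next
    assume "\<not> bval (Less (Reg 3) (Reg 5)) s1"
    then have "tried x (insert (i, T, m) S) s1"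
      using s s1 unfolding tried_def K_def y_def[symmetric]
      by (auto simp: content_def[abs_def] y_def[symmetric])
    then show "wp Skip (n * q * 3 + 3) (tried x (insert (i, T, m) S)) s1" by (intro wp_Skip) auto
  qed simp
  show ?thesis
    unfolding try_template_def
  proof (rule wp_Seq, rule wp_mono[OF 1 order_refl], rule wp_Seq, rule wp_mono[OF 2 order_refl], assumption,
      rule wp_Seq, rule wp_mono[OF 3 order_refl], assumption, rule 4, assumption)
  qed (auto simp: try_time_def)
qed

definition step_time :: nat where
  "step_time = n ^ L * (length Ts * try_time + 3) + 2"

lemma wp_search_step:
  assumes s: "tried x S s" and x: "sln x" and "regs s 6 = 2 ^ i"
  shows "wp (search_step p q M L Ts) step_time (tried x (S \<union> indices {i})) s"
  unfolding search_step_def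
proof (rule wp_For[where k = "n ^ L" and n = "length Ts * try_time + 1" and
      I = "\<lambda>m s. regs s 6 = 2 ^ i \<and> tried x (S \<union> {i} \<times> set Ts \<times> {..<m}) s"])
  fix m s'
  assume m: "m < n ^ L" "regs s' 7 = int m"
    "regs s' 6 = 2 ^ i \<and> tried x (S \<union> {i} \<times> set Ts \<times> {..<m}) s'"
  define I where "I = (\<lambda>l s'. regs s' 6 = 2 ^ i \<and> regs s' 7 = int m \<and>
      tried x (S \<union> {i} \<times> set Ts \<times> {..<m} \<union> {i} \<times> set (take l Ts) \<times> {m}) s')"
  have "wp (seqs (map (try_template p q M) Ts)) (length Ts * try_time + 1) (I (length Ts)) s'"
  proof (rule wp_seqs[where n = try_time and I = I])
    show "I 0 s'" using m by (simp add: I_def)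
    fix l t assume l: "l < length (map (try_template p q M) Ts)" and t: "I l t"
    have *: "insert (i, Ts ! l, m) (S \<union> {i} \<times> set Ts \<times> {..<m} \<union> {i} \<times> set (take l Ts) \<times> {m}) =
      S \<union> {i} \<times> set Ts \<times> {..<m} \<union> {i} \<times> set (take (Suc l) Ts) \<times> {m}"
      using l by (auto simp: take_Suc_conv_app_nth)
    have "wp (try_template p q M (Ts ! l)) try_time (I (Suc l)) t"
    proof (rule wp_frame[OF wp_try_template[OF _ x] order_refl])
      show "tried x (S \<union> {i} \<times> set Ts \<times> {..<m} \<union> {i} \<times> set (take l Ts) \<times> {m}) t" "regs t 7 = int m"
        "regs t 6 = 2 ^ i" using t by (auto simp: I_def)
      show "Ts ! l \<in> set Ts" using l by simp
    qed (use t in \<open>auto simp: I_def mod_try_template *\<close>)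
    then show "wp (map (try_template p q M) Ts ! l) try_time (I (Suc l)) t" using l by simp
  qed simp_all
  then show "wp (seqs (map (try_template p q M) Ts)) (length Ts * try_time + 1)
      (\<lambda>s'. regs (set_reg 7 (int (Suc m)) s') 6 = 2 ^ i \<and>
        tried x (S \<union> {i} \<times> set Ts \<times> {..<Suc m}) (set_reg 7 (int (Suc m)) s')) s'"
  proof (rule wp_mono[OF _ order_refl])
    fix s' assume "I (length Ts) s'"
    moreover have "S \<union> {i} \<times> set Ts \<times> {..<m} \<union> {i} \<times> set (take (length Ts) Ts) \<times> {m} =
      S \<union> {i} \<times> set Ts \<times> {..<Suc m}" by auto
    ultimately show "regs (set_reg 7 (int (Suc m)) s') 6 = 2 ^ i \<and>
        tried x (S \<union> {i} \<times> set Ts \<times> {..<Suc m}) (set_reg 7 (int (Suc m)) s')"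
      by (simp add: I_def tried_def content_def[abs_def])
  qed
qed (use assms in \<open>auto simp: tried_def content_def[abs_def] mod_try_template step_time_def add_mult_distrib2\<close>)

definition search_time :: "nat \<Rightarrow> nat" where
  "search_time V = V * (step_time + 2) + 2"

text \<open>The step length doubles until it exceeds \<open>B\<close>. Since
  \<open>B < 2 ^ V\<close> this takes at most \<open>V\<close> rounds, and by then every exponent
  that a decomposition with entries up to \<open>B\<close> can use has been tried.\<close>

lemma wp_search:
  assumes s: "tried x {} s" and x: "sln x" and B: "regs s 9 = B" "B < 2 ^ V"
  shows "wp (search p q M L Ts) (search_time V) (tried x (indices {i. 2 ^ i \<le> B})) s"
  unfolding search_def
proof (rule wp_Seq[where m = 1], rule wp_Assign)
  define body where "body = Seq (search_step p q M L Ts) (Assign 6 (Add (Reg 6) (Reg 6)))"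
  show "wp (While (Neg (Less (Reg 9) (Reg 6))) body) (Suc (V * Suc (step_time + 1)))
      (tried x (indices {i. 2 ^ i \<le> B})) (set_reg 6 (aval (Const 1) s) s)"
  proof (rule wp_While[where k = V and n = "step_time + 1" and I = "\<lambda>i s. regs s 9 = B \<and> regs s 6 = 2 ^ i \<and>
        tried x (indices {..<i}) s"])
    show "regs (set_reg 6 (aval (Const 1) s) s) 9 = B \<and>
        regs (set_reg 6 (aval (Const 1) s) s) 6 = 2 ^ 0 \<and>
        tried x (indices {..<0}) (set_reg 6 (aval (Const 1) s) s)"
      using s B by (simp add: tried_def content_def[abs_def])
  next
    fix i s
    assume I: "regs s 9 = B \<and> regs s 6 = 2 ^ i \<and> tried x (indices {..<i}) s"
      and "bval (Neg (Less (Reg 9) (Reg 6))) s"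
    then have "2 ^ i \<le> B" by simp
    with B(2) have "(2 :: int) ^ i < 2 ^ V" by linarith
    then have "i < V" by simp
    moreover have "wp (search_step p q M L Ts) step_time (\<lambda>s'. regs s' 9 = B \<and> regs s' 6 = 2 ^ i \<and>
        tried x (indices {..<Suc i}) s') s"
    proof (rule wp_frame[OF wp_search_step[OF _ x] order_refl])
      fix s'
      have *: "indices {..<i} \<union> indices {i} = indices {..<Suc i}"
        by auto
      assume "tried x (indices {..<i} \<union> indices {i}) s'"
        and r: "\<And>r. r \<notin> mod_regs (search_step p q M L Ts) \<Longrightarrow> regs s' r = regs s r"
      moreover have "9 \<notin> mod_regs (search_step p q M L Ts)" "6 \<notin> mod_regs (search_step p q M L Ts)"
        using mod_search_step(1)[of p q M L Ts] by auto
      ultimately show "regs s' 9 = B \<and> regs s' 6 = 2 ^ i \<and> tried x (indices {..<Suc i}) s'"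
        using I r[of 9] r[of 6] unfolding * by simp
    qed (use I in auto)
    then have "wp body (step_time + 1) (\<lambda>s'. regs s' 9 = B \<and> regs s' 6 = 2 ^ Suc i \<and>
        tried x (indices {..<Suc i}) s') s"
      unfolding body_def
      by (intro wp_Seq[where m = step_time and n = 1])
        (auto elim!: wp_mono intro!: wp_Assign simp: tried_def content_def[abs_def])
    ultimately show "i < V \<and> wp body (step_time + 1) (\<lambda>s'. regs s' 9 = B \<and> regs s' 6 = 2 ^ Suc i \<and>
        tried x (indices {..<Suc i}) s') s" by simp
  next
    fix i s
    assume I: "regs s 9 = B \<and> regs s 6 = 2 ^ i \<and> tried x (indices {..<i}) s"
      and "\<not> bval (Neg (Less (Reg 9) (Reg 6))) s"
    then have less: "B < 2 ^ i" by simp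
    have "{i. 2 ^ i \<le> B} \<subseteq> {..<i}"
    proof
      fix l assume "l \<in> {i. 2 ^ i \<le> B}"
      with less have "(2 :: int) ^ l < 2 ^ i" unfolding mem_Collect_eq by linarith
      then show "l \<in> {..<i}" by simp
    qed
    with I show "tried x (indices {i. 2 ^ i \<le> B}) s"
      unfolding tried_def by auto
  qed simp
qed (auto simp: search_time_def)

definition holds :: "int \<Rightarrow> (nat \<Rightarrow> int) \<Rightarrow> state \<Rightarrow> bool" where
  "holds B x s \<longleftrightarrow> inp s \<and> sln x \<and> (\<forall>i<n * q. content 4 s i = x i) \<and> regs s 4 = F x \<and> regs s 9 = B"

definition near :: "int \<Rightarrow> (nat \<Rightarrow> int) \<Rightarrow> (nat \<Rightarrow> int) \<Rightarrow> bool" where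
  "near B x y \<longleftrightarrow> (\<forall>i<n * q. \<bar>y i - x i\<bar> \<le> B)"

definition ncand :: "nat \<Rightarrow> nat" where
  "ncand V = length Ts * n ^ L * V"

definition improve_time :: "nat \<Rightarrow> nat" where
  "improve_time V = search_time V + n * q * 3 + 5"

text \<open>The estimate of the gap serves both outcomes. After an improvement it yields the
  geometric decrease; if \<open>F x' = F x\<close>, its right-hand side is zero and \<open>x\<close>
  is optimal among the solutions near it.\<close>

lemma wp_improve:
  assumes s: "holds B x s" and B: "B < 2 ^ V"
  shows "wp (improve p q M L Ts) (improve_time V) (\<lambda>s'. \<exists>x'. holds B x' s' \<and>
     (\<forall>y. sln y \<and> near B x y \<longrightarrow> F x - F y \<le> int (ncand V) * (F x - F x')) \<and>
     (F x' < F x \<and> regs s' 8 = regs s 8 \<or> F x' = F x \<and> regs s' 8 = 0)) s"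
    (is "wp _ _ ?Q s")
proof -
  let ?S = "indices {i. 2 ^ i \<le> B}"
  have x: "sln x" using s by (simp add: holds_def)
  have 1: "wp (search p q M L Ts) (search_time V) (\<lambda>s'. tried x ?S s' \<and> regs s' 9 = B \<and> regs s' 8 = regs s 8)
      (set_reg 5 (aval (Reg 4) s) s)"
  proof (rule wp_frame[OF wp_search[OF _ x _ B] order_refl])
    show "tried x {} (set_reg 5 (aval (Reg 4) s) s)"
      using s by (simp add: holds_def tried_def content_def[abs_def])
    show "regs (set_reg 5 (aval (Reg 4) s) s) 9 = B" using s by (simp add: holds_def)
    fix s'
    assume "tried x ?S s'" and
      r: "\<And>r. r \<notin> mod_regs (search p q M L Ts) \<Longrightarrow> regs s' r = regs (set_reg 5 (aval (Reg 4) s) s) r"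
    moreover have "9 \<notin> mod_regs (search p q M L Ts)" "8 \<notin> mod_regs (search p q M L Ts)"
      using mod_search(1)[of p q M L Ts] by auto
    ultimately show "tried x ?S s' \<and> regs s' 9 = B \<and> regs s' 8 = regs s 8"
      using s r[of 9] r[of 8] by (simp add: holds_def)
  qed
  have 2: "wp (If (Less (Reg 5) (Reg 4)) (Seq (Assign 4 (Reg 5)) (copy q 3 4)) (Assign 8 (Const 0)))
      (n * q * 3 + 4) ?Q s1"
    if s1: "tried x ?S s1 \<and> regs s1 9 = B \<and> regs s1 8 = regs s 8" for s1
  proof -
    have gap: "F x - F y \<le> int (ncand V) * (F x - regs s1 5)" if "sln y \<and> near B x y" for y
      unfolding ncand_def distinct_card[OF Ts(2), symmetric] Ts(1)
      using that s1 x B n_pos M(1)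
      by (intro obj_gap[OF dec]) (auto simp: tried_def near_def Ts(1) cand_def)
    show ?thesis
    proof (rule wp_If)
      assume less: "bval (Less (Reg 5) (Reg 4)) s1"
      let ?t = "(set_reg 4 (regs s1 5) s1)"
      have z: "sln (content 3 s1)" "F (content 3 s1) = regs s1 5" "regs s1 5 < F x"
        using less s1 by (auto simp: tried_def)
      have "wp (copy q 3 4) (n * q * 3 + 2) ?Q ?t"
      proof (rule wp_frame[OF wp_copy])
        fix s'
        assume "\<forall>i<n * q. content 4 s' i = content 3 ?t i"
          and "\<And>r. r \<notin> mod_regs (copy q 3 4) \<Longrightarrow> regs s' r = regs ?t r"
          and "\<And>u. u \<notin> mod_arrs (copy q 3 4) \<Longrightarrow> arrs s' u = arrs ?t u"
        then have "holds B (content 3 s1) s'" "regs s' 8 = regs s 8"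
          using s1 z by (auto simp: holds_def tried_def content_def)
        then show "?Q s'" using gap z by (intro exI[of _ "content 3 s1"]) auto
      qed (use s1 in \<open>auto simp: tried_def\<close>)
      then show "wp (Seq (Assign 4 (Reg 5)) (copy q 3 4)) (n * q * 3 + 3) ?Q s1"
        by (intro wp_Seq[where m = 1 and n = "n * q * 3 + 2"] wp_Assign) auto
    next
      assume "\<not> bval (Less (Reg 5) (Reg 4)) s1"
      then have eq: "regs s1 5 = F x" using s1 by (auto simp: tried_def)
      show "wp (Assign 8 (Const 0)) (n * q * 3 + 3) ?Q s1"
      proof (rule wp_Assign, intro exI[of _ x] conjI)
        show "holds B x (set_reg 8 (aval (Const 0) s1) s1)"
          using s1 x by (simp add: holds_def tried_def content_def[abs_def])
      qed (use gap eq in auto)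
    qed simp
  qed
  show ?thesis
    unfolding improve_def
    by (rule wp_Seq[where m = 1], rule wp_Assign, rule wp_Seq, rule wp_mono[OF 1 order_refl], rule 2)
      (auto simp: improve_time_def)
qed

end

section \<open>Repeated rounds and the geometric decrease of the gap\<close>

definition optimize :: "nat \<Rightarrow> nat \<Rightarrow> int \<Rightarrow> nat \<Rightarrow> (nat \<Rightarrow> int) list list \<Rightarrow> com" where
  "optimize p q M L Ts = Seq (Assign 8 (Const 1)) (While (Less (Const 0) (Reg 8)) (improve p q M L Ts))"

definition add_abs :: "nat \<Rightarrow> aexp \<Rightarrow> aexp \<Rightarrow> com" where
  "add_abs r e f = If (Less e (Const 0)) (Assign r (Sub (Reg r) (Mult e f))) (Assign r (Add (Reg r) (Mult e f)))"

lemma mod_add_abs [simp]: "mod_regs (add_abs r e f) = {r}" "mod_arrs (add_abs r e f) = {}"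
  by (auto simp: add_abs_def)

text \<open>Register 9 receives the bound of \<open>sol_distance\<close>, with the value of the
  starting solution as \<open>F0\<close>. All solutions that are at least as good lie within this
  distance of each other, so it is computed only once.\<close>

definition prepare :: "nat \<Rightarrow> nat \<Rightarrow> int \<Rightarrow> com" where
  "prepare p q M = Seq (eval_obj p q M 4) (Seq (Assign 4 (Reg 3)) (Seq (Assign 12 (Const 0))
     (Seq (seqs (map (\<lambda>j. add_abs 12 (b0E j) (Const 1)) [0..<q])) (Seq (Assign 9 (Reg 4))
     (Seq (For 13 (varsE q) (add_abs 9 (cE p q (Reg 13)) (Reg 12)))
       (Assign 9 (Add (Mult (Const 2) (Reg 12)) (Mult (Const 4) (Reg 9)))))))))"

definition check_sign :: "nat \<Rightarrow> com" where
  "check_sign q = Seq (Assign 10 (Const 0))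
     (For 13 (varsE q) (If (Less (Cell 4 (Reg 13)) (Const 0)) (Assign 10 (Const 1)) Skip))"

text \<open>The first two terms of the binomial expansion. For \<open>k = N\<close> the second of
  them is at least as large as the first.\<close>

lemma power_Suc_lower: "N ^ Suc k + Suc k * N ^ k \<le> Suc N ^ Suc k" for N k :: nat
proof (induction k)
  case (Suc k)
  have "N ^ Suc (Suc k) + Suc (Suc k) * N ^ Suc k \<le> Suc N * (N ^ Suc k + Suc k * N ^ k)"
    by (simp add: algebra_simps)
  also have "\<dots> \<le> Suc N * Suc N ^ Suc k" using Suc by (rule mult_le_mono2)
  finally show ?case by simp
qed simp

lemma double_power: "2 * N ^ Suc N \<le> Suc N ^ Suc N" for N :: nat
  using power_Suc_lower[of N N] by (simp add: algebra_simps)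

text \<open>If the gap shrinks by the factor \<open>N / (N + 1)\<close> in each round, it halves in \<open>N + 1\<close> rounds.\<close>

lemma rounds_bound:
  fixes N V m :: nat
  assumes "Suc N ^ m \<le> 2 ^ V * N ^ m"
  shows "m < Suc N * Suc V"
proof (rule ccontr)
  assume "\<not> m < Suc N * Suc V"
  then obtain e where m: "m = Suc N * Suc V + e" using le_Suc_ex not_less by blast
  show False
  proof (cases "N = 0")
    case True
    with assms m show False by simp
  next
    case False
    have "2 ^ V * N ^ m < 2 * 2 ^ V * N ^ m" using False by simp
    also have "\<dots> = (2 * N ^ Suc N) ^ Suc V * N ^ e"
      unfolding m power_add power_mult power_mult_distrib by simp
    also have "\<dots> \<le> (Suc N ^ Suc N) ^ Suc V * Suc N ^ e"
      by (intro mult_le_mono power_mono double_power) auto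
    also have "\<dots> = Suc N ^ m" unfolding m power_add power_mult by simp
    finally show False using assms by simp
  qed
qed

context nfold_search
begin

definition optimize_time :: "nat \<Rightarrow> nat" where
  "optimize_time V = Suc (Suc (Suc (ncand V) * Suc V) * Suc (improve_time V)) + 1"

lemma wp_optimize:
  assumes s: "holds B x0 s" and V: "B < 2 ^ V"
    and near: "\<And>x y. sln x \<Longrightarrow> sln y \<Longrightarrow> F x \<le> F x0 \<Longrightarrow> F y \<le> F x0 \<Longrightarrow> near B x y"
    and gap: "\<And>y. sln y \<Longrightarrow> F x0 - F y \<le> 2 ^ V"
  shows "wp (optimize p q M L Ts) (optimize_time V)
    (\<lambda>s'. \<exists>x. holds B x s' \<and> (\<forall>y. sln y \<longrightarrow> F x \<le> F y)) s"
proof -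
  have x0: "sln x0" using s by (simp add: holds_def)
  obtain y where y: "sln y" "\<And>z. sln z \<Longrightarrow> F y \<le> F z"
    using obj_minimizer[OF x0 M(1)] by blast
  define N where "N = ncand V"
  \<comment> \<open>After \<open>i\<close> rounds the gap is at most
    \<open>2 ^ V * (N / (N + 1)) ^ i\<close>, here without fractions. The gap may just have become
    zero, so the inequality that limits the number of rounds is kept from the previous round, in
    which the gap was still at least 1.\<close>
  define I where "I = (\<lambda>i s. \<exists>x. holds B x s \<and> F x \<le> F x0 \<and>
     (regs s 8 = 1 \<and> (F x - F y) * int (Suc N ^ i) \<le> 2 ^ V * int (N ^ i) \<and>
         (i = 0 \<or> Suc N ^ (i - 1) \<le> 2 ^ V * N ^ (i - 1)) \<or>
      regs s 8 = 0 \<and> F x = F y))"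
  have "wp (While (Less (Const 0) (Reg 8)) (improve p q M L Ts)) (optimize_time V - 1)
    (\<lambda>s'. \<exists>x. holds B x s' \<and> (\<forall>y. sln y \<longrightarrow> F x \<le> F y)) (set_reg 8 (aval (Const 1) s) s)"
  proof (rule wp_While[where I = I and k = "Suc (Suc N * Suc V)" and n = "improve_time V"])
    have "holds B x0 (set_reg 8 (aval (Const 1) s) s)"
      using s by (simp add: holds_def content_def[abs_def])
    then show "I 0 (set_reg 8 (aval (Const 1) s) s)"
      using gap[OF y(1)] unfolding I_def by (intro exI[of _ x0]) simp
  next
    fix i s assume "I i s" "\<not> bval (Less (Const 0) (Reg 8)) s"
    then obtain x where "holds B x s" "F x = F y" unfolding I_def by auto
    with y(2) show "\<exists>x. holds B x s \<and> (\<forall>y. sln y \<longrightarrow> F x \<le> F y)" by auto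
  next
    fix i s assume "I i s" "bval (Less (Const 0) (Reg 8)) s"
    then obtain x where x: "holds B x s" "F x \<le> F x0" "regs s 8 = 1"
      "(F x - F y) * int (Suc N ^ i) \<le> 2 ^ V * int (N ^ i)"
      "i = 0 \<or> Suc N ^ (i - 1) \<le> 2 ^ V * N ^ (i - 1)" unfolding I_def by auto
    have "i < Suc (Suc N * Suc V)" using x(5) rounds_bound[of N "i - 1" V] by auto
    moreover have "wp (improve p q M L Ts) (improve_time V) (I (Suc i)) s"
    proof (rule wp_mono[OF wp_improve[OF x(1) V] order_refl])
      fix s'
      assume "\<exists>x'. holds B x' s' \<and>
        (\<forall>y. sln y \<and> near B x y \<longrightarrow> F x - F y \<le> int (ncand V) * (F x - F x')) \<and>
        (F x' < F x \<and> regs s' 8 = regs s 8 \<or> F x' = F x \<and> regs s' 8 = 0)"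
      then obtain x' where x': "holds B x' s'"
        "\<And>y. sln y \<Longrightarrow> near B x y \<Longrightarrow> F x - F y \<le> int N * (F x - F x')"
        "F x' < F x \<and> regs s' 8 = 1 \<or> F x' = F x \<and> regs s' 8 = 0"
        using x(3) by (auto simp: N_def)
      have sx: "sln x" "sln x'" using x(1) x'(1) by (auto simp: holds_def)
      have g: "F x - F y \<le> int N * (F x - F x')"
        by (rule x'(2)[OF y(1) near[OF sx(1) y(1) x(2) y(2)[OF x0]]])
      from x'(3) show "I (Suc i) s'"
      proof
        assume less: "F x' < F x \<and> regs s' 8 = 1"
        then have "1 \<le> F x - F y" using y(2)[OF sx(2)] by simp
        then have "int (Suc N ^ i) \<le> (F x - F y) * int (Suc N ^ i)"
          using mult_right_mono[of 1 "F x - F y" "int (Suc N ^ i)"] by simp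
        also note x(4)
        finally have "int (Suc N ^ i) \<le> int (2 ^ V * N ^ i)" by simp
        then have 1: "Suc N ^ i \<le> 2 ^ V * N ^ i" by (simp only: of_nat_le_iff)
        \<comment> \<open>With the gap \<open>G\<close> and the gain \<open>D\<close> the estimate
          reads \<open>G \<le> N * D\<close>. Hence
          \<open>(N + 1) * (G - D) \<le> N * G - D\<close>, and \<open>D\<close> is
          positive.\<close>
        have "int (Suc N) * (F x' - F y) \<le> int N * (F x - F y)"
          using g less by (simp add: algebra_simps)
        then have "int (Suc N) * (F x' - F y) * int (Suc N ^ i) \<le> int N * (F x - F y) * int (Suc N ^ i)"
          by (rule mult_right_mono) simp
        also have "\<dots> \<le> int N * (2 ^ V * int (N ^ i))"
          unfolding mult.assoc using x(4) by (intro mult_left_mono) auto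
        finally have "(F x' - F y) * int (Suc N ^ Suc i) \<le> 2 ^ V * int (N ^ Suc i)"
          by (simp only: power_Suc of_nat_mult mult.assoc mult.left_commute mult.commute)
        then show "I (Suc i) s'"
          unfolding I_def using x'(1) less x(2) 1 by (intro exI[of _ x']) auto
      next
        assume eq: "F x' = F x \<and> regs s' 8 = 0"
        with g y(2)[OF sx(1)] have "F x' = F y" by simp
        with eq show "I (Suc i) s'"
          unfolding I_def using x'(1) x(2) by (intro exI[of _ x']) auto
      qed
    qed
    ultimately show "i < Suc (Suc N * Suc V) \<and> wp (improve p q M L Ts) (improve_time V) (I (Suc i)) s" ..
  qed (simp add: optimize_time_def N_def)
  then show ?thesis
    unfolding optimize_def by (intro wp_Seq[where m = 1] wp_Assign) (auto simp: optimize_time_def)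
qed

end

section \<open>Computing the distance bound and testing signs\<close>

context nfold_data
begin

lemma wp_add_abs:
  assumes "Q (set_reg r (regs s r + \<bar>aval e s\<bar> * aval f s) s)"
  shows "wp (add_abs r e f) 2 Q s"
  unfolding add_abs_def using assms
  by (intro wp_If[where n = 1] wp_Assign) (auto simp: abs_if)

lemma wp_prepare:
  fixes M :: int
  assumes s: "inp s"
  defines "\<beta> \<equiv> b0_norm" and "f \<equiv> obj M c (n * q) (content 4 s)"
  shows "wp (prepare p q M) (n * q * 14 + q * 2 + 40) (\<lambda>s'. arrs s' = arrs s \<and> regs s' 4 = f \<and>
    regs s' 9 = 2 * \<beta> + 4 * (f + c_norm * \<beta>)) s"
proof -
  define K where "K = (\<lambda>s' :: state. arrs s' = arrs s \<and> regs s' 4 = f)"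
  have 1: "wp (eval_obj p q M 4) (n * q * 10 + 20) (\<lambda>s'. arrs s' = arrs s \<and> regs s' 3 = f) s"
    by (rule wp_frame[OF wp_eval_obj[OF s]]) (auto simp: f_def)
  have 2: "wp (seqs (map (\<lambda>j. add_abs 12 (b0E j) (Const 1)) [0..<q])) (q * 2 + 1)
      (\<lambda>s'. K s' \<and> regs s' 12 = \<beta>) s1" if "K s1" "regs s1 12 = 0" for s1
    by (rule wp_seqs[where n = 2 and I = "\<lambda>j s'. K s' \<and> regs s' 12 = (\<Sum>j'<j. \<bar>b0 j'\<bar>)"])
      (use that s in \<open>auto intro!: wp_add_abs simp: K_def \<beta>_def\<close>)
  have 3: "wp (For 13 (varsE q) (add_abs 9 (cE p q (Reg 13)) (Reg 12))) (n * q * 4 + 2)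
      (\<lambda>s'. K s' \<and> regs s' 12 = \<beta> \<and> regs s' 9 = f + c_norm * \<beta>) s1"
    if "K s1 \<and> regs s1 12 = \<beta> \<and> regs s1 9 = f" for s1
    by (rule wp_For[where n = 2 and k = "n * q" and I = "\<lambda>i s'. K s' \<and> regs s' 12 = \<beta> \<and>
        regs s' 9 = f + (\<Sum>i'<i. \<bar>c i'\<bar>) * \<beta>"])
      (use that s in \<open>auto intro!: wp_add_abs simp: K_def algebra_simps\<close>)
  show ?thesis
    unfolding prepare_def
  proof (rule wp_Seq, rule wp_mono[OF 1 order_refl], rule wp_Seq[where m = 1], rule wp_Assign,
      rule wp_Seq[where m = 1], rule wp_Assign, rule wp_Seq, rule wp_mono[OF 2 order_refl])
    fix s1 s2 :: state
    assume s2: "K s2 \<and> regs s2 12 = \<beta>"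
    have 4: "wp (Assign 9 (Add (Mult (Const 2) (Reg 12)) (Mult (Const 4) (Reg 9)))) 1
       (\<lambda>s'. arrs s' = arrs s \<and> regs s' 4 = f \<and>
        regs s' 9 = 2 * \<beta> + 4 * (f + c_norm * \<beta>)) s3"
      if "K s3 \<and> regs s3 12 = \<beta> \<and> regs s3 9 = f + c_norm * \<beta>" for s3
      using that by (intro wp_Assign) (auto simp: K_def)
    show "wp (Seq (Assign 9 (Reg 4)) (Seq (For 13 (varsE q) (add_abs 9 (cE p q (Reg 13)) (Reg 12)))
       (Assign 9 (Add (Mult (Const 2) (Reg 12)) (Mult (Const 4) (Reg 9)))))) (n * q * 4 + 4)
       (\<lambda>s'. arrs s' = arrs s \<and> regs s' 4 = f \<and>
        regs s' 9 = 2 * \<beta> + 4 * (f + c_norm * \<beta>)) s2"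
      using s2
      by (intro wp_Seq[where m = 1 and n = "n * q * 4 + 3"] wp_Assign
          wp_Seq[where m = "n * q * 4 + 2" and n = 1] wp_mono[OF 3 order_refl] 4) (auto simp: K_def)
  qed (auto simp: K_def)
qed

lemma wp_check_sign:
  assumes s: "inp s"
  shows "wp (check_sign q) (n * q * 4 + 3) (\<lambda>s'. arrs s' = arrs s \<and>
    regs s' 10 = (if \<forall>i<n * q. 0 \<le> content 4 s i then 0 else 1)) s"
proof -
  have "wp (For 13 (varsE q) (If (Less (Cell 4 (Reg 13)) (Const 0)) (Assign 10 (Const 1)) Skip)) (n * q * 4 + 2)
    (\<lambda>s'. arrs s' = arrs s \<and> regs s' 10 = (if \<forall>i<n * q. 0 \<le> content 4 s i then 0 else 1))
    (set_reg 10 (aval (Const 0) s) s)"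
  proof (rule wp_For[where n = 2 and k = "n * q" and I = "\<lambda>i s'. arrs s' = arrs s \<and>
        regs s' 10 = (if \<forall>i'<i. 0 \<le> content 4 s i' then 0 else 1)"])
    fix i and s' :: state
    assume "i < n * q" "regs s' 13 = int i" "arrs s' = arrs s \<and>
        regs s' 10 = (if \<forall>i'<i. 0 \<le> content 4 s i' then 0 else 1)"
    then show "wp (If (Less (Cell 4 (Reg 13)) (Const 0)) (Assign 10 (Const 1)) Skip) 2
      (\<lambda>s'. arrs (set_reg 13 (int (Suc i)) s') = arrs s \<and>
        regs (set_reg 13 (int (Suc i)) s') 10 = (if \<forall>i'<Suc i. 0 \<le> content 4 s i' then 0 else 1)) s'"
      by (intro wp_If[where n = 1] wp_Assign wp_Skip) (auto simp: content_def less_Suc_eq)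
  qed (use s in auto)
  then show ?thesis unfolding check_sign_def by (intro wp_Seq[where m = 1] wp_Assign) auto
qed

end

section \<open>An initial integer solution\<close>

text \<open>The values of \<open>f\<close> form a subgroup of the integers. By division with
  remainder, a nonzero value of least absolute value divides all others.\<close>

lemma subgroup_generator:
  fixes f :: "'a \<Rightarrow> int"
  assumes "z0 \<in> Z" and "\<And>x y k. x \<in> Z \<Longrightarrow> y \<in> Z \<Longrightarrow> \<exists>z\<in>Z. f z = f x - k * f y"
  shows "\<exists>g\<in>Z. \<forall>z\<in>Z. f g dvd f z"
proof (cases "\<forall>z\<in>Z. f z = 0")
  case True
  with assms(1) show ?thesis by auto
next
  case False
  then obtain g where g: "g \<in> Z \<and> f g \<noteq> 0" "\<And>z. z \<in> Z \<and> f z \<noteq> 0 \<Longrightarrow> nat \<bar>f g\<bar> \<le> nat \<bar>f z\<bar>"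
    using ex_has_least_nat[of "\<lambda>z. z \<in> Z \<and> f z \<noteq> 0" _ "\<lambda>z. nat \<bar>f z\<bar>"] by blast
  have "f g dvd f z" if z: "z \<in> Z" for z
  proof -
    obtain y where y: "y \<in> Z" "f y = f z - (f z div f g) * f g"
      using assms(2)[OF z conjunct1[OF g(1)], of "f z div f g"] by blast
    then have "f y = f z mod f g" by (simp add: minus_div_mult_eq_mod)
    moreover have "\<bar>f z mod f g\<bar> < \<bar>f g\<bar>" using g(1) by (intro abs_mod_less) auto
    ultimately have "f y = 0" using g(2)[of y] y(1) by force
    with \<open>f y = f z mod f g\<close> show ?thesis by (simp add: dvd_eq_mod_eq_0)
  qed
  with g(1) show ?thesis by blast
qed

text \<open>The solution of the system of one brick is a family of expressions in the input and in
  register 11, the brick number; the second condition keeps their values when the rest of the memory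
  changes. The first \<open>m\<close> rows are required only if all \<open>p\<close> rows have a
  common integer solution, since otherwise the divisions inside need not be exact.\<close>

definition solves_rows :: "nat \<Rightarrow> nat \<Rightarrow> (nat \<Rightarrow> nat \<Rightarrow> int) \<Rightarrow> nat \<Rightarrow> (nat \<Rightarrow> aexp) \<Rightarrow> bool" where
  "solves_rows p q a m E \<longleftrightarrow> (\<forall>j. tame True (E j)) \<and>
     (\<forall>j s s'. arrs s 0 = arrs s' 0 \<longrightarrow> regs s 11 = regs s' 11 \<longrightarrow> aval (E j) s = aval (E j) s') \<and>
     (\<forall>s. (\<exists>z. \<forall>i<p. (\<Sum>j<q. a i j * z j) = aval (bE p q (Reg 11) i) s) \<longrightarrow>
       (\<forall>i<m. (\<Sum>j<q. a i j * aval (E j) s) = aval (bE p q (Reg 11) i) s))"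

lemmas solves_rowsD = solves_rows_def[THEN iffD1, THEN conjunct1, rule_format]
  solves_rows_def[THEN iffD1, THEN conjunct2, THEN conjunct1, rule_format]
  solves_rows_def[THEN iffD1, THEN conjunct2, THEN conjunct2, THEN spec, THEN mp]

text \<open>
  Integer linear systems with a fixed matrix are solved row by row: a correction that leaves the
  earlier rows alone changes row \<open>m\<close> by a multiple of a fixed generator.
\<close>

lemma solver_exists:
  "\<exists>E. solves_rows p q a p E"
proof -
  have "\<exists>E. solves_rows p q a m E" if "m \<le> p" for m
    using that
  proof (induction m)
    case 0
    show ?case by (intro exI[of _ "\<lambda>_. Const 0"]) (simp add: solves_rows_def)
  next
    case (Suc m)
    from Suc.IH[OF Suc_leD[OF Suc.prems]] obtain E where E0: "solves_rows p q a m E" ..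
    note E = solves_rowsD[OF E0]
    define row where "row = (\<lambda>i z. \<Sum>j<q. a i j * z j)"
    have row_diff: "row i (\<lambda>j. x j - k * y j) = row i x - k * row i y" for i x y k
      by (simp add: row_def right_diff_distrib sum_subtractf mult.left_commute[of _ k] flip: sum_distrib_left)
    have row_add: "row i (\<lambda>j. x j + y j * k) = row i x + k * row i y" for i x y k
      by (simp add: row_def distrib_left sum.distrib mult.left_commute mult.commute[of _ k] flip: sum_distrib_left)
    define Z where "Z = {z. \<forall>i<m. row i z = 0}"
    have "\<exists>g\<in>Z. \<forall>z\<in>Z. row m g dvd row m z"
    proof (rule subgroup_generator)
      show "(\<lambda>_. 0) \<in> Z" by (simp add: Z_def row_def)
      fix x y k assume "x \<in> Z" "y \<in> Z"
      then show "\<exists>z\<in>Z. row m z = row m x - k * row m y"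
        by (intro bexI[of _ "\<lambda>j. x j - k * y j"]) (auto simp: Z_def row_diff)
    qed
    then obtain g where g: "g \<in> Z" "\<And>z. z \<in> Z \<Longrightarrow> row m g dvd row m z" by blast
    \<comment> \<open>The multiple of \<open>g\<close> that repairs row \<open>m\<close>. If
      \<open>row m g = 0\<close>, the division yields 0, and the divisibility shown below says that
      the row is already right.\<close>
    define R where "R = Div (Sub (bE p q (Reg 11) m) (sum_exp (map (\<lambda>j. Mult (Const (a m j)) (E j)) [0..<q])))
      (Const (row m g))"
    define E' where "E' = (\<lambda>j. Add (E j) (Mult (Const (g j)) R))"
    show ?case
      unfolding solves_rows_def
    proof (intro exI[of _ E'] conjI allI impI)
      show "tame True (E' j)" for j by (simp add: E'_def R_def E(1) bE_def)
      have sum_E: "aval (sum_exp (map (\<lambda>j. Mult (Const (a m j)) (E j)) [0..<q])) s = row m (\<lambda>j. aval (E j) s)" for s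
        by (simp add: aval_sum_exp row_def)
      {
        fix j and s s' :: state
        assume eq: "arrs s 0 = arrs s' 0" "regs s 11 = regs s' 11"
        then have "aval (E j) s = aval (E j) s'" for j by (rule E(2))
        with eq show "aval (E' j) s = aval (E' j) s'" by (simp add: E'_def R_def sum_E bE_def)
      }
      fix s i
      assume ex: "\<exists>z. \<forall>i<p. (\<Sum>j<q. a i j * z j) = aval (bE p q (Reg 11) i) s" and i: "i < Suc m"
      define x where "x = (\<lambda>j. aval (E j) s)"
      define k where "k = aval R s"
      have x: "row i x = aval (bE p q (Reg 11) i) s" if "i < m" for i
        using E(3)[OF ex] that by (simp add: row_def x_def)
      from ex obtain z where z: "\<And>i. i < p \<Longrightarrow> row i z = aval (bE p q (Reg 11) i) s" by (auto simp: row_def)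
      \<comment> \<open>The difference between a true solution and the current one annihilates the
        earlier rows, so the generator divides what is missing in row \<open>m\<close>.\<close>
      have "(\<lambda>j. z j - 1 * x j) \<in> Z" unfolding Z_def mem_Collect_eq row_diff using z x Suc.prems by auto
      from g(2)[OF this] have "row m g dvd aval (bE p q (Reg 11) m) s - row m x"
        unfolding row_diff using z[of m] Suc.prems by simp
      moreover have "k = (aval (bE p q (Reg 11) m) s - row m x) div row m g"
        by (simp add: k_def R_def sum_E x_def)
      ultimately have k: "k * row m g = aval (bE p q (Reg 11) m) s - row m x" by simp
      have "(\<Sum>j<q. a i j * aval (E' j) s) = row i (\<lambda>j. x j + g j * k)"
        by (simp add: row_def E'_def x_def k_def)
      also have "\<dots> = row i x + k * row i g" by (rule row_add)
      also have "\<dots> = aval (bE p q (Reg 11) i) s"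
      proof (cases "i = m")
        case True
        with k show ?thesis by simp
      next
        case False
        with i have "i < m" by simp
        with g(1) x show ?thesis by (simp add: Z_def)
      qed
      finally show "(\<Sum>j<q. a i j * aval (E' j) s) = aval (bE p q (Reg 11) i) s" .
    qed
  qed
  from this[of p] show ?thesis by simp
qed

section \<open>The starting point, its test and the output\<close>

definition start_brick :: "nat \<Rightarrow> (nat \<Rightarrow> aexp) \<Rightarrow> com" where
  "start_brick q E = seqs (map (\<lambda>j. Seq (Store 4 (ix q (Reg 11) j) (E j))
     (Store 4 (Const (int j)) (Sub (Cell 4 (Const (int j))) (Cell 4 (ix q (Reg 11) j))))) [0..<q])"

text \<open>Brick 0 starts as \<open>b0\<close>, and each other brick is subtracted from it, so the
  sum constraint holds by construction.\<close>

definition start :: "nat \<Rightarrow> (nat \<Rightarrow> aexp) \<Rightarrow> com" where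
  "start q E = Seq (seqs (map (\<lambda>j. Store 4 (Const (int j)) (b0E j)) [0..<q])) (Seq (Assign 11 (Const 1))
     (While (Less (Reg 11) nE) (Seq (start_brick q E) (Assign 11 (Add (Reg 11) (Const 1))))))"

definition check_row :: "nat \<Rightarrow> nat \<Rightarrow> (nat \<Rightarrow> nat \<Rightarrow> int) \<Rightarrow> nat \<Rightarrow> com" where
  "check_row p q a i = (let l = sum_exp (map (\<lambda>j. Mult (Const (a i j)) (Cell 4 (ix q (Reg 11) j))) [0..<q]);
      r = bE p q (Reg 11) i in If (Conj (Neg (Less l r)) (Neg (Less r l))) Skip (Assign 10 (Const 1)))"

definition check :: "nat \<Rightarrow> nat \<Rightarrow> (nat \<Rightarrow> nat \<Rightarrow> int) \<Rightarrow> com" where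
  "check p q a = Seq (Assign 10 (Const 0)) (For 11 nE (seqs (map (check_row p q a) [0..<p])))"

text \<open>This phase overwrites array 0, so it may not use input cells as factors and is kept
  apart from the main program. Its loop takes the bound from register 0, because the loop destroys
  the input.\<close>

definition write_output :: "nat \<Rightarrow> com" where
  "write_output q = If (Less (Const 0) (Reg 10)) (Seq (Assign 0 (Const 1)) (Store 0 (Const 0) (Const 0)))
     (Seq (Assign 0 (Add (Const 1) (varsE q))) (Seq (For 13 (Sub (Reg 0) (Const 1))
       (Store 0 (Add (Reg 13) (Const 1)) (Cell 4 (Reg 13)))) (Store 0 (Const 0) (Const 2))))"

lemma brick_index_eq:
  assumes "j < q" "j' < (q :: nat)"
  shows "k * q + j = k' * q + j' \<longleftrightarrow> k = k' \<and> j = j'"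
proof
  assume eq: "k * q + j = k' * q + j'"
  have "(k * q + j) div q = k" "(k' * q + j') div q = k'" "(k * q + j) mod q = j" "(k' * q + j') mod q = j'"
    using assms by auto
  with eq show "k = k' \<and> j = j'" by metis
qed simp

context nfold_data
begin

lemma wp_start:
  assumes s: "inp s" and n: "0 < n"
    and E: "\<And>j s s'. arrs s 0 = arrs s' 0 \<Longrightarrow> regs s 11 = regs s' 11 \<Longrightarrow> aval (E j) s = aval (E j) s'"
  defines "ev \<equiv> \<lambda>k j. aval (E j) (set_reg 11 (int k) s)"
  shows "wp (start q E) (n * (2 * q + 3) + q + 4) (\<lambda>s'. arrs s' 0 = arrs s 0 \<and>
    (\<forall>k<n. \<forall>j<q. content 4 s' (k * q + j) = (if k = 0 then b0 j - (\<Sum>k=1..<n. ev k j) else ev k j))) s"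
proof -
  define val where "val = (\<lambda>m k j. if k = 0 then b0 j - (\<Sum>k=1..<m. ev k j) else ev k j)"
  \<comment> \<open>The entries \<open>j < l\<close> of brick \<open>m\<close> have been computed
    and subtracted, so in these positions brick 0 already accounts for brick
    \<open>m\<close>.\<close>
  define I where "I = (\<lambda>m l s'. arrs s' 0 = arrs s 0 \<and> regs s' 11 = int m \<and>
    (\<forall>k<m. \<forall>j<q. content 4 s' (k * q + j) = val (if j < l then Suc m else m) k j) \<and>
    (\<forall>j<l. content 4 s' (m * q + j) = ev m j))"
  have 1: "wp (seqs (map (\<lambda>j. Store 4 (Const (int j)) (b0E j)) [0..<q])) (q + 1)
      (\<lambda>s'. arrs s' 0 = arrs s 0 \<and> (\<forall>j<q. content 4 s' j = b0 j)) s"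
    by (rule wp_seqs[where n = 1 and I = "\<lambda>l s'. arrs s' 0 = arrs s 0 \<and> (\<forall>j<l. content 4 s' j = b0 j)"])
      (use s in \<open>auto intro!: wp_Store simp: content_def less_Suc_eq\<close>)
  have 2: "wp (start_brick q E) (q * 2 + 1) (I m q) s1" if m: "1 \<le> m" and I0: "I m 0 s1" for m s1
    unfolding start_brick_def
  proof (rule wp_seqs[where n = 2 and I = "I m"])
    let ?entry = "\<lambda>j. Seq (Store 4 (ix q (Reg 11) j) (E j))
      (Store 4 (Const (int j)) (Sub (Cell 4 (Const (int j))) (Cell 4 (ix q (Reg 11) j))))"
    show "I m 0 s1" by (rule I0)
    fix l s2 assume l: "l < length (map ?entry [0..<q])"
      and s2: "I m l s2"
    have l: "l < q" using l by simp
    have r: "aval (Reg 11) t = int m" if "regs t 11 = int m" for t using that by simp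
    define s3 where "s3 = s2\<lparr>arrs := (arrs s2)(4 := (arrs s2 4)(int (m * q + l) := ev m l))\<rparr>"
    define s4 where "s4 = s3\<lparr>arrs := (arrs s3)(4 := (arrs s3 4)(int l := content 4 s3 l - content 4 s3 (m * q + l)))\<rparr>"
    have El: "aval (E l) s2 = ev m l"
      unfolding ev_def using s2 by (intro E) (auto simp: I_def)
    have c3: "content 4 s3 (k * q + j) = (if k = m \<and> j = l then ev m l else content 4 s2 (k * q + j))" if "j < q" for k j
      using brick_index_eq[OF that l, of k m] by (simp add: s3_def content_def flip: of_nat_mult of_nat_add)
    have c4: "content 4 s4 (k * q + j) = (if k = 0 \<and> j = l then content 4 s3 l - content 4 s3 (m * q + l)
        else content 4 s3 (k * q + j))" if "j < q" for k j
      using brick_index_eq[OF that l, of k 0] by (simp add: s4_def content_def flip: of_nat_mult of_nat_add)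
    have l3: "content 4 s3 l = val m 0 l"
      using c3[OF l, of 0] m s2 l by (auto simp: I_def)
    have "I m (Suc l) s4"
      unfolding I_def
    proof (intro conjI allI impI)
      show "arrs s4 0 = arrs s 0" "regs s4 11 = int m"
        using s2 by (auto simp: s4_def s3_def I_def)
      fix k j assume kj: "k < m" "j < q"
      have "content 4 s2 (k * q + j) = val (if j < l then Suc m else m) k j" using s2 kj by (simp add: I_def)
      moreover have "val (Suc m) k j = (if k = 0 then val m k j - ev m j else val m k j)"
        using m by (simp add: val_def)
      ultimately show "content 4 s4 (k * q + j) = val (if j < Suc l then Suc m else m) k j"
        using c4[OF kj(2), of k] c3[OF kj(2), of k] c3[OF l, of m] l3 kj by (auto simp: less_Suc_eq)
    next
      fix j assume "j < Suc l"
      then have j: "j < q" "j < l \<or> j = l" using l by auto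
      then show "content 4 s4 (m * q + j) = ev m j"
        using c4[OF j(1), of m] c3[OF j(1), of m] m s2 by (auto simp: I_def)
    qed
    moreover have "s2\<lparr>arrs := (arrs s2)(4 := (arrs s2 4)(aval (ix q (Reg 11) l) s2 := aval (E l) s2))\<rparr> = s3"
      using s2 aval_ix[OF r, of s2 l] by (simp add: s3_def El I_def)
    moreover have "s3\<lparr>arrs := (arrs s3)(4 := (arrs s3 4)(aval (Const (int l)) s3 :=
        aval (Sub (Cell 4 (Const (int l))) (Cell 4 (ix q (Reg 11) l))) s3))\<rparr> = s4"
      using s2 aval_ix[OF r, of s3 l] by (simp add: s4_def s3_def I_def content_def)
    ultimately show "wp (map ?entry [0..<q] ! l) 2
      (I m (Suc l)) s2"
      using l by (auto intro!: wp_Seq[where m = 1 and n = 1] wp_Store)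
  qed (simp_all add: mult.commute)
  have 3: "wp (While (Less (Reg 11) nE) (Seq (start_brick q E) (Assign 11 (Add (Reg 11) (Const 1)))))
      (Suc (n * Suc (q * 2 + 2))) (\<lambda>s'. arrs s' 0 = arrs s 0 \<and>
        (\<forall>k<n. \<forall>j<q. content 4 s' (k * q + j) = val n k j)) s1"
    if "I 1 0 s1" for s1
  proof (rule wp_While[where I = "\<lambda>i s. Suc i \<le> n \<and> I (Suc i) 0 s" and k = n and n = "q * 2 + 2"])
    show "Suc 0 \<le> n \<and> I (Suc 0) 0 s1" using that n by simp
  next
    fix i s2 assume i: "Suc i \<le> n \<and> I (Suc i) 0 s2"
    then have inp: "inp s2" using s by (simp add: I_def)
    {
      assume "bval (Less (Reg 11) nE) s2"
      then have "Suc (Suc i) \<le> n" using i inp by (simp add: I_def)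
      moreover have "wp (start_brick q E) (q * 2 + 1) (\<lambda>s. I (Suc i) q s) s2" using 2 i by simp
      moreover have "I (Suc (Suc i)) 0 (set_reg 11 (1 + int (Suc i)) t)" if "I (Suc i) q t" for t
      proof -
        have "content 4 t (k * q + j) = val (Suc (Suc i)) k j" if "k < Suc (Suc i)" "j < q" for k j
          using \<open>I (Suc i) q t\<close> that by (cases "k = Suc i") (auto simp: I_def val_def)
        with that show ?thesis by (simp add: I_def content_def[abs_def])
      qed
      ultimately show "i < n \<and> wp (Seq (start_brick q E) (Assign 11 (Add (Reg 11) (Const 1)))) (q * 2 + 2)
          (\<lambda>s. Suc (Suc i) \<le> n \<and> I (Suc (Suc i)) 0 s) s2"
        by (auto intro!: wp_Seq[where m = "q * 2 + 1" and n = 1] wp_Assign elim!: wp_mono simp: I_def add.commute)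
    next
      assume "\<not> bval (Less (Reg 11) nE) s2"
      then have "n = Suc i" using i inp by (simp add: I_def)
      with i show "arrs s2 0 = arrs s 0 \<and> (\<forall>k<n. \<forall>j<q. content 4 s2 (k * q + j) = val n k j)"
        by (simp add: I_def)
    }
  qed simp
  show ?thesis
    unfolding start_def
  proof (rule wp_Seq, rule wp_mono[OF 1 order_refl], rule wp_Seq[where m = 1], rule wp_Assign,
      rule wp_mono[OF 3 order_refl])
    fix s' assume "arrs s' 0 = arrs s 0 \<and> (\<forall>j<q. content 4 s' j = b0 j)"
    then show "I 1 0 (set_reg 11 (aval (Const 1) s') s')"
      by (simp add: I_def val_def content_def)
  qed (auto simp: algebra_simps val_def)
qed

lemma wp_check:
  assumes s: "inp s"
  shows "wp (check p q a) (n * (p * 2 + 3) + 3) (\<lambda>s'. arrs s' = arrs s \<and>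
    regs s' 10 = (if \<forall>k<n. \<forall>i<p. (\<Sum>j<q. a i j * content 4 s (k * q + j)) = bb k i then 0 else 1)) s"
proof -
  define ok where "ok = (\<lambda>k i. (\<Sum>j<q. a i j * content 4 s (k * q + j)) = bb k i)"
  define I where "I = (\<lambda>k l (s' :: state). arrs s' = arrs s \<and>
    regs s' 10 = (if (\<forall>k'<k. \<forall>i<p. ok k' i) \<and> (\<forall>i<l. ok k i) then 0 else 1))"
  have row: "wp (check_row p q a i) 2 (\<lambda>s'. regs s' 11 = int k \<and> I k (Suc i) s') t"
    if t: "regs t 11 = int k \<and> I k i t" and ki: "k < n" "i < p" for k i t
  proof -
    have inp: "inp t" using t s by (simp add: I_def)
    have "aval (sum_exp (map (\<lambda>j. Mult (Const (a i j)) (Cell 4 (ix q (Reg 11) j))) [0..<q])) t =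
      (\<Sum>j<q. a i j * content 4 s (k * q + j))"
      unfolding aval_sum_exp using t aval_ix[of "Reg 11" t k] by (intro sum.cong) (auto simp: content_def I_def)
    moreover have "aval (bE p q (Reg 11) i) t = bb k i" using t ki by (intro aval_bE inp) auto
    ultimately show ?thesis
      unfolding check_row_def Let_def using t
      by (intro wp_If[where n = 1] wp_Assign wp_Skip) (auto simp: I_def ok_def less_Suc_eq)
  qed
  have "wp (For 11 nE (seqs (map (check_row p q a) [0..<p]))) (n * (p * 2 + 3) + 2) (I n 0)
      (set_reg 10 (aval (Const 0) s) s)"
  proof (rule wp_For[where k = n and n = "p * 2 + 1" and I = "\<lambda>k s'. I k 0 s'"])
    fix k s' assume k: "k < n" "regs s' 11 = int k" "I k 0 s'"
    have "wp (seqs (map (check_row p q a) [0..<p])) (p * 2 + 1) (\<lambda>s'. regs s' 11 = int k \<and> I k p s') s'"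
      by (rule wp_seqs[where n = 2 and I = "\<lambda>i s'. regs s' 11 = int k \<and> I k i s'"])
        (use k row in auto)
    then show "wp (seqs (map (check_row p q a) [0..<p])) (p * 2 + 1)
      (\<lambda>s'. I (Suc k) 0 (set_reg 11 (int (Suc k)) s')) s'"
      by (rule wp_mono) (auto simp: I_def less_Suc_eq)
  qed (use s in \<open>auto simp: I_def check_row_def Let_def add_mult_distrib2\<close>)
  then show ?thesis
    unfolding check_def by (intro wp_Seq[where m = 1] wp_Assign) (auto simp: I_def ok_def elim!: wp_mono)
qed

lemma wp_write_output:
  assumes s: "inp s"
  shows "wp (write_output q) (n * q * 3 + 5) (\<lambda>s'. holds_output s'
    (if 0 < regs s 10 then [0] else 2 # map (content 4 s) [0..<n * q])) s"
proof -
  define s1 where "s1 = (set_reg 0 (1 + int (n * q)) s)"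
  have 1: "wp (For 13 (Sub (Reg 0) (Const 1)) (Store 0 (Add (Reg 13) (Const 1)) (Cell 4 (Reg 13)))) (n * q * 3 + 2)
    (\<lambda>s'. regs s' 0 = 1 + int (n * q) \<and> (\<forall>i<n * q. arrs s' 0 (1 + int i) = content 4 s i)) s1"
    by (rule wp_For[where k = "n * q" and n = 1 and I = "\<lambda>l s'. regs s' 0 = 1 + int (n * q) \<and>
        arrs s' 4 = arrs s 4 \<and> (\<forall>i<l. arrs s' 0 (1 + int i) = content 4 s i)"])
      (auto intro!: wp_Store simp: s1_def content_def less_Suc_eq)
  have 2: "holds_output (t\<lparr>arrs := (arrs t)(0 := (arrs t 0)(0 := 2))\<rparr>) (2 # map (content 4 s) [0..<n * q])"
    if "regs t 0 = 1 + int (n * q)" "\<forall>i<n * q. arrs t 0 (1 + int i) = content 4 s i" for t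
    using that by (auto simp: holds_output_def nth_Cons split: nat.split)
  show ?thesis
    unfolding write_output_def
  proof (rule wp_If[where n = "n * q * 3 + 4"])
    assume "bval (Less (Const 0) (Reg 10)) s"
    then show "wp (Seq (Assign 0 (Const 1)) (Store 0 (Const 0) (Const 0))) (n * q * 3 + 4)
      (\<lambda>s'. holds_output s' (if 0 < regs s 10 then [0] else 2 # map (content 4 s) [0..<n * q])) s"
      by (intro wp_Seq[where m = 1 and n = 1] wp_Assign wp_Store) (auto simp: holds_output_def)
  next
    assume n10: "\<not> bval (Less (Const 0) (Reg 10)) s"
    show "wp (Seq (Assign 0 (Add (Const 1) (varsE q))) (Seq (For 13 (Sub (Reg 0) (Const 1))
       (Store 0 (Add (Reg 13) (Const 1)) (Cell 4 (Reg 13)))) (Store 0 (Const 0) (Const 2)))) (n * q * 3 + 4)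
      (\<lambda>s'. holds_output s' (if 0 < regs s 10 then [0] else 2 # map (content 4 s) [0..<n * q])) s"
    proof (rule wp_Seq[where m = 1 and n = "n * q * 3 + 3"], rule wp_Assign)
      have e: "(set_reg 0 (aval (Add (Const 1) (varsE q)) s) s) = s1"
        using s by (simp add: s1_def)
      show "wp (Seq (For 13 (Sub (Reg 0) (Const 1))
       (Store 0 (Add (Reg 13) (Const 1)) (Cell 4 (Reg 13)))) (Store 0 (Const 0) (Const 2))) (n * q * 3 + 3)
      (\<lambda>s'. holds_output s' (if 0 < regs s 10 then [0] else 2 # map (content 4 s) [0..<n * q]))
      (set_reg 0 (aval (Add (Const 1) (varsE q)) s) s)"
        unfolding e using n10 2
        by (intro wp_Seq[where m = "n * q * 3 + 2" and n = 1] wp_mono[OF 1 order_refl]) (auto intro!: wp_Store)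
    qed simp_all
  qed simp
qed

end

section \<open>The complete program\<close>

definition solve :: "nat \<Rightarrow> nat \<Rightarrow> (nat \<Rightarrow> nat \<Rightarrow> int) \<Rightarrow> (nat \<Rightarrow> aexp) \<Rightarrow> int \<Rightarrow> nat \<Rightarrow> (nat \<Rightarrow> int) list list \<Rightarrow> com" where
  "solve p q a E M L Ts = Seq (start q E) (Seq (check p q a) (If (Less (Const 0) (Reg 10)) Skip
     (Seq (prepare p q M) (Seq (optimize p q M L Ts) (check_sign q)))))"

lemma tame_exps [simp]: "tame i nE" "tame i (varsE q)" "tame i e \<Longrightarrow> tame i (cE p q e)" "tame i (b0E j)"
    "tame i e \<Longrightarrow> tame i (bE p q e j)" "tame i e \<Longrightarrow> tame i (ix q e j)" "tame True (powE l)"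
    "tame True (digitE l)"
proof -
  show "tame i nE" for i by (simp add: nE_def)
  show "tame True (powE l)" for l by (induction l) (simp_all add: nE_def)
  then show "tame True (digitE l)" by (simp add: digitE_def nE_def del: powE.simps)
qed (auto simp: varsE_def cE_def b0E_def bE_def ix_def nE_def)

lemma ctame_solve:
  assumes "\<And>j. tame True (E j)"
  shows "ctame True (solve p q a E M L Ts)"
proof -
  have copy: "ctame True (copy q u v)" if "v \<noteq> 0" for u v using that by (simp add: copy_def)
  have eval: "ctame True (eval_obj p q M u)" for u by (simp add: eval_obj_def cE_def nE_def)
  have try_T: "ctame True (try_template p q M T)" for T
    by (simp add: try_template_def copy eval add_template_def)
  have "ctame True (optimize p q M L Ts)"
    by (simp add: optimize_def improve_def search_def search_step_def copy try_T)
  moreover have "ctame True (prepare p q M)" by (simp add: prepare_def eval add_abs_def cE_def b0E_def nE_def)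
  moreover have "ctame True (start q E)" by (simp add: start_def start_brick_def assms)
  moreover have "ctame True (check p q a)" by (simp add: check_def check_row_def Let_def)
  ultimately show ?thesis by (simp add: solve_def check_sign_def)
qed

lemma ctame_write_output: "ctame False (write_output q)"
  by (simp add: write_output_def)

definition init_steps :: "nat \<Rightarrow> nat \<Rightarrow> nat \<Rightarrow> nat" where
  "init_steps p q n = n * (2 * q + 3) + q + 4 + (n * (p * 2 + 3) + 3)"

definition prepare_steps :: "nat \<Rightarrow> nat \<Rightarrow> nat" where
  "prepare_steps q n = n * q * 14 + q * 2 + 40"

definition optimize_steps :: "nat \<Rightarrow> nat \<Rightarrow> nat \<Rightarrow> nat \<Rightarrow> nat \<Rightarrow> nat" where
  "optimize_steps q L l n V = Suc (Suc (Suc (l * n ^ L * V) * Suc V) * Suc (V *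
     (n ^ L * (l * (n * q * 16 + L * (q + 1) + 30) + 3) + 2 + 2) + 2 + n * q * 3 + 5)) + 1"

text \<open>One more than the bit length of the numbers in memory after the preparation. Register 9
  is among them, so two to this power bounds both the step lengths and the initial gap, and it does
  so with an exponent linear in the number of steps.\<close>

definition value_bits :: "nat \<Rightarrow> nat \<Rightarrow> nat \<Rightarrow> nat \<Rightarrow> nat \<Rightarrow> nat" where
  "value_bits p q C n w = w + init_steps p q n * C * w + prepare_steps q n * C * w + 1"

definition solve_steps :: "nat \<Rightarrow> nat \<Rightarrow> nat \<Rightarrow> nat \<Rightarrow> nat \<Rightarrow> nat \<Rightarrow> nat \<Rightarrow> nat" where
  "solve_steps p q L l C n w = init_steps p q n + prepare_steps q n +
     optimize_steps q L l n (value_bits p q C n w) + n * q * 4 + 4"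

section \<open>Correctness of the complete program\<close>

context nfold_search
begin

definition feas :: "(nat \<Rightarrow> int) \<Rightarrow> bool" where
  "feas x \<longleftrightarrow> sln x \<and> (\<forall>i<n * q. 0 \<le> x i)"

definition cost :: "(nat \<Rightarrow> int) \<Rightarrow> int" where
  "cost x = (\<Sum>i<n * q. c i * x i)"

lemma obj_feas: "feas x \<Longrightarrow> F x = cost x"
  by (simp add: feas_def obj_def pobj_def negpart_def cost_def)

text \<open>The penalty is exact, so the signs of a minimizer decide whether feasible points exist.
  On feasible points the penalty vanishes and the objective is the cost.\<close>

lemma minimizer_optimal:
  assumes "sln x" and "\<And>y. sln y \<Longrightarrow> F x \<le> F y"
  shows "(\<exists>y. feas y) \<Longrightarrow> feas x" and "feas x \<Longrightarrow> feas y \<Longrightarrow> cost x \<le> cost y"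
proof -
  show "feas x" if "\<exists>y. feas y"
    using that minimizer_nonneg[OF dec n_pos M(2) assms] assms(1) unfolding feas_def by blast
  show "cost x \<le> cost y" if "feas x" "feas y"
    using assms(2)[of y] that obj_feas by (simp add: feas_def)
qed

text \<open>The test of the starting point decides whether integer solutions exist. Given a solution
  \<open>y\<close>, every brick system is solvable, so only brick 0 is in question; and the rows of
  \<open>b0\<close>, as the sum of the bricks of \<open>y\<close>, give the sum of all
  \<open>bb k\<close>, which leaves \<open>bb 0\<close> for brick 0.\<close>

lemma start_sol_iff:
  assumes ev: "\<And>k. k < n \<Longrightarrow> (\<exists>z. \<forall>i<p. (\<Sum>j<q. a i j * z j) = bb k i) \<Longrightarrow>
      (\<forall>i<p. (\<Sum>j<q. a i j * ev k j) = bb k i)"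
    and x: "\<forall>k<n. \<forall>j<q. x (k * q + j) = (if k = 0 then b0 j - (\<Sum>k=1..<n. ev k j) else ev k j)"
  shows "(\<forall>k<n. \<forall>i<p. (\<Sum>j<q. a i j * x (k * q + j)) = bb k i) \<Longrightarrow> sln x"
    and "sln y \<Longrightarrow> (\<forall>k<n. \<forall>i<p. (\<Sum>j<q. a i j * x (k * q + j)) = bb k i)"
proof -
  have split: "(\<Sum>k<n. g k) = g 0 + (\<Sum>k=1..<n. g k)" for g :: "nat \<Rightarrow> int"
    using n_pos by (simp add: lessThan_atLeast0 sum.atLeast_Suc_lessThan)
  show "sln x" if "\<forall>k<n. \<forall>i<p. (\<Sum>j<q. a i j * x (k * q + j)) = bb k i"
    unfolding sol_def
  proof (intro conjI that allI impI)
    fix j assume j: "j < q"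
    have "(\<Sum>k=1..<n. x (k * q + j)) = (\<Sum>k=1..<n. ev k j)"
      using x j by (intro sum.cong) auto
    then show "(\<Sum>k<n. x (k * q + j)) = b0 j"
      using x[rule_format, OF n_pos j] unfolding split by simp
  qed
  assume y: "sln y"
  then have row: "(\<Sum>j<q. a i j * y (k * q + j)) = bb k i" if "k < n" "i < p" for k i
    using that by (simp add: sol_def)
  have E: "(\<Sum>j<q. a i j * ev k j) = bb k i" if "k < n" "i < p" for k i
  proof -
    have "\<exists>z. \<forall>i<p. (\<Sum>j<q. a i j * z j) = bb k i"
      using row[OF that(1)] by (intro exI[of _ "\<lambda>j. y (k * q + j)"]) simp
    from ev[OF that(1) this] that(2) show ?thesis by simp
  qed
  show "\<forall>k<n. \<forall>i<p. (\<Sum>j<q. a i j * x (k * q + j)) = bb k i"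
  proof (intro allI impI)
    fix k i assume k: "k < n" and i: "i < p"
    show "(\<Sum>j<q. a i j * x (k * q + j)) = bb k i"
    proof (cases "k = 0")
      case False
      have "(\<Sum>j<q. a i j * x (k * q + j)) = (\<Sum>j<q. a i j * ev k j)"
        using x k False by (intro sum.cong) auto
      with E[OF k i] show ?thesis by simp
    next
      case True
      have "(\<Sum>j<q. a i j * x (k * q + j)) = (\<Sum>j<q. a i j * (b0 j - (\<Sum>k=1..<n. ev k j)))"
        using x k True by (intro sum.cong) auto
      also have "\<dots> = (\<Sum>j<q. a i j * b0 j) - (\<Sum>j<q. \<Sum>k=1..<n. a i j * ev k j)"
        by (simp add: right_diff_distrib sum_subtractf sum_distrib_left)
      also have "(\<Sum>j<q. \<Sum>k=1..<n. a i j * ev k j) = (\<Sum>k=1..<n. bb k i)"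
        using E i by (subst sum.swap) (auto intro: sum.cong)
      also have "(\<Sum>j<q. a i j * b0 j) = (\<Sum>j<q. \<Sum>k<n. a i j * y (k * q + j))"
        using y by (intro sum.cong) (auto simp: sol_def sum_distrib_left[symmetric])
      also have "\<dots> = (\<Sum>k<n. bb k i)"
        using row i by (subst sum.swap) (auto intro: sum.cong)
      finally show ?thesis using True unfolding split by simp
    qed
  qed
qed

lemma obj_gap_bound:
  assumes "sln x" and "sln y"
  shows "F x - F y \<le> F x + c_norm * b0_norm"
    and "0 \<le> F x + c_norm * b0_norm"
  using obj_lower_bound[OF assms(1) M(1), of c] obj_lower_bound[OF assms(2) M(1), of c]
    negpart_nonneg[of "n * q" x] negpart_nonneg[of "n * q" y] by linarith+

lemma wp_solve:
  assumes s: "inp s"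
    and E0: "solves_rows p q a p E"
    and C: "cweight (solve p q a E M L Ts) \<le> C"
    and w: "bounded w s" "input_bounded w s" "0 < w"
  shows "wp (solve p q a E M L Ts) (solve_steps p q L (length Ts) C n w) (\<lambda>s'. inp s' \<and>
    (if 0 < regs s' 10 then \<nexists>y. feas y else feas (content 4 s') \<and> (\<forall>y. feas y \<longrightarrow> cost (content 4 s') \<le> cost y))) s"
    (is "wp _ _ ?Q s")
proof -
  note E = solves_rowsD[OF E0]
  define ev where "ev = (\<lambda>k j. aval (E j) (set_reg 11 (int k) s))"
  define t1 where "t1 = init_steps p q n"
  define t2 where "t2 = prepare_steps q n"
  define v1 where "v1 = w + (n * (2 * q + 3) + q + 4) * C * w"
  define v2 where "v2 = v1 + (n * (p * 2 + 3) + 3) * C * w"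
  define v3 where "v3 = v2 + t2 * C * w"
  define V where "V = value_bits p q C n w"
  \<comment> \<open>The extra bit makes the inequality \<open>B < 2 ^ V\<close> strict.\<close>
  have V: "V = Suc v3"
    by (simp add: V_def value_bits_def v3_def v2_def v1_def init_steps_def t2_def algebra_simps)
  have tames: "ctame True (start q E)" "ctame True (check p q a)" "ctame True (prepare p q M)"
    using ctame_solve[of E p q a M L Ts] E(1) by (simp_all add: solve_def)
  have Cs: "cweight (start q E) \<le> C" "cweight (check p q a) \<le> C" "cweight (prepare p q M) \<le> C"
    using C by (simp_all add: solve_def)
  define start_ok where "start_ok = (\<lambda>s' :: state. inp s' \<and>
    (\<forall>k<n. \<forall>j<q. content 4 s' (k * q + j) = (if k = 0 then b0 j - (\<Sum>k=1..<n. ev k j) else ev k j)))"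
  have 1: "wp (start q E) (n * (2 * q + 3) + q + 4) (\<lambda>s'. start_ok s' \<and> bounded v1 s' \<and> input_bounded w s') s"
  proof (rule wp_mono[OF wp_bounded[OF wp_start[OF s n_pos E(2)] tames(1) Cs(1) w(1) w(2) w(3)] order_refl])
    fix s' :: state
    assume "((arrs s' 0 = arrs s 0 \<and> (\<forall>k<n. \<forall>j<q. content 4 s' (k * q + j) = (if k = 0
      then b0 j - (\<Sum>k=1..<n. aval (E j) (set_reg 11 (int k) s))
      else aval (E j) (set_reg 11 (int k) s)))) \<and>
      bounded (w + (n * (2 * q + 3) + q + 4) * C * w) s' \<and> (True \<longrightarrow> input_bounded w s'))"
    then show "start_ok s' \<and> bounded v1 s' \<and> input_bounded w s'"
      using s by (simp add: start_ok_def ev_def v1_def)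
  qed
  have ev: "\<forall>i<p. (\<Sum>j<q. a i j * ev k j) = bb k i"
    if "k < n" "\<exists>z. \<forall>i<p. (\<Sum>j<q. a i j * z j) = bb k i" for k
    using E(3)[of "(set_reg 11 (int k) s)"] that aval_bE[of "(set_reg 11 (int k) s)" "Reg 11" k] s
    by (simp add: ev_def)
  define check_ok where "check_ok = (\<lambda>s' :: state. inp s' \<and>
    (if 0 < regs s' 10 then \<nexists>y. sln y else sln (content 4 s')))"
  have 2: "wp (check p q a) (n * (p * 2 + 3) + 3) (\<lambda>s'. check_ok s' \<and> bounded v2 s' \<and> input_bounded w s') s1"
    if s1: "start_ok s1 \<and> bounded v1 s1 \<and> input_bounded w s1" for s1
  proof -
    have inp1: "inp s1" using s1 by (simp add: start_ok_def)
    note iff = start_sol_iff[of ev "content 4 s1", OF ev]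
    have "wp (check p q a) (n * (p * 2 + 3) + 3) check_ok s1"
    proof (rule wp_mono[OF wp_check[OF inp1, of a] order_refl])
      fix s' :: state
      assume *: "arrs s' = arrs s1 \<and> regs s' 10 =
        (if \<forall>k<n. \<forall>i<p. (\<Sum>j<q. a i j * content 4 s1 (k * q + j)) = bb k i then 0 else 1)"
      then have "content 4 s' = content 4 s1" by (simp add: content_def[abs_def])
      with * inp1 iff s1 show "check_ok s'" unfolding check_ok_def start_ok_def by (auto split: if_splits)
    qed
    moreover have "bounded v1 s1" "True \<Longrightarrow> input_bounded w s1" using s1 by auto
    ultimately show ?thesis using wp_bounded[OF _ tames(2) Cs(2) _ _ w(3)] unfolding v2_def by simp
  qed
  have 3: "wp (prepare p q M) t2 (\<lambda>s'. \<exists>B. holds B (content 4 s') s' \<and> B < 2 ^ V \<and>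
      B = 2 * b0_norm + 4 * (F (content 4 s') + c_norm * b0_norm)) s1"
    if s1: "check_ok s1 \<and> bounded v2 s1 \<and> input_bounded w s1" and pos: "\<not> 0 < regs s1 10" for s1
  proof -
    have inp1: "inp s1" using s1 by (simp add: check_ok_def)
    show ?thesis
    proof (rule wp_mono[OF wp_bounded[OF wp_prepare[OF inp1, of M] tames(3) Cs(3) _ _ w(3)]])
      fix s' :: state
      assume *: "(arrs s' = arrs s1 \<and> regs s' 4 = F (content 4 s1) \<and> regs s' 9 =
          2 * b0_norm + 4 * (F (content 4 s1) + c_norm * b0_norm)) \<and>
        bounded (v2 + (n * q * 14 + q * 2 + 40) * C * w) s' \<and> (True \<longrightarrow> input_bounded w s')"
      then have content: "content 4 s' = content 4 s1" by (simp add: content_def[abs_def])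
      have "bounded v3 s'" using * by (simp add: v3_def t2_def prepare_steps_def)
      then have "\<bar>regs s' 9\<bar> \<le> 2 ^ v3" by (simp add: bounded_def)
      also have "\<dots> < (2 :: int) ^ V" by (simp add: V)
      finally have "regs s' 9 < 2 ^ V" by simp
      then show "\<exists>B. holds B (content 4 s') s' \<and> B < 2 ^ V \<and>
        B = 2 * b0_norm + 4 * (F (content 4 s') + c_norm * b0_norm)"
        using * s1 pos unfolding content holds_def check_ok_def by (intro exI[of _ "regs s' 9"]) auto
    qed (use s1 in \<open>auto simp: t2_def prepare_steps_def\<close>)
  qed
  define opt_ok where "opt_ok = (\<lambda>s' :: state. inp s' \<and> sln (content 4 s') \<and> (\<forall>y. sln y \<longrightarrow> F (content 4 s') \<le> F y))"
  have opt_time: "optimize_steps q L (length Ts) n V = optimize_time V"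
    by (simp add: optimize_steps_def optimize_time_def improve_time_def search_time_def step_time_def
        try_time_def ncand_def)
  have 4: "wp (optimize p q M L Ts) (optimize_steps q L (length Ts) n V) opt_ok s1"
    if s1: "\<exists>B. holds B (content 4 s1) s1 \<and> B < 2 ^ V \<and>
      B = 2 * b0_norm + 4 * (F (content 4 s1) + c_norm * b0_norm)" for s1 :: state
  proof -
    define G where "G = F (content 4 s1) + c_norm * b0_norm"
    define \<beta> where "\<beta> = b0_norm"
    obtain B where B: "holds B (content 4 s1) s1" "B < 2 ^ V" "B = 2 * \<beta> + 4 * G"
      using s1 unfolding G_def \<beta>_def by blast
    have sl: "sln (content 4 s1)" using B(1) by (simp add: holds_def)
    \<comment> \<open>Both terms of \<open>B = 2 * \<beta> + 4 * G\<close> are nonnegative, so the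
      size of register 9 also bounds \<open>G\<close>, which is at least the gap to any
      solution.\<close>
    have "0 \<le> \<beta>" by (simp add: \<beta>_def sum_nonneg)
    moreover have "0 \<le> G" using obj_gap_bound(2)[OF sl sl] by (simp add: G_def)
    ultimately have G: "G \<le> 2 ^ V" using B(2,3) by linarith
    show ?thesis
      unfolding opt_time
    proof (rule wp_mono[OF wp_optimize[OF B(1,2)] order_refl])
      fix x y assume "sln x" "sln y" "F x \<le> F (content 4 s1)" "F y \<le> F (content 4 s1)"
      then show "near B x y"
        unfolding near_def B(3) G_def \<beta>_def using sol_distance[OF _ _ M(1)] by blast
    next
      fix y assume "sln y"
      from obj_gap_bound(1)[OF sl this] show "F (content 4 s1) - F y \<le> 2 ^ V" using G unfolding G_def by linarith
    next
      fix s' :: state assume "\<exists>x. holds B x s' \<and> (\<forall>y. sln y \<longrightarrow> F x \<le> F y)"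
      then obtain x where x: "holds B x s'" "\<And>y. sln y \<Longrightarrow> F x \<le> F y" by blast
      have eq: "\<And>i. i < n * q \<Longrightarrow> content 4 s' i = x i" using x(1) by (simp add: holds_def)
      have "sln (content 4 s') = sln x" by (rule sol_cong[OF eq])
      moreover have "F (content 4 s') = F x" by (rule obj_cong[OF eq])
      ultimately show "opt_ok s'" using x by (simp add: opt_ok_def holds_def)
    qed
  qed
  have 5: "wp (check_sign q) (n * q * 4 + 3) ?Q s1" if s1: "opt_ok s1" for s1
  proof (rule wp_mono[OF wp_check_sign order_refl])
    show "inp s1" using s1 by (simp add: opt_ok_def)
    fix s' :: state
    assume *: "arrs s' = arrs s1 \<and> regs s' 10 = (if \<forall>i<n * q. 0 \<le> content 4 s1 i then 0 else 1)"
    then have content: "content 4 s' = content 4 s1" by (simp add: content_def[abs_def])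
    have "sln (content 4 s1)" "\<And>y. sln y \<Longrightarrow> F (content 4 s1) \<le> F y" using s1 by (auto simp: opt_ok_def)
    note opt = minimizer_optimal[OF this]
    have "regs s' 10 = (if feas (content 4 s1) then 0 else 1)" using * s1 by (simp add: feas_def opt_ok_def)
    moreover have "inp s'" using * s1 by (simp add: opt_ok_def)
    ultimately show "?Q s'" using opt unfolding content by (cases "feas (content 4 s1)") auto
  qed
  have 6: "wp (If (Less (Const 0) (Reg 10)) Skip (Seq (prepare p q M) (Seq (optimize p q M L Ts) (check_sign q))))
      (t2 + optimize_steps q L (length Ts) n V + n * q * 4 + 4) ?Q s1"
    if s1: "check_ok s1 \<and> bounded v2 s1 \<and> input_bounded w s1" for s1
  proof (rule wp_If[where n = "t2 + optimize_steps q L (length Ts) n V + n * q * 4 + 3"])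
    assume "bval (Less (Const 0) (Reg 10)) s1"
    with s1 show "wp Skip (t2 + optimize_steps q L (length Ts) n V + n * q * 4 + 3) ?Q s1"
      by (intro wp_Skip) (auto simp: check_ok_def feas_def)
  next
    assume "\<not> bval (Less (Const 0) (Reg 10)) s1"
    then have pos: "\<not> 0 < regs s1 10" by simp
    show "wp (Seq (prepare p q M) (Seq (optimize p q M L Ts) (check_sign q)))
        (t2 + optimize_steps q L (length Ts) n V + n * q * 4 + 3) ?Q s1"
      by (rule wp_Seq[where m = t2 and n = "optimize_steps q L (length Ts) n V + (n * q * 4 + 3)"],
          rule wp_mono[OF 3[OF s1 pos] order_refl], rule wp_Seq[OF _ order_refl],
          rule wp_mono[OF 4 order_refl], assumption, rule 5, assumption) simp_all
  qed simp
  show ?thesis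
    unfolding solve_def
    by (rule wp_Seq, rule wp_mono[OF 1 order_refl], rule wp_Seq[OF _ order_refl],
        rule wp_mono[OF 2 order_refl], assumption, rule 6, assumption) (simp_all add: solve_steps_def init_steps_def V_def t2_def)
qed

end

section \<open>Encodings\<close>

definition poly_bounded :: "('a \<Rightarrow> nat) \<Rightarrow> ('a \<Rightarrow> nat) \<Rightarrow> bool" where
  "poly_bounded sz f \<longleftrightarrow> (\<exists>T :: nat poly. \<forall>x. f x \<le> poly T (sz x))"

lemma poly_bounded_const: "poly_bounded sz (\<lambda>_. k)"
  unfolding poly_bounded_def by (intro exI[of _ "[:k:]"]) simp

lemma poly_bounded_size: "poly_bounded sz sz"
  unfolding poly_bounded_def by (intro exI[of _ "[:0, 1:]"]) simp

lemma poly_bounded_le: "poly_bounded sz g \<Longrightarrow> (\<And>x. f x \<le> g x) \<Longrightarrow> poly_bounded sz f"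
  unfolding poly_bounded_def by (meson order_trans)

lemma poly_bounded_add: "poly_bounded sz f \<Longrightarrow> poly_bounded sz g \<Longrightarrow> poly_bounded sz (\<lambda>x. f x + g x)"
  unfolding poly_bounded_def by (elim exE, rule_tac x = "T + Ta" in exI) (simp add: add_mono)

lemma poly_bounded_mult: "poly_bounded sz f \<Longrightarrow> poly_bounded sz g \<Longrightarrow> poly_bounded sz (\<lambda>x. f x * g x)"
  unfolding poly_bounded_def by (elim exE, rule_tac x = "T * Ta" in exI) (simp add: mult_mono)

lemma poly_bounded_power: "poly_bounded sz f \<Longrightarrow> poly_bounded sz (\<lambda>x. f x ^ k)"
  by (induction k) (simp_all add: poly_bounded_const poly_bounded_mult)

lemma poly_bounded_Suc: "poly_bounded sz f \<Longrightarrow> poly_bounded sz (\<lambda>x. Suc (f x))"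
  using poly_bounded_add[of sz f "\<lambda>_. 1"] poly_bounded_const[of sz 1] by simp

section \<open>Bricks as segments of a flat list\<close>

lemma length_concat_uniform:
  assumes "\<forall>xs\<in>set xss. length xs = m"
  shows "length (concat xss) = length xss * m"
  using assms by (induction xss) auto

lemma nth_concat_uniform:
  assumes "\<forall>xs\<in>set xss. length xs = m" and "k < length xss" and "j < m"
  shows "concat xss ! (k * m + j) = xss ! k ! j"
  using assms
proof (induction xss arbitrary: k)
  case (Cons xs xss)
  show ?case
  proof (cases k)
    case 0
    with Cons.prems show ?thesis by (simp add: nth_append)
  next
    case (Suc k')
    with Cons.prems Cons.IH[of k'] show ?thesis by (simp add: nth_append)
  qed
qed simp

lemma vec_entries_uniform:
  assumes "\<forall>k\<in>{1..n}. v k \<in> carrier_vec m"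
  shows "length (vec_entries v [1..<n + 1]) = n * m"
    and "k < n \<Longrightarrow> j < m \<Longrightarrow> vec_entries v [1..<n + 1] ! (k * m + j) = v (Suc k) $ j"
proof -
  let ?xss = "map (\<lambda>k. list_of_vec (v k)) [1..<n + 1]"
  have *: "\<forall>xs\<in>set ?xss. length xs = m"
  proof
    fix xs assume "xs \<in> set ?xss"
    then have "\<exists>k\<in>{1..n}. xs = list_of_vec (v k)" by force
    with assms show "length xs = m" by auto
  qed
  show "length (vec_entries v [1..<n + 1]) = n * m"
    using length_concat_uniform[OF *] by (simp add: vec_entries_def)
  assume k: "k < n" and j: "j < m"
  have "v (Suc k) \<in> carrier_vec m" using assms k by simp
  then show "vec_entries v [1..<n + 1] ! (k * m + j) = v (Suc k) $ j"
    using nth_concat_uniform[OF * _ j, of k] k j by (simp add: vec_entries_def list_of_vec_index del: upt_Suc)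
qed

context
  fixes A :: "int mat" and p q n :: nat and b c :: "nat \<Rightarrow> int vec"
  assumes A: "A \<in> carrier_mat p q" and inst: "nfold_instance p q n b c"
begin

abbreviation (input) ent :: "nat \<Rightarrow> nat \<Rightarrow> int" where
  "ent i j \<equiv> A $$ (i, j)"

lemma instD: "n > 0" "b 0 \<in> carrier_vec q" "\<forall>k\<in>{1..n}. b k \<in> carrier_vec p" "\<forall>k\<in>{1..n}. c k \<in> carrier_vec q"
  using inst by (auto simp: nfold_instance_def)

lemma bc_entries_split:
  "bc_entries n b c = list_of_vec (b 0) @ vec_entries b [1..<n + 1] @ vec_entries c [1..<n + 1]"
proof -
  have "[0..<n + 1] = 0 # [1..<n + 1]" by (simp add: upt_conv_Cons del: upt_Suc)
  then show ?thesis by (simp add: bc_entries_def vec_entries_def del: upt_Suc)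
qed

lemma encoded_input:
  "input p q n (($) (b 0)) (\<lambda>k i. b (Suc k) $ i) (\<lambda>i. c (Suc (i div q)) $ (i mod q))
     (arrs (init_state (encode_input n b c)) 0)"
proof -
  note ub = vec_entries_uniform[OF instD(3)] and uc = vec_entries_uniform[OF instD(4)]
  define xs where "xs = encode_input n b c"
  have xs: "xs = int n # list_of_vec (b 0) @ vec_entries b [1..<n + 1] @ vec_entries c [1..<n + 1]"
    by (simp add: xs_def encode_input_def bc_entries_split)
  have len: "length xs = 1 + q + n * p + n * q"
    using instD(2) ub(1) uc(1) by (simp add: xs del: upt_Suc)
  have arr: "arrs (init_state xs) 0 (int m) = xs ! m" if "m < length xs" for m
    using that by (simp add: init_state_def)
  have brick: "k * m + j < n * m" if "k < n" "j < m" for k j m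
  proof -
    have "k * m + j < Suc k * m" using that by simp
    also have "\<dots> \<le> n * m" using that by (intro mult_le_mono1) simp
    finally show ?thesis .
  qed
  show ?thesis
    unfolding input_def xs_def[symmetric]
  proof (intro conjI allI impI)
    show "arrs (init_state xs) 0 0 = int n" using arr[of 0] len by (simp add: xs)
  next
    fix j assume j: "j < q"
    have "xs ! (1 + j) = b 0 $ j" using j instD(2) by (simp add: xs nth_append list_of_vec_index)
    then show "arrs (init_state xs) 0 (1 + int j) = b 0 $ j" using arr[of "1 + j"] j len by simp
  next
    fix k i assume k: "k < n" and i: "i < p"
    have "xs ! (1 + q + (k * p + i)) = b (Suc k) $ i"
      using brick[OF k i] instD(2) ub(1) ub(2)[OF k i] by (simp add: xs nth_append del: upt_Suc)
    then show "arrs (init_state xs) 0 (1 + int q + int p * int k + int i) = b (Suc k) $ i"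
      using arr[of "1 + q + (k * p + i)"] brick[OF k i] len by (simp add: algebra_simps)
  next
    fix i assume i: "i < n * q"
    then have k: "i div q < n" and j: "i mod q < q" by (auto simp: less_mult_imp_div_less) (cases q; simp)
    have "xs ! (1 + q + n * p + i) = vec_entries c [1..<n + 1] ! i"
      using instD(2) ub(1) by (simp add: xs nth_append del: upt_Suc)
    also have "\<dots> = c (Suc (i div q)) $ (i mod q)" using uc(2)[OF k j] by simp
    finally show "arrs (init_state xs) 0 (1 + int q + int p * int n + int i) = c (Suc (i div q)) $ (i mod q)"
      using arr[of "1 + q + n * p + i"] i len by (simp add: algebra_simps)
  qed
qed

text \<open>The passage between the vectors of the problem, numbered from 1, and the flat vector of
  the program, whose bricks are numbered from 0.\<close>

lemma feasible_iff:
  assumes v: "\<And>k. k \<in> {1..n} \<Longrightarrow> v k \<in> carrier_vec q"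
    and y: "\<And>k j. k < n \<Longrightarrow> j < q \<Longrightarrow> y (k * q + j) = v (Suc k) $ j"
  shows "v \<in> nfold_feasible A n b \<longleftrightarrow>
      sol ent p q n (\<lambda>k i. b (Suc k) $ i) (($) (b 0)) y \<and> (\<forall>i<n * q. 0 \<le> y i)"
    and "nfold_objective n c v = (\<Sum>i<n * q. c (Suc (i div q)) $ (i mod q) * y i)"
proof -
  have dim: "dim_row A = p" "dim_col A = q" using A by auto
  have all_Suc: "(\<forall>k\<in>{1..n}. P k) \<longleftrightarrow> (\<forall>k<n. P (Suc k))" for P
    unfolding image_Suc_lessThan[symmetric] by auto
  have sum_Suc: "(\<Sum>k=1..n. f k) = (\<Sum>k<n. f (Suc k))" for f :: "nat \<Rightarrow> int"
    by (simp add: sum.atLeast1_atMost_eq)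
  have vS: "v (Suc k) \<in> carrier_vec q" if "k < n" for k using v[of "Suc k"] that by simp
  have nonneg: "(\<forall>k<n. \<forall>j<q. 0 \<le> v (Suc k) $ j) \<longleftrightarrow> (\<forall>i<n * q. 0 \<le> y i)"
  proof
    assume *: "\<forall>k<n. \<forall>j<q. 0 \<le> v (Suc k) $ j"
    show "\<forall>i<n * q. 0 \<le> y i"
    proof (intro allI impI)
      fix i assume i: "i < n * q"
      then have k: "i div q < n" and j: "i mod q < q" by (auto simp: less_mult_imp_div_less) (cases q; simp)
      from y[OF k j] * k j show "0 \<le> y i" by simp
    qed
  next
    assume *: "\<forall>i<n * q. 0 \<le> y i"
    show "\<forall>k<n. \<forall>j<q. 0 \<le> v (Suc k) $ j"
    proof (intro allI impI)
      fix k j assume kj: "k < n" "j < q"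
      have "k * q + j < Suc k * q" using kj by simp
      also have "\<dots> \<le> n * q" using kj by (intro mult_le_mono1) simp
      finally have "0 \<le> y (k * q + j)" using * by blast
      then show "0 \<le> v (Suc k) $ j" using y[OF kj] by simp
    qed
  qed
  have mult: "A *\<^sub>v v (Suc k) = b (Suc k) \<longleftrightarrow> (\<forall>i<p. (\<Sum>j<q. ent i j * y (k * q + j)) = b (Suc k) $ i)"
    if k: "k < n" for k
  proof -
    have "b (Suc k) \<in> carrier_vec p" using instD(3) k by simp
    then have "A *\<^sub>v v (Suc k) = b (Suc k) \<longleftrightarrow> (\<forall>i<p. (A *\<^sub>v v (Suc k)) $ i = b (Suc k) $ i)"
      using dim by (auto simp: vec_eq_iff)
    moreover have "(A *\<^sub>v v (Suc k)) $ i = (\<Sum>j<q. ent i j * y (k * q + j))" if "i < p" for i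
      using that dim vS[OF k] y[OF k] by (simp add: scalar_prod_def lessThan_atLeast0)
    ultimately show ?thesis by auto
  qed
  have total: "finsum_vec TYPE(int) q v {1..n} = b 0 \<longleftrightarrow> (\<forall>j<q. (\<Sum>k<n. y (k * q + j)) = b 0 $ j)"
  proof -
    have vc: "v \<in> {1..n} \<rightarrow> carrier_vec q" using v by auto
    have "finsum_vec TYPE(int) q v {1..n} \<in> carrier_vec q" by (rule finsum_vec_closed[OF vc])
    then have "finsum_vec TYPE(int) q v {1..n} = b 0 \<longleftrightarrow>
        (\<forall>j<q. finsum_vec TYPE(int) q v {1..n} $ j = b 0 $ j)"
      using instD(2) by (auto simp: vec_eq_iff)
    moreover have "finsum_vec TYPE(int) q v {1..n} $ j = (\<Sum>k<n. y (k * q + j))" if "j < q" for j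
      unfolding index_finsum_vec[OF finite_atLeastAtMost that vc] sum_Suc using y that by (intro sum.cong) auto
    ultimately show ?thesis by auto
  qed
  show "v \<in> nfold_feasible A n b \<longleftrightarrow>
      sol ent p q n (\<lambda>k i. b (Suc k) $ i) (($) (b 0)) y \<and> (\<forall>i<n * q. 0 \<le> y i)"
    unfolding nfold_feasible_def mem_Collect_eq dim all_Suc total sol_def nonneg[symmetric]
    using vS mult by blast
  show "nfold_objective n c v = (\<Sum>i<n * q. c (Suc (i div q)) $ (i mod q) * y i)"
    unfolding nfold_objective_def sum_Suc sum_bricks
  proof (intro sum.cong refl)
    fix k assume "k \<in> {..<n}"
    then have k: "k < n" by simp
    show "c (Suc k) \<bullet> v (Suc k) = (\<Sum>j<q. c (Suc ((k * q + j) div q)) $ ((k * q + j) mod q) * y (k * q + j))"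
      using vS[OF k] y[OF k] by (auto simp: scalar_prod_def lessThan_atLeast0 intro!: sum.cong)
  qed
qed

lemma encoded_output:
  "map y [0..<n * q] = vec_entries (\<lambda>k. vec q (\<lambda>j. y ((k - 1) * q + j))) [1..<n + 1]"
proof (rule nth_equalityI)
  have u: "\<forall>k\<in>{1..n}. vec q (\<lambda>j. y ((k - 1) * q + j)) \<in> carrier_vec q" by simp
  note v = vec_entries_uniform[OF u]
  show "length (map y [0..<n * q]) = length (vec_entries (\<lambda>k. vec q (\<lambda>j. y ((k - 1) * q + j))) [1..<n + 1])"
    using v(1) by simp
  fix i assume "i < length (map y [0..<n * q])"
  then have i: "i < n * q" by simp
  then have k: "i div q < n" and j: "i mod q < q" by (auto simp: less_mult_imp_div_less) (cases q; simp)
  show "map y [0..<n * q] ! i = vec_entries (\<lambda>k. vec q (\<lambda>j. y ((k - 1) * q + j))) [1..<n + 1] ! i"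
    using v(2)[OF k j] i j by simp
qed

lemma input_size_bounds:
  shows "n \<le> input_size n b c" and "0 < input_size n b c"
    and "bounded (input_size n b c) (init_state (encode_input n b c))"
    and "input_bounded (input_size n b c) (init_state (encode_input n b c))"
proof -
  define S where "S = input_size n b c"
  define xs where "xs = encode_input n b c"
  have xs: "xs = int n # bc_entries n b c" by (simp add: xs_def encode_input_def)
  have S: "S = n + sum_list (map bit_size (bc_entries n b c))" by (simp add: S_def input_size_def)
  show n: "n \<le> input_size n b c" by (simp add: input_size_def)
  then show "0 < input_size n b c" using instD(1) by simp
  \<comment> \<open>Every entry has at least one bit, so the size also bounds the length of the
    list, which stands in register 0; the leading entry \<open>n\<close> of the list is paid for by
    \<open>n > 0\<close>.\<close>
  have "length zs \<le> sum_list (map bit_size zs)" for zs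
    by (induction zs) (auto simp: bit_size_def)
  from this[of "bc_entries n b c"] have len: "length xs \<le> S" using instD(1) unfolding xs S by simp
  have pow: "int m \<le> 2 ^ S" if "m \<le> S" for m
  proof -
    have "m \<le> 2 ^ S" using that less_exp[of S] by linarith
    then show ?thesis by (metis of_nat_le_iff of_nat_numeral of_nat_power)
  qed
  have el: "\<bar>z\<bar> \<le> 2 ^ S" if "z \<in> set xs" for z
  proof (cases "z = int n")
    case True
    then show ?thesis using pow[of n] n by (simp add: S_def)
  next
    case False
    then have "z \<in> set (bc_entries n b c)" using that by (simp add: xs)
    then have "bit_size z \<le> sum_list (map bit_size (bc_entries n b c))"
      by (intro member_le_sum_list) auto
    then have "bit_size z \<le> S" by (simp add: S)
    then have "(2 :: int) ^ bit_size z \<le> 2 ^ S" by (intro power_increasing) auto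
    with abs_le_bit_size[of z] show ?thesis by linarith
  qed
  have arr: "\<bar>arrs (init_state xs) u i\<bar> \<le> 2 ^ S" for u i
    using el by (auto simp: init_state_def)
  then show "input_bounded (input_size n b c) (init_state (encode_input n b c))"
    by (simp add: input_bounded_def S_def xs_def)
  have "\<bar>regs (init_state xs) r\<bar> \<le> 2 ^ S" for r
    using pow[OF len] by (simp add: init_state_def)
  with arr show "bounded (input_size n b c) (init_state (encode_input n b c))"
    by (simp add: bounded_def S_def xs_def)
qed

end

section \<open>Total running time and the final assembly\<close>

lemma wp_exec:
  assumes "wp P n Q s" and "ctame i P" and "cweight P \<le> C" and "bounded v s"
    and "i \<Longrightarrow> input_bounded w s" and "0 < w"
  shows "\<exists>t s'. exec P s t s' \<and> Q s' \<and> bounded (v + n * C * w) s' \<and> t \<le> n * (C * (v + n * C * w + 2) + 1)"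
proof -
  obtain m s' where *: "m \<le> n" "run P s m s'" "Q s'" using assms(1) unfolding wp_def by blast
  from run_exec[OF *(2) assms(2-6)] obtain t where t: "bounded (v + m * C * w) s'"
    "t \<le> m * (C * (v + m * C * w + 2) + 1)" "exec P s t s'" by blast
  have le: "m * C * w \<le> n * C * w" using *(1) by simp
  then have "(2 :: int) ^ (v + m * C * w) \<le> 2 ^ (v + n * C * w)" by (intro power_increasing) auto
  then have "bounded (v + n * C * w) s'" using t(1) unfolding bounded_def by (meson order_trans)
  moreover have "m * (C * (v + m * C * w + 2) + 1) \<le> n * (C * (v + n * C * w + 2) + 1)"
    using le *(1) by (intro mult_le_mono add_le_mono order_refl)
  ultimately show ?thesis using *(3) t(2,3) by (meson order_trans)
qed

text \<open>The second summand is the output phase, which starts with numbers of the length that the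
  main phase may have produced.\<close>

definition total_time :: "nat \<Rightarrow> nat \<Rightarrow> nat \<Rightarrow> nat \<Rightarrow> nat \<Rightarrow> nat \<Rightarrow> nat \<Rightarrow> nat" where
  "total_time p q L l C n w = solve_steps p q L l C n w * (C * (w + solve_steps p q L l C n w * C * w + 2) + 1) +
     (n * q * 3 + 5) * (C * (w + solve_steps p q L l C n w * C * w + (n * q * 3 + 5) * C * w + 2) + 1)"

lemma total_time_poly:
  "\<exists>T. \<forall>n b c. total_time p q L l C n (input_size n b c) \<le> poly T (input_size n b c)"
proof -
  define sz where "sz = (\<lambda>(n, b, c). input_size n b c)"
  \<comment> \<open>Here it matters that \<open>n\<close> enters the size with its value: the
    running time contains the factor \<open>n ^ L\<close>.\<close>
  have n: "poly_bounded sz (\<lambda>x. fst x)"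
    by (rule poly_bounded_le[OF poly_bounded_size]) (auto simp: sz_def input_size_def)
  note intros = poly_bounded_const n poly_bounded_size poly_bounded_Suc poly_bounded_add poly_bounded_mult poly_bounded_power
  have V: "poly_bounded sz (\<lambda>x. value_bits p q C (fst x) (sz x))"
    unfolding value_bits_def init_steps_def prepare_steps_def by (intro intros)
  have O: "poly_bounded sz (\<lambda>x. optimize_steps q L l (fst x) (value_bits p q C (fst x) (sz x)))"
    unfolding optimize_steps_def by (intro intros V)
  have s: "poly_bounded sz (\<lambda>x. solve_steps p q L l C (fst x) (sz x))"
    unfolding solve_steps_def init_steps_def prepare_steps_def by (intro intros O)
  have "poly_bounded sz (\<lambda>x. total_time p q L l C (fst x) (sz x))"
    unfolding total_time_def by (intro intros s)
  then show ?thesis unfolding poly_bounded_def sz_def by auto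
qed

theorem theorem1p1:
  fixes A :: "int mat" and p q :: nat
  assumes "A \<in> carrier_mat p q"
  shows "\<exists>(P :: com) (T :: nat poly). \<forall>n b c. nfold_instance p q n b c \<longrightarrow>
    (\<exists>t out. computes_in P (encode_input n b c) t (encode_outcome n out) \<and>
       t \<le> poly T (input_size n b c) \<and>
       correct_outcome A n b c out)"
proof -
  define a where "a = (\<lambda>i j. A $$ (i, j))"
  obtain E where E: "solves_rows p q a p E"
    using solver_exists[where p = p and q = q and a = a] ..
  obtain L r where dec: "decomposable a p q L r" using decomposable_exists by blast
  obtain Ts where Ts: "set Ts = templates a p q L r" "distinct Ts"
    using finite_distinct_list[OF finite_templates] by blast
  \<comment> \<open>Meets both demands on \<open>M\<close>: at least 2, and at least the bound
    \<open>L * r\<close> on the entries of a step of length one.\<close>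
  define M where "M = int (L * r) + 2"
  define P where "P = solve p q a E M L Ts"
  define C where "C = cweight P + cweight (write_output q)"
  have C: "cweight P \<le> C" "cweight (write_output q) \<le> C" by (simp_all add: C_def)
  obtain T where T: "\<And>n b c. total_time p q L (length Ts) C n (input_size n b c) \<le> poly T (input_size n b c)"
    using total_time_poly by blast
  have "\<exists>t out. computes_in (Seq P (write_output q)) (encode_input n b c) t (encode_outcome n out) \<and>
       t \<le> poly T (input_size n b c) \<and> correct_outcome A n b c out"
    if inst: "nfold_instance p q n b c" for n b c
  proof -
    define S where "S = input_size n b c"
    define s0 where "s0 = init_state (encode_input n b c)"
    interpret nfold_search p q n "($) (b 0)" "\<lambda>k i. b (Suc k) $ i" "\<lambda>i. c (Suc (i div q)) $ (i mod q)" a L r Ts M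
      using Ts dec instD(1)[OF assms inst] by unfold_locales (auto simp: M_def)
    have inp0: "inp s0" unfolding s0_def by (rule encoded_input[OF assms inst])
    note S = input_size_bounds[OF assms inst, folded S_def s0_def]
    define n1 where "n1 = solve_steps p q L (length Ts) C n S"
    have "wp P n1 (\<lambda>s'. inp s' \<and> (if 0 < regs s' 10 then \<nexists>y. feas y
        else feas (content 4 s') \<and> (\<forall>y. feas y \<longrightarrow> cost (content 4 s') \<le> cost y))) s0"
      unfolding P_def n1_def by (rule wp_solve[OF inp0 E C(1)[unfolded P_def] S(3,4,2)])
    moreover have "ctame True P" unfolding P_def by (rule ctame_solve) (rule solves_rowsD(1)[OF E])
    ultimately have "\<exists>t s'. exec P s0 t s' \<and> (inp s' \<and> (if 0 < regs s' 10 then \<nexists>y. feas y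
        else feas (content 4 s') \<and> (\<forall>y. feas y \<longrightarrow> cost (content 4 s') \<le> cost y))) \<and>
        bounded (S + n1 * C * S) s' \<and> t \<le> n1 * (C * (S + n1 * C * S + 2) + 1)"
      by (rule wp_exec[OF _ _ C(1) S(3,4,2)])
    then obtain t1 s1 where
      s1: "exec P s0 t1 s1" "inp s1" "bounded (S + n1 * C * S) s1" "t1 \<le> n1 * (C * (S + n1 * C * S + 2) + 1)"
      "if 0 < regs s1 10 then \<nexists>y. feas y
        else feas (content 4 s1) \<and> (\<forall>y. feas y \<longrightarrow> cost (content 4 s1) \<le> cost y)"
      by blast
    from wp_exec[OF wp_write_output[OF s1(2)] ctame_write_output C(2) s1(3) _ S(2)] obtain t2 s2 where
      s2: "exec (write_output q) s1 t2 s2"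
      "holds_output s2 (if 0 < regs s1 10 then [0] else 2 # map (content 4 s1) [0..<n * q])"
      "t2 \<le> (n * q * 3 + 5) * (C * (S + n1 * C * S + (n * q * 3 + 5) * C * S + 2) + 1)" by blast
    define v where "v = (\<lambda>k. vec q (\<lambda>j. content 4 s1 ((k - 1) * q + j)))"
    define out where "out = (if 0 < regs s1 10 then Infeasible else Optimal v)"
    have "encode_outcome n out = (if 0 < regs s1 10 then [0] else 2 # map (content 4 s1) [0..<n * q])"
      unfolding out_def v_def encoded_output[OF assms inst] by simp
    then have "computes_in (Seq P (write_output q)) (encode_input n b c) (t1 + t2) (encode_outcome n out)"
      using exec.Seq[OF s1(1) s2(1)] s2(2) unfolding computes_in_def s0_def by auto
    moreover have "t1 + t2 \<le> total_time p q L (length Ts) C n S"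
      using s1(4) s2(3) unfolding total_time_def n1_def by (rule add_mono)
    then have "t1 + t2 \<le> poly T (input_size n b c)" using T unfolding S_def by (rule order_trans)
    moreover have "correct_outcome A n b c out"
    proof -
      have flat: "feas y \<and> cost y = nfold_objective n c x"
        if x: "x \<in> nfold_feasible A n b" and y: "y = (\<lambda>i. x (Suc (i div q)) $ (i mod q))" for x y
      proof -
        have xc: "\<And>k. k \<in> {1..n} \<Longrightarrow> x k \<in> carrier_vec q" using x assms by (auto simp: nfold_feasible_def)
        have yx: "\<And>k j. k < n \<Longrightarrow> j < q \<Longrightarrow> y (k * q + j) = x (Suc k) $ j" by (simp add: y)
        from feasible_iff[OF assms inst xc yx] x show ?thesis unfolding feas_def cost_def unfolding a_def by simp
      qed
      have vc: "\<And>k. k \<in> {1..n} \<Longrightarrow> v k \<in> carrier_vec q" by (simp add: v_def)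
      have vy: "\<And>k j. k < n \<Longrightarrow> j < q \<Longrightarrow> content 4 s1 (k * q + j) = v (Suc k) $ j" by (simp add: v_def)
      note v = feasible_iff[OF assms inst vc vy]
      show ?thesis
      proof (cases "0 < regs s1 10")
        case True
        with s1(5) flat show ?thesis by (auto simp: out_def)
      next
        case False
        then have f: "feas (content 4 s1)" "\<And>y. feas y \<Longrightarrow> cost (content 4 s1) \<le> cost y" using s1(5) by auto
        have "v \<in> nfold_feasible A n b" using f(1) v(1) unfolding feas_def unfolding a_def by simp
        moreover have "nfold_objective n c v = cost (content 4 s1)" using v(2) unfolding cost_def by simp
        ultimately show ?thesis using False f(2) flat by (auto simp: out_def) metis
      qed
    qed
    ultimately show ?thesis by blast
  qed
  then show ?thesis by blast
qed

end
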